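(* Let $A$ be any language (oracle) and let $f$ be a time bound that is time-constructible and quasihomogeneous. If $\mathrm{DTIME}^A_b(f)\neq\mathrm{DTIME}^A(f)$ for every $b\in\mathbb{N}$, then $\mathrm{DTIME}^A(f)\neq\mathrm{NTIME}^A(f)$.
   Context: A time bound is a function $f:\mathbb{N}\to\mathbb{N}$ with $n\le f(n)\le f(n+1)$ for all $n$. An oracle Turing machine (deterministic or nondeterministic) has a separate read-only input tape, some number $b$ of work tapes, and an additional oracle tape on which queries "is $q\in A$?" to the oracle set $A$ can be put (the oracle tape is erased after each query). $\mathrm{DTIME}^A(f)$ (resp. $\mathrm{NTIME}^A(f)$) is the class of languages $L\subseteq\{0,1\}^*$ accepted by some deterministic (resp. nondeterministic) oracle TM with oracle $A$ with time complexity in $O(f)$; $\mathrm{DTIME}^A_b(f)$ uses only machines with $b$ work tapes. A time bound $g$ is time-constructible if some (oracle-free) DTM, on every input $w$, writes $1^{g(|w|)}$ on a work tape and halts within $O(g(|w|))$ steps. $f$ is subhomogeneous if for each $c\in\mathbb{N}_{+}$ there is $\bar c\in\mathbb{N}_{+}$ with $f(cn)\le\bar c f(n)$ for all $n\in\mathbb{N}_{+}$; superhomogeneous if for each $c\in\mathbb{N}_{+}$ there is $c'\in\mathbb{N}_{+}$ with $c f(n)\le f(c'n)$ for all $n\in\mathbb{N}_{+}$; quasihomogeneous if both. *)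

theory Defs
  imports Complex_Main "HOL-Library.Landau_Symbols"
begin

section \<open>Multitape oracle Turing machines\<close>

text \<open>
  Words are boolean lists and languages are sets of words. The read-only input tape holds
  the input word between two end markers that the head cannot leave. Work tapes are infinite in
  both directions. The oracle tape is write-only: bits are appended at its right end.
  States and work tape symbols are natural numbers; as a program is a finite set of
  instructions, only finitely many of them are used by any one machine.
\<close>

datatype input_symbol = Left_End | Bit bool | Right_End

datatype direction = Go_Left | Stay | Go_Right

abbreviation (input) blank :: nat where "blank \<equiv> 0"

text \<open>
  \<open>Step q x ys q' d acts out\<close>: in state \<open>q\<close>, reading \<open>x\<close> on the input tape and \<open>ys\<close> on the
  work tapes, go to state \<open>q'\<close>, move the input head in direction \<open>d\<close>, write on and move along
  the work tapes according to \<open>acts\<close>, and append to the oracle tape the bit in \<open>out\<close>, if any.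

  \<open>Query q y n\<close>: in state \<open>q\<close>, put the word on the oracle tape to the oracle, erase
  the oracle tape, and go to state \<open>y\<close> or \<open>n\<close> according to the answer. A query takes one step.
\<close>

datatype instruction =
    Step nat input_symbol "nat list" nat direction "(nat \<times> direction) list" "bool option"
  | Query nat nat nat

record machine =
  work_tapes :: nat
  start_state :: nat
  accept_state :: nat
  program :: "instruction set"

fun instruction_wf :: "nat \<Rightarrow> instruction \<Rightarrow> bool" where
  "instruction_wf b (Step q x ys q' d acts out) \<longleftrightarrow> length ys = b \<and> length acts = b"
| "instruction_wf b (Query q y n) \<longleftrightarrow> True"

definition turing_machine :: "machine \<Rightarrow> bool" where
  "turing_machine M \<longleftrightarrow>
     finite (program M) \<and> (\<forall>i\<in>program M. instruction_wf (work_tapes M) i)"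

fun applicable :: "instruction \<Rightarrow> nat \<Rightarrow> input_symbol \<Rightarrow> nat list \<Rightarrow> bool" where
  "applicable (Step q x ys q' d acts out) q0 x0 ys0 \<longleftrightarrow> q0 = q \<and> x0 = x \<and> ys0 = ys"
| "applicable (Query q y n) q0 x0 ys0 \<longleftrightarrow> q0 = q"

definition deterministic :: "machine \<Rightarrow> bool" where
  "deterministic M \<longleftrightarrow>
     (\<forall>i\<in>program M. \<forall>j\<in>program M. \<forall>q x ys.
        applicable i q x ys \<and> applicable j q x ys \<longrightarrow> i = j)"

text \<open>An oracle-free machine makes no use of the oracle tape at all.\<close>

fun instruction_oracle_free :: "instruction \<Rightarrow> bool" where
  "instruction_oracle_free (Step q x ys q' d acts out) \<longleftrightarrow> out = None"
| "instruction_oracle_free (Query q y n) \<longleftrightarrow> False"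

definition oracle_free :: "machine \<Rightarrow> bool" where
  "oracle_free M \<longleftrightarrow> (\<forall>i\<in>program M. instruction_oracle_free i)"


section \<open>Computations\<close>

text \<open>A work tape is given by its head position and the symbols in its cells.\<close>

type_synonym tape = "int \<times> (int \<Rightarrow> nat)"

record config =
  state :: nat
  input_head :: nat
  tapes :: "tape list"
  oracle_tape :: "bool list"

definition initial :: "machine \<Rightarrow> config" where
  "initial M =
     \<lparr> state = start_state M, input_head = 1,
       tapes = replicate (work_tapes M) (0, \<lambda>_. blank), oracle_tape = [] \<rparr>"

definition scan_input :: "bool list \<Rightarrow> nat \<Rightarrow> input_symbol" where
  "scan_input w p =
     (if p = 0 then Left_End else if p \<le> length w then Bit (w ! (p - 1)) else Right_End)"

fun scan_tape :: "tape \<Rightarrow> nat" where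
  "scan_tape (h, T) = T h"

text \<open>A move of the input head beyond an end marker has no effect.\<close>

fun move_input :: "bool list \<Rightarrow> direction \<Rightarrow> nat \<Rightarrow> nat" where
  "move_input w Go_Left p = p - 1"
| "move_input w Stay p = p"
| "move_input w Go_Right p = min (p + 1) (length w + 1)"

fun move_head :: "direction \<Rightarrow> int \<Rightarrow> int" where
  "move_head Go_Left h = h - 1"
| "move_head Stay h = h"
| "move_head Go_Right h = h + 1"

fun act_tape :: "nat \<times> direction \<Rightarrow> tape \<Rightarrow> tape" where
  "act_tape (s, d) (h, T) = (move_head d h, T(h := s))"

fun execute :: "bool list set \<Rightarrow> bool list \<Rightarrow> instruction \<Rightarrow> config \<Rightarrow> config" where
  "execute A w (Step q x ys q' d acts out) c =
     \<lparr> state = q', input_head = move_input w d (input_head c),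
       tapes = map2 act_tape acts (tapes c),
       oracle_tape = (case out of None \<Rightarrow> oracle_tape c | Some a \<Rightarrow> oracle_tape c @ [a]) \<rparr>"
| "execute A w (Query q y n) c =
     c\<lparr> state := (if oracle_tape c \<in> A then y else n), oracle_tape := [] \<rparr>"

definition step :: "bool list set \<Rightarrow> machine \<Rightarrow> bool list \<Rightarrow> config \<Rightarrow> config \<Rightarrow> bool" where
  "step A M w c c' \<longleftrightarrow>
     (\<exists>i\<in>program M.
        applicable i (state c) (scan_input w (input_head c)) (map scan_tape (tapes c)) \<and>
        c' = execute A w i c)"

definition halted :: "bool list set \<Rightarrow> machine \<Rightarrow> bool list \<Rightarrow> config \<Rightarrow> bool" where
  "halted A M w c \<longleftrightarrow> (\<nexists>c'. step A M w c c')"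

definition halts_in :: "bool list set \<Rightarrow> machine \<Rightarrow> bool list \<Rightarrow> config \<Rightarrow> bool" where
  "halts_in A M w c \<longleftrightarrow> (step A M w)\<^sup>*\<^sup>* (initial M) c \<and> halted A M w c"

definition accepts :: "bool list set \<Rightarrow> machine \<Rightarrow> bool list \<Rightarrow> bool" where
  "accepts A M w \<longleftrightarrow> (\<exists>c. halts_in A M w c \<and> state c = accept_state M)"

definition language :: "bool list set \<Rightarrow> machine \<Rightarrow> bool list set" where
  "language A M = {w. accepts A M w}"

text \<open>
  All computations count, accepting or not; in particular, a machine that runs within
  some time bound halts on every input along every computation.
\<close>

definition runs_within :: "bool list set \<Rightarrow> machine \<Rightarrow> (nat \<Rightarrow> nat) \<Rightarrow> bool" where
  "runs_within A M t \<longleftrightarrow>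
     (\<forall>w c k. (step A M w ^^ k) (initial M) c \<longrightarrow> k \<le> t (length w))"

definition runs_in_O :: "bool list set \<Rightarrow> machine \<Rightarrow> (nat \<Rightarrow> nat) \<Rightarrow> bool" where
  "runs_in_O A M f \<longleftrightarrow>
     (\<exists>t. runs_within A M t \<and> (\<lambda>n. real (t n)) \<in> O(\<lambda>n. real (f n)))"


section \<open>Complexity classes\<close>

definition DTIME_tapes :: "nat \<Rightarrow> bool list set \<Rightarrow> (nat \<Rightarrow> nat) \<Rightarrow> bool list set set" where
  "DTIME_tapes b A f =
     {language A M | M. turing_machine M \<and> deterministic M \<and> work_tapes M = b \<and> runs_in_O A M f}"

definition DTIME :: "bool list set \<Rightarrow> (nat \<Rightarrow> nat) \<Rightarrow> bool list set set" where
  "DTIME A f = {language A M | M. turing_machine M \<and> deterministic M \<and> runs_in_O A M f}"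

definition NTIME :: "bool list set \<Rightarrow> (nat \<Rightarrow> nat) \<Rightarrow> bool list set set" where
  "NTIME A f = {language A M | M. turing_machine M \<and> runs_in_O A M f}"


section \<open>Time bounds\<close>

definition time_bound :: "(nat \<Rightarrow> nat) \<Rightarrow> bool" where
  "time_bound f \<longleftrightarrow> (\<forall>n. n \<le> f n \<and> f n \<le> f (n + 1))"

text \<open>The tape contains \<open>1\<^sup>m\<close>, starting in an arbitrary cell, and is blank elsewhere.\<close>

definition tape_has_ones :: "nat \<Rightarrow> tape \<Rightarrow> bool" where
  "tape_has_ones m tp \<longleftrightarrow>
     (\<exists>p. \<forall>j. snd tp j = (if p \<le> j \<and> j < p + int m then 1 else blank))"

text \<open>The empty oracle is a dummy here, as the machine is oracle-free.\<close>

definition time_constructible :: "(nat \<Rightarrow> nat) \<Rightarrow> bool" where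
  "time_constructible g \<longleftrightarrow>
     (\<exists>M. turing_machine M \<and> deterministic M \<and> oracle_free M \<and> runs_in_O {} M g \<and>
          (\<exists>k<work_tapes M. \<forall>w. \<exists>c.
             halts_in {} M w c \<and> tape_has_ones (g (length w)) (tapes c ! k)))"

definition subhomogeneous :: "(nat \<Rightarrow> nat) \<Rightarrow> bool" where
  "subhomogeneous f \<longleftrightarrow> (\<forall>c\<ge>1. \<exists>c'\<ge>1. \<forall>n\<ge>1. f (c * n) \<le> c' * f n)"

definition superhomogeneous :: "(nat \<Rightarrow> nat) \<Rightarrow> bool" where
  "superhomogeneous f \<longleftrightarrow> (\<forall>c\<ge>1. \<exists>c'\<ge>1. \<forall>n\<ge>1. c * f n \<le> f (c' * n))"

definition quasihomogeneous :: "(nat \<Rightarrow> nat) \<Rightarrow> bool" where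
  "quasihomogeneous f \<longleftrightarrow> subhomogeneous f \<and> superhomogeneous f"

end

theory Submission
  imports Defs "HOL-Library.Nat_Bijection" "HOL-Library.Countable"
begin

text \<open>
  Suppose that deterministic and nondeterministic time coincide. A universal nondeterministic
  machine with a fixed number of tapes then decides a language that some deterministic machine
  \<open>D\<close> decides in time \<open>O(f)\<close>, say with \<open>b\<close> work tapes. Every other language in the class
  reduces to it by a block code \<open>w \<mapsto> h(w\<^sub>1) \<dots> h(w\<^sub>n) e\<close> with blocks of constant length, and such an
  encoded input can be read off \<open>w\<close> on the fly, in lockstep with \<open>D\<close> and without additional
  tapes. Hence \<open>b\<close> tapes suffice for the whole class.

  The universal machine guesses a trace of the computation and checks one tape at a time, so that
  it needs just one tape for the check; one-hot encoding splits every tape into tracks of bits, and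
  the state and the input are treated as further tapes. A sweep over the trace that checks one track
  is followed by a backward sweep that undoes it. The machine that constructs \<open>f\<close> runs in lockstep
  as a clock. Superhomogeneity lets padding absorb the overhead of the simulation, and
  subhomogeneity bounds the time of \<open>D\<close> on the padded inputs.
\<close>

section \<open>Accepting states without instructions\<close>

text \<open>The obstacle is that the simulated machine may have any number of tapes, whereas the
  simulator has a fixed number and may lose only a constant factor in time. Once a trace fixes what
  is read and written on every tape, the tapes no longer interact, so their histories can be
  verified separately, in a number of sweeps that depends on the simulated machine only. The trace
  also suffices to clean the bit tape, since every operation names the overwritten bit and the move.
  Oracle answers are guessed as part of the trace and confirmed by real queries in one of the
  sweeps. A time bound counts wrong guesses and malformed inputs too, so termination has to come
  from the clock and not from the checker. The block length is constant for each simulated machine: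
  it can be chosen large enough to give the clock the required constant factor of additional time,
  and the offset in a block still fits into the finite control.\<close>

fun source :: "instruction \<Rightarrow> nat" where
  "source (Step q x ys q' d acts out) = q"
| "source (Query q y n) = q"

fun targets :: "instruction \<Rightarrow> nat set" where
  "targets (Step q x ys q' d acts out) = {q'}"
| "targets (Query q y n) = {y, n}"

fun written :: "instruction \<Rightarrow> nat set" where
  "written (Step q x ys q' d acts out) = fst ` set acts"
| "written (Query q y n) = {}"

text \<open>No instruction leaves the accept state, so acceptance becomes mere reachability of that
  state and simulations need not reproduce the halting condition.\<close>

definition accept_sink :: "machine \<Rightarrow> bool" where
  "accept_sink M \<longleftrightarrow> (\<forall>i\<in>program M. source i \<noteq> accept_state M)"

text \<open>A finite bound on the symbols that can appear on the work tapes; 0 is included for the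
  initial blanks. It keeps the number of possible readings finite.\<close>

definition alphabet :: "machine \<Rightarrow> nat set" where
  "alphabet M = insert 0 (\<Union>i\<in>program M. written i)"

lemma applicable_source: "applicable i q x ys \<Longrightarrow> source i = q"
  by (cases i) auto

lemma finite_input_symbol: "finite (UNIV :: input_symbol set)"
proof -
  have "(UNIV :: input_symbol set) \<subseteq> {Left_End, Right_End, Bit True, Bit False}"
    by (auto, metis input_symbol.exhaust)
  then show ?thesis by (rule finite_subset) simp
qed

lemma finite_alphabet: "turing_machine M \<Longrightarrow> finite (alphabet M)"
proof -
  have "finite (written i)" for i by (cases i) auto
  then show "turing_machine M \<Longrightarrow> finite (alphabet M)"
    by (auto simp: alphabet_def turing_machine_def)
qed

lemma accept_sink_halted:
  "accept_sink M \<Longrightarrow> state c = accept_state M \<Longrightarrow> halted A M w c"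
  by (auto simp: accept_sink_def halted_def step_def dest: applicable_source)

lemma length_tapes_step:
  assumes "turing_machine M" "step A M w c c'" "length (tapes c) = work_tapes M"
  shows "length (tapes c') = work_tapes M"
proof -
  obtain i where i: "i \<in> program M" "c' = execute A w i c"
    using assms by (auto simp: step_def)
  then have "instruction_wf (work_tapes M) i" using assms by (auto simp: turing_machine_def)
  with i assms show ?thesis by (cases i) auto
qed

lemma length_tapes_reach:
  assumes "turing_machine M" "(step A M w)\<^sup>*\<^sup>* (initial M) c"
  shows "length (tapes c) = work_tapes M"
  using assms(2)
  by (induction rule: rtranclp_induct) (auto simp: initial_def length_tapes_step[OF assms(1)])

lemma alphabet_act:
  fixes tps :: "tape list"
  assumes "\<And>tp j. tp \<in> set tps \<Longrightarrow> snd tp j \<in> S" "fst ` set acts \<subseteq> S" "tp \<in> set (map2 act_tape acts tps)"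
  shows "snd tp j \<in> S"
proof -
  obtain a t where at: "(a, t) \<in> set (zip acts tps)" "tp = act_tape a t" using assms(3) by auto
  then have "a \<in> set acts" "t \<in> set tps" by (auto dest: set_zip_leftD set_zip_rightD)
  with assms(1)[of t] assms(2) at(2) show ?thesis
    by (cases a; cases t) (auto simp: fun_upd_def)
qed

lemma alphabet_reach:
  assumes "(step A M w)\<^sup>*\<^sup>* (initial M) c" "tp \<in> set (tapes c)"
  shows "snd tp j \<in> alphabet M"
  using assms
proof (induction arbitrary: tp j rule: rtranclp_induct)
  case base
  then show ?case by (auto simp: initial_def alphabet_def)
next
  case (step c c')
  then obtain i where i: "i \<in> program M" "c' = execute A w i c"
    by (auto simp: step_def)
  show ?case
  proof (cases i)
    case (Step q x ys q' d acts out)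
    have "fst ` set acts \<subseteq> alphabet M" using i Step by (force simp: alphabet_def)
    then show ?thesis using alphabet_act[OF step.IH, where acts=acts and tp=tp and j=j] i Step step.prems by auto
  next
    case (Query q y n)
    then show ?thesis using i step by auto
  qed
qed

lemma state_reach:
  assumes "(step A M w)\<^sup>*\<^sup>* (initial M) c"
  shows "state c \<in> insert (start_state M) (\<Union>i\<in>program M. targets i)"
  using assms
proof (induction rule: rtranclp_induct)
  case base
  then show ?case by (auto simp: initial_def)
next
  case (step c c')
  then obtain i where i: "i \<in> program M" "c' = execute A w i c"
    by (auto simp: step_def)
  then show ?case by (cases i) force+
qed

lemma map2_act_tape_Stay: "map2 act_tape (map (\<lambda>s. (s, Stay)) (map scan_tape tps)) tps = tps"
  by (induction tps) auto

text \<open>A fresh state \<open>F\<close> becomes accepting, and a step into it is added exactly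
  for those readings on which the old accept state is stuck. This preserves determinism and costs
  one step.\<close>

lemma ex_accept_sink:
  assumes tm: "turing_machine M"
  shows "\<exists>N. turing_machine N \<and> (deterministic M \<longrightarrow> deterministic N) \<and> work_tapes N = work_tapes M
     \<and> accept_sink N \<and> language A N = language A M
     \<and> (\<forall>t. runs_within A M t \<longrightarrow> runs_within A N (\<lambda>n. t n + 1))"
proof -
  define S where "S = insert (start_state M) (\<Union>i\<in>program M. insert (source i) (targets i))"
  have fin: "finite (program M)" using tm by (auto simp: turing_machine_def)
  have "finite (targets i)" for i by (cases i) auto
  then have "finite S" using fin by (auto simp: S_def)
  \<comment> \<open>\<open>accept_state M\<close> is excluded separately, as it may fail to occur in
    \<open>S\<close>.\<close>
  then obtain F where F: "F \<notin> S" "F \<noteq> accept_state M"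
    using ex_new_if_finite[of "insert (accept_state M) S"] by auto
  define E where "E = {(x, ys). set ys \<subseteq> alphabet M \<and> length ys = work_tapes M
     \<and> (\<forall>i\<in>program M. \<not> applicable i (accept_state M) x ys)}"
  define final where "final = (\<lambda>(x, ys). Step (accept_state M) x ys F Stay (map (\<lambda>s. (s, Stay)) ys) None)"
  define N where "N = M\<lparr>accept_state := F, program := program M \<union> final ` E\<rparr>"
  have "E \<subseteq> UNIV \<times> {ys. set ys \<subseteq> alphabet M \<and> length ys = work_tapes M}"
    by (auto simp: E_def)
  then have finE: "finite E"
    by (rule finite_subset) (intro finite_cartesian_product finite_input_symbol
        finite_lists_length_eq finite_alphabet[OF tm])
  have tmN: "turing_machine N"
    using tm finE by (auto simp: turing_machine_def N_def final_def E_def)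
  have detN: "deterministic N" if "deterministic M"
    unfolding deterministic_def
  proof (intro ballI allI impI)
    fix i j q x ys
    assume "i \<in> program N" "j \<in> program N" and app: "applicable i q x ys \<and> applicable j q x ys"
    then consider "i \<in> program M" "j \<in> program M" | "i \<in> program M" "j \<in> final ` E"
      | "i \<in> final ` E" "j \<in> program M" | "i \<in> final ` E" "j \<in> final ` E"
      by (auto simp: N_def)
    then show "i = j"
    proof cases
      case 1
      with that app show ?thesis unfolding deterministic_def by metis
    qed (use app in \<open>auto simp: final_def E_def\<close>)
  qed
  have sink: "accept_sink N"
    unfolding accept_sink_def
  proof
    fix i assume "i \<in> program N"
    then consider "i \<in> program M" | "source i = accept_state M" by (auto simp: N_def final_def)
    then show "source i \<noteq> accept_state N"
      by cases (use F in \<open>auto simp: N_def S_def\<close>)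
  qed
  have init: "initial N = initial M" by (simp add: initial_def N_def)
  have stepI: "step A N w c c'" if "step A M w c c'" for w c c'
    using that by (auto simp: step_def N_def)
  have stepF: "step A N w c (c\<lparr>state := F\<rparr>)"
    if r: "(step A M w)\<^sup>*\<^sup>* (initial M) c" and h: "halted A M w c" "state c = accept_state M" for w c
  proof -
    have "(scan_input w (input_head c), map scan_tape (tapes c)) \<in> E"
    proof -
      have "scan_tape tp \<in> alphabet M" if "tp \<in> set (tapes c)" for tp
        using alphabet_reach[OF r that] by (cases tp) auto
      moreover have "\<not> applicable i (accept_state M) (scan_input w (input_head c)) (map scan_tape (tapes c))"
        if "i \<in> program M" for i
        using h that unfolding halted_def step_def by auto
      ultimately show ?thesis using length_tapes_reach[OF tm r] by (auto simp: E_def)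
    qed
    then have "final (scan_input w (input_head c), map scan_tape (tapes c)) \<in> program N"
      by (auto simp: N_def)
    moreover have "c\<lparr>state := F\<rparr> = execute A w (final (scan_input w (input_head c), map scan_tape (tapes c))) c"
      unfolding final_def by (simp add: map2_act_tape_Stay del: map_map)
    ultimately show ?thesis
      unfolding step_def by (intro bexI conjI) (auto simp: final_def h)
  qed
  have stepE: "step A M w c c' \<or> halted A M w c \<and> state c = accept_state M \<and> c' = c\<lparr>state := F\<rparr>"
    if r: "(step A M w)\<^sup>*\<^sup>* (initial M) c" and st: "step A N w c c'" for w c c'
  proof -
    obtain i where i: "i \<in> program N" "c' = execute A w i c"
      "applicable i (state c) (scan_input w (input_head c)) (map scan_tape (tapes c))"
      using st by (auto simp: step_def)
    show ?thesis
    proof (cases "i \<in> program M")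
      case True
      with i show ?thesis by (auto simp: step_def)
    next
      case False
      then obtain x ys where xy: "(x, ys) \<in> E" "i = final (x, ys)" using i by (auto simp: N_def)
      then have "ys = map scan_tape (tapes c)" "x = scan_input w (input_head c)" "state c = accept_state M"
        using i(3) by (auto simp: final_def)
      then show ?thesis using i(2) xy unfolding halted_def step_def E_def final_def
        by (auto simp: map2_act_tape_Stay simp del: map_map)
    qed
  qed
  have noF: "\<not> step A N w c c'" if "state c = F" for w c c'
    using accept_sink_halted[OF sink, of c A w] that by (auto simp: halted_def N_def)
  have stM: "state c \<noteq> F" if "(step A M w)\<^sup>*\<^sup>* (initial M) c" for w c
    using state_reach[OF that] F by (auto simp: S_def)
  \<comment> \<open>A run of \<open>N\<close> is a run of \<open>M\<close>, possibly followed by a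
    single step from an accepting halt into \<open>F\<close>.\<close>
  have path: "(step A M w ^^ k) (initial M) c \<or> (\<exists>j c0. k = Suc j \<and> (step A M w ^^ j) (initial M) c0
      \<and> halted A M w c0 \<and> state c0 = accept_state M \<and> c = c0\<lparr>state := F\<rparr>)"
    if "(step A N w ^^ k) (initial M) c" for w k c
    using that
  proof (induction k arbitrary: c)
    case (Suc k)
    then obtain d where d: "(step A N w ^^ k) (initial M) d" "step A N w d c" by auto
    from Suc.IH[OF d(1)] noF d(2) have M: "(step A M w ^^ k) (initial M) d" by auto
    then have "(step A M w)\<^sup>*\<^sup>* (initial M) d" by (rule relpowp_imp_rtranclp)
    from stepE[OF this d(2)] M show ?case by auto
  qed auto
  have "language A N = language A M"
  proof (intro set_eqI iffI)
    fix w assume "w \<in> language A N"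
    then obtain c where c: "(step A N w)\<^sup>*\<^sup>* (initial M) c" "state c = F"
      by (auto simp: language_def accepts_def halts_in_def init) (simp add: N_def)
    then obtain k where k: "(step A N w ^^ k) (initial M) c" by (auto simp: rtranclp_power)
    have "\<not> (step A M w ^^ k) (initial M) c" using stM c(2) by (metis relpowp_imp_rtranclp)
    with path[OF k] show "w \<in> language A M"
      by (auto simp: language_def accepts_def halts_in_def dest: relpowp_imp_rtranclp)
  next
    fix w assume "w \<in> language A M"
    then obtain c where c: "(step A M w)\<^sup>*\<^sup>* (initial M) c" "halted A M w c" "state c = accept_state M"
      by (auto simp: language_def accepts_def halts_in_def)
    have "(step A N w)\<^sup>*\<^sup>* (initial M) c" using c(1) by (rule rtranclp_mono[THEN predicate2D, rotated]) (auto intro: stepI)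
    then have "(step A N w)\<^sup>*\<^sup>* (initial N) (c\<lparr>state := F\<rparr>)" using stepF[OF c] init by auto
    moreover have "halted A N w (c\<lparr>state := F\<rparr>)" using noF by (auto simp: halted_def)
    ultimately show "w \<in> language A N"
      unfolding language_def accepts_def halts_in_def
      by (auto intro!: exI[of _ "c\<lparr>state := F\<rparr>"]) (simp add: N_def)
  qed
  moreover have "runs_within A N (\<lambda>n. t n + 1)" if "runs_within A M t" for t
    unfolding runs_within_def init
  proof (intro allI impI)
    fix w c k assume "(step A N w ^^ k) (initial M) c"
    from path[OF this] that show "k \<le> t (length w) + 1"
      by (auto simp: runs_within_def) (metis le_SucI)
  qed
  ultimately show ?thesis using tmN detN sink
    by (intro exI[of _ N]) (auto simp: N_def)
qed

section \<open>Inverse images under block codes\<close>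

locale block_code =
  fixes D :: machine and h :: "bool \<Rightarrow> bool list" and e :: "bool list" and c :: nat
  assumes tm: "turing_machine D" and sink: "accept_sink D"
    and len_h: "\<And>a. length (h a) = c" and len_e: "length e = c - 1" and pos: "c > 0"
begin

text \<open>The tail \<open>e\<close> has length \<open>c - 1\<close>, so that together with the
  right end marker it fills a last block of length \<open>c\<close>, which corresponds to the cell
  \<open>Right_End\<close> of \<open>w\<close>.\<close>

definition code :: "bool list \<Rightarrow> bool list" where
  "code w = concat (map h w) @ e"

fun block_symbol :: "input_symbol \<Rightarrow> nat \<Rightarrow> input_symbol" where
  "block_symbol Left_End k = Left_End"
| "block_symbol (Bit a) k = Bit (h a ! k)"
| "block_symbol Right_End k = (if k < c - 1 then Bit (e ! k) else Right_End)"

text \<open>The left end marker has no block, so at \<open>p = 0\<close> the offset is ignored.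
  Offsets count from 0 while the code starts in cell 1, whence the \<open>+ 1\<close>.\<close>

definition block_position :: "nat \<Rightarrow> nat \<Rightarrow> nat" where
  "block_position p k = (if p = 0 then 0 else (p - 1) * c + k + 1)"

text \<open>Only a move across a block boundary moves the real head. A block entered from the left
  starts at offset 0, one entered from the right at \<open>c - 1\<close>. At
  \<open>Right_End\<close> the last offset is the end marker of the code, so a move to the right has
  no effect there.\<close>

fun block_move :: "direction \<Rightarrow> input_symbol \<Rightarrow> nat \<Rightarrow> direction \<times> nat" where
  "block_move Stay x k = (Stay, k)"
| "block_move Go_Right x k =
     (if x = Left_End then (Go_Right, 0)
      else if k + 1 < c then (Stay, k + 1)
      else if x = Right_End then (Stay, k) else (Go_Right, 0))"
| "block_move Go_Left x k =
     (if x = Left_End then (Stay, k) else if k > 0 then (Stay, k - 1) else (Go_Left, c - 1))"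

text \<open>The offset in the block is dropped in the accepting state, which has to be unique.\<close>

definition block_state :: "nat \<Rightarrow> nat \<Rightarrow> nat" where
  "block_state q k = prod_encode (q, if q = accept_state D then 0 else k)"

fun block_instruction :: "input_symbol \<Rightarrow> nat \<Rightarrow> instruction \<Rightarrow> instruction set" where
  "block_instruction x k (Step q y ys q' d acts out) =
     (if y = block_symbol x k
      then {Step (block_state q k) x ys (block_state q' (snd (block_move d x k))) (fst (block_move d x k)) acts out}
      else {})"
| "block_instruction x k (Query q y n) = {Query (block_state q k) (block_state y k) (block_state n k)}"

definition block_machine :: machine where
  "block_machine = \<lparr>work_tapes = work_tapes D, start_state = block_state (start_state D) 0,
     accept_state = block_state (accept_state D) 0,
     program = (\<Union>i\<in>program D. \<Union>k<c. \<Union>x. block_instruction x k i)\<rparr>"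

lemma length_code: "length (code w) = c * length w + (c - 1)"
proof -
  have "length (concat (map h w)) = c * length w"
    by (induction w) (auto simp: len_h)
  then show ?thesis by (simp add: code_def len_e)
qed

lemma nth_concat_h: "i < length w \<Longrightarrow> k < c \<Longrightarrow> concat (map h w) ! (i * c + k) = h (w ! i) ! k"
proof (induction w arbitrary: i)
  case (Cons a w)
  then show ?case by (cases i) (auto simp: nth_append len_h add.assoc)
qed simp

lemma scan_code:
  assumes "p \<le> length w + 1" "k < c"
  shows "scan_input (code w) (block_position p k) = block_symbol (scan_input w p) k"
proof -
  have len: "length (concat (map h w)) = c * length w"
    by (induction w) (auto simp: len_h)
  consider "p = 0" | "1 \<le> p" "p \<le> length w" | "p = length w + 1" using assms by linarith
  then show ?thesis
  proof cases
    case 1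
    then show ?thesis by (simp add: block_position_def scan_input_def)
  next
    case 2
    then have lt: "(p - 1) * c + k < c * length w"
    proof -
      have "(p - 1) * c + k < (p - 1) * c + c" using assms by simp
      also have "\<dots> = p * c" using 2 by (cases p) auto
      also have "\<dots> \<le> length w * c" using 2 by simp
      finally show ?thesis by (simp add: mult.commute)
    qed
    then have "code w ! ((p - 1) * c + k) = h (w ! (p - 1)) ! k"
      using nth_concat_h[of "p - 1" w k] 2 assms by (auto simp: code_def nth_append len)
    then show ?thesis using 2 lt by (simp add: block_position_def scan_input_def length_code)
  next
    case 3
    then show ?thesis using assms
      by (auto simp: block_position_def scan_input_def length_code code_def nth_append len len_e mult.commute)
  qed
qed

lemma move_code:
  assumes "p \<le> length w + 1" "k < c" "block_move d (scan_input w p) k = (d', k')"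
  shows "move_input w d' p \<le> length w + 1" "k' < c"
    "move_input (code w) d (block_position p k) = block_position (move_input w d' p) k'"
proof -
  have le: "(p - 1) * c + c \<le> c * length w" if "1 \<le> p" "p \<le> length w"
  proof -
    have "(p - 1) * c + c = p * c" using that by (cases p) auto
    also have "\<dots> \<le> length w * c" using that by simp
    finally show ?thesis by (simp add: mult.commute)
  qed
  have "move_input w d' p \<le> length w + 1 \<and> k' < c \<and>
    move_input (code w) d (block_position p k) = block_position (move_input w d' p) k'"
  proof -
    consider "p = 0" | "1 \<le> p" "p \<le> length w" | "p = length w + 1" using assms by linarith
    then show ?thesis
    proof cases
      case 1
      then show ?thesis using assms pos
        by (cases d) (auto simp: block_position_def scan_input_def split: if_splits)
    next
      case 2
      then obtain p' where p': "p = Suc p'" by (cases p) auto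
      have *: "c + p' * c \<le> c * length w" using le 2 p' by (simp add: add.commute)
      show ?thesis
      proof (cases d)
        case Go_Left
        then show ?thesis using assms 2 p' pos
          by (cases p') (auto simp: block_position_def scan_input_def split: if_splits)
      next
        case Stay
        then show ?thesis using assms 2 p' by (auto simp: block_position_def)
      next
        case Go_Right
        then show ?thesis using assms 2 p' pos *
          by (auto simp: block_position_def scan_input_def length_code split: if_splits)
      qed
    next
      case 3
      then show ?thesis using assms pos
        by (cases d; cases "length w")
          (auto simp: block_position_def scan_input_def length_code min_def mult.commute split: if_splits)
    qed
  qed
  then show "move_input w d' p \<le> length w + 1" "k' < c"
    "move_input (code w) d (block_position p k) = block_position (move_input w d' p) k'" by auto
qed

text \<open>The accept state is a sink and hence never the source of an instruction, so the loss of
  its offset does no harm.\<close>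

lemma block_state_eq:
  "q \<noteq> accept_state D \<Longrightarrow> block_state q k = block_state q' k' \<Longrightarrow> q = q' \<and> k = k'"
  "block_state q k = block_state q' k' \<Longrightarrow> q = q'"
  by (auto simp: block_state_def split: if_splits)

text \<open>The record update leaves work tapes and oracle tape identical, which is why the
  simulation takes no additional tape and no additional step.\<close>

definition simulates :: "bool list \<Rightarrow> config \<Rightarrow> config \<Rightarrow> bool" where
  "simulates w c' d \<longleftrightarrow> (\<exists>p k. p \<le> length w + 1 \<and> k < c \<and>
     c' = d\<lparr>state := block_state (state d) k, input_head := p\<rparr> \<and> input_head d = block_position p k)"

lemma simulates_initial: "simulates w (initial block_machine) (initial D)"
  unfolding simulates_def
  by (rule exI[of _ 1], rule exI[of _ 0]) (auto simp: initial_def block_machine_def block_position_def pos)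

lemma block_step:
  assumes sim: "simulates w c' d" and st: "step A D (code w) d d'"
  shows "\<exists>c''. step A block_machine w c' c'' \<and> simulates w c'' d'"
proof -
  obtain p k where pk: "p \<le> length w + 1" "k < c"
    "c' = d\<lparr>state := block_state (state d) k, input_head := p\<rparr>" "input_head d = block_position p k"
    using sim by (auto simp: simulates_def)
  obtain i where i: "i \<in> program D" "d' = execute A (code w) i d"
    "applicable i (state d) (block_symbol (scan_input w p) k) (map scan_tape (tapes d))"
    using st pk scan_code by (auto simp: step_def)
  show ?thesis
  proof (cases i)
    case (Step q y ys q' dir acts out)
    obtain d1 k1 where bm: "block_move dir (scan_input w p) k = (d1, k1)" by fastforce
    let ?j = "Step (block_state q k) (scan_input w p) ys (block_state q' k1) d1 acts out"
    have "?j \<in> block_instruction (scan_input w p) k i" using i Step bm by auto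
    then have "?j \<in> program block_machine" using i(1) pk(2) by (auto simp: block_machine_def)
    then have "step A block_machine w c' (execute A w ?j c')"
      unfolding step_def using i Step pk by (intro bexI[of _ ?j]) auto
    moreover have "simulates w (execute A w ?j c') d'"
      unfolding simulates_def using move_code[OF pk(1,2) bm] pk i Step
      by (rule_tac exI[of _ "move_input w d1 p"], rule_tac exI[of _ k1]) (auto split: option.splits)
    ultimately show ?thesis by blast
  next
    case (Query q y n)
    let ?j = "Query (block_state q k) (block_state y k) (block_state n k)"
    have "?j \<in> block_instruction (scan_input w p) k i" using Query by auto
    then have "?j \<in> program block_machine" using i(1) pk(2) by (auto simp: block_machine_def)
    then have "step A block_machine w c' (execute A w ?j c')"
      unfolding step_def using i Query pk by (intro bexI[of _ ?j]) auto
    moreover have "simulates w (execute A w ?j c') d'"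
      unfolding simulates_def using pk i Query by (rule_tac exI[of _ p], rule_tac exI[of _ k]) auto
    ultimately show ?thesis by blast
  qed
qed

text \<open>The converse simulation is needed because the running time refers to all computations.
  Source state and offset can be recovered from the state code, as the source is not the accept
  state.\<close>

lemma block_step_inverse:
  assumes sim: "simulates w c' d" and st: "step A block_machine w c' c''"
  shows "\<exists>d'. step A D (code w) d d' \<and> simulates w c'' d'"
proof -
  obtain p k where pk: "p \<le> length w + 1" "k < c"
    "c' = d\<lparr>state := block_state (state d) k, input_head := p\<rparr>" "input_head d = block_position p k"
    using sim by (auto simp: simulates_def)
  obtain i j x l where j: "i \<in> program D" "j \<in> block_instruction x l i" "l < c"
    "applicable j (block_state (state d) k) (scan_input w p) (map scan_tape (tapes d))"
    "c'' = execute A w j c'"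
    using st pk by (auto simp: step_def block_machine_def)
  have src: "source i \<noteq> accept_state D" using sink j by (auto simp: accept_sink_def)
  show ?thesis
  proof (cases i)
    case (Step q y ys q' dir acts out)
    obtain d1 k1 where bm: "block_move dir (scan_input w p) k = (d1, k1)" by fastforce
    have bs: "block_state q l = block_state (state d) k" "x = scan_input w p" "y = block_symbol x l"
      "ys = map scan_tape (tapes d)"
      using j(2,4) Step by (auto split: if_splits)
    have "q \<noteq> accept_state D" using src Step by simp
    from block_state_eq(1)[OF this bs(1)] have eq: "q = state d" "l = k" "x = scan_input w p"
      "y = block_symbol x k" "ys = map scan_tape (tapes d)" using bs by auto
    have "step A D (code w) d (execute A (code w) i d)"
      unfolding step_def using j(1) Step eq scan_code[OF pk(1,2)] pk(4) by (intro bexI[of _ i]) auto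
    moreover have "simulates w c'' (execute A (code w) i d)"
      unfolding simulates_def using move_code[OF pk(1,2) bm] pk j Step bm eq
      by (rule_tac exI[of _ "move_input w d1 p"], rule_tac exI[of _ k1]) (auto split: option.splits if_splits)
    ultimately show ?thesis by blast
  next
    case (Query q y n)
    have bs: "block_state q l = block_state (state d) k" using j(2,4) Query by auto
    have "q \<noteq> accept_state D" using src Query by simp
    from block_state_eq(1)[OF this bs] have eq: "q = state d" "l = k" by auto
    have "step A D (code w) d (execute A (code w) i d)"
      unfolding step_def using j(1) Query eq by (intro bexI[of _ i]) auto
    moreover have "simulates w c'' (execute A (code w) i d)"
      unfolding simulates_def using pk j Query eq by (rule_tac exI[of _ p], rule_tac exI[of _ k]) auto
    ultimately show ?thesis by blast
  qed
qed

lemma block_path: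
  "(step A D (code w) ^^ n) (initial D) d \<Longrightarrow>
   \<exists>c'. (step A block_machine w ^^ n) (initial block_machine) c' \<and> simulates w c' d"
proof (induction n arbitrary: d)
  case 0
  then show ?case using simulates_initial by auto
next
  case (Suc n)
  then obtain d0 where "(step A D (code w) ^^ n) (initial D) d0" "step A D (code w) d0 d" by auto
  with Suc.IH obtain c' where "(step A block_machine w ^^ n) (initial block_machine) c'" "simulates w c' d0"
    by blast
  with block_step[OF this(2) \<open>step A D (code w) d0 d\<close>] show ?case by auto
qed

lemma block_path_inverse:
  "(step A block_machine w ^^ n) (initial block_machine) c' \<Longrightarrow>
   \<exists>d. (step A D (code w) ^^ n) (initial D) d \<and> simulates w c' d"
proof (induction n arbitrary: c')
  case 0
  then show ?case using simulates_initial by auto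
next
  case (Suc n)
  then obtain c0 where c0: "(step A block_machine w ^^ n) (initial block_machine) c0"
    "step A block_machine w c0 c'" by auto
  with Suc.IH obtain d where "(step A D (code w) ^^ n) (initial D) d" "simulates w c0 d"
    by blast
  with block_step_inverse[OF this(2) c0(2)] show ?case by auto
qed

lemma accept_sink_block_machine: "accept_sink block_machine"
proof -
  have "source j = block_state (source i) k" if "j \<in> block_instruction x k i" for i j k x
    using that by (cases i) (auto split: if_splits)
  then show ?thesis using sink
    by (auto simp: accept_sink_def block_machine_def dest!: block_state_eq(2))
qed

lemma simulates_accept:
  "simulates w c' d \<Longrightarrow> state c' = accept_state block_machine \<longleftrightarrow> state d = accept_state D"
  by (auto simp: simulates_def block_machine_def block_state_def)

lemma language_block_machine: "language A block_machine = {w. code w \<in> language A D}"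
proof -
  have *: "accepts A M w \<longleftrightarrow> (\<exists>n c. (step A M w ^^ n) (initial M) c \<and> state c = accept_state M)"
    if "accept_sink M" for M w
    using accept_sink_halted[OF that] by (auto simp: accepts_def halts_in_def rtranclp_power)
  have "accepts A block_machine w \<longleftrightarrow> accepts A D (code w)" for w
  proof
    assume "accepts A block_machine w"
    then obtain n c where c: "(step A block_machine w ^^ n) (initial block_machine) c"
      "state c = accept_state block_machine" unfolding *[OF accept_sink_block_machine] by blast
    from block_path_inverse[OF c(1)] obtain d where
      "(step A D (code w) ^^ n) (initial D) d" "simulates w c d" by blast
    with c(2) simulates_accept show "accepts A D (code w)" unfolding *[OF sink] by blast
  next
    assume "accepts A D (code w)"
    then obtain n d where d: "(step A D (code w) ^^ n) (initial D) d"
      "state d = accept_state D" unfolding *[OF sink] by blast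
    from block_path[OF d(1)] obtain c where
      "(step A block_machine w ^^ n) (initial block_machine) c" "simulates w c d" by blast
    with d(2) simulates_accept show "accepts A block_machine w"
      unfolding *[OF accept_sink_block_machine] by blast
  qed
  then show ?thesis by (simp add: language_def)
qed

lemma turing_machine_block_machine: "turing_machine block_machine"
proof -
  have "finite (block_instruction x k i)" for x k i by (cases i) auto
  moreover have "instruction_wf b j" if "instruction_wf b i" "j \<in> block_instruction x k i" for b i j x k
    using that by (cases i) (auto split: if_splits)
  ultimately show ?thesis
    using tm finite_input_symbol unfolding turing_machine_def block_machine_def by simp blast
qed

text \<open>The state determines the simulated state and the offset, and the offset and the scanned
  symbol determine the simulated symbol; so two applicable instructions stem from one instruction of
  \<open>D\<close>.\<close>

lemma deterministic_block_machine:
  assumes det: "deterministic D"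
  shows "deterministic block_machine"
  unfolding deterministic_def
proof (intro ballI allI impI)
  fix j j' s x ys
  assume "j \<in> program block_machine" "j' \<in> program block_machine"
    and app: "applicable j s x ys \<and> applicable j' s x ys"
  then obtain i i' k k' y y' where
    i: "i \<in> program D" "j \<in> block_instruction y k i" and
    i': "i' \<in> program D" "j' \<in> block_instruction y' k' i'"
    by (auto simp: block_machine_def)
  have src: "source i \<noteq> accept_state D"
    using i i' sink by (auto simp: accept_sink_def)
  have *: "s = block_state (source i) k \<and> applicable i (source i) (block_symbol x k) ys
      \<and> j \<in> block_instruction x k i"
    if "j \<in> block_instruction y k i" "applicable j s x ys" for i j y k
    using that by (cases i) (auto split: if_splits)
  have j: "s = block_state (source i) k" "applicable i (source i) (block_symbol x k) ys"
    "j \<in> block_instruction x k i" using *[OF i(2)] app by auto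
  have j': "s = block_state (source i') k'" "applicable i' (source i') (block_symbol x k') ys"
    "j' \<in> block_instruction x k' i'" using *[OF i'(2)] app by auto
  have eq: "source i = source i'" "k = k'"
    using block_state_eq(1)[OF src, of k "source i'" k'] j(1) j'(1) by auto
  then have "i = i'" using j(2) j'(2) det i(1) i'(1) unfolding deterministic_def by metis
  then show "j = j'" using j(3) j'(3) eq by (cases i) (auto split: if_splits)
qed

lemma runs_within_block_machine:
  "runs_within A D t \<Longrightarrow> runs_within A block_machine (\<lambda>n. t (c * n + (c - 1)))"
  using block_path_inverse unfolding runs_within_def by (metis length_code)

end

section \<open>Checking a trace track by track\<close>

text \<open>What one letter of the trace does on one track. \<open>RW\<close> lists the expected
  bit, the new bit and the move, so that it can be undone; \<open>Ask\<close> carries the guessed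
  answer of the oracle.\<close>

datatype op = Nop | RW bool bool direction | Out bool | Ask bool

text \<open>\<open>Sep f\<close> opens a block, with \<open>f\<close> set for a final one.
  \<open>Cur\<close> marks the operation executed in the current sweep, so that it is found on the
  way back.\<close>

datatype symbol = Blank | Sep bool | Fresh op | Cur op | Done

datatype control =
    RewP | Choose | Copy bool | RewT | Forward | Seek | Asking bool | Backward | Restore bool | Accept | Reject

type_synonym 'a ptape = "int \<times> (int \<Rightarrow> 'a)"

fun scan :: "'a ptape \<Rightarrow> 'a" where
  "scan (h, T) = T h"

fun act :: "'a \<times> direction \<Rightarrow> 'a ptape \<Rightarrow> 'a ptape" where
  "act (s, d) (h, T) = (move_head d h, T(h := s))"

fun opposite :: "direction \<Rightarrow> direction" where
  "opposite Go_Left = Go_Right"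
| "opposite Stay = Stay"
| "opposite Go_Right = Go_Left"

fun exec_op :: "bool list set \<Rightarrow> op \<Rightarrow> bool ptape \<times> bool list \<Rightarrow> (bool ptape \<times> bool list) option" where
  "exec_op A Nop (W, q) = Some (W, q)"
| "exec_op A (RW r r' d) (W, q) = (if scan W = r then Some (act (r', d) W, q) else None)"
| "exec_op A (Out a) (W, q) = Some (W, q @ [a])"
| "exec_op A (Ask b) (W, q) = (if (q \<in> A) = b then Some (W, []) else None)"

fun run :: "bool list set \<Rightarrow> op list \<Rightarrow> bool ptape \<times> bool list \<Rightarrow> (bool ptape \<times> bool list) option" where
  "run A [] s = Some s"
| "run A (x # xs) s = (case exec_op A x s of None \<Rightarrow> None | Some s' \<Rightarrow> run A xs s')"

type_synonym action =
  "control \<times> (symbol \<times> direction) \<times> (symbol \<times> direction) \<times> (bool \<times> direction) \<times> bool option"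

text \<open>
  The checker has a trace tape, a table tape and a bit tape. It first copies blocks of the table
  to the trace tape, nondeterministically, until it has copied a block marked as final. Then it
  sweeps the trace: going forward, it executes the first fresh operation of each block on the bit
  tape; going backward, it undoes them, which leaves the bit tape blank for the next sweep.
\<close>

fun delta :: "control \<Rightarrow> symbol \<Rightarrow> symbol \<Rightarrow> bool \<Rightarrow> action list" where
  "delta RewP t p w =
     (if p = Blank then [(Choose, (t, Stay), (p, Go_Right), (w, Stay), None)]
      else [(RewP, (t, Stay), (p, Go_Left), (w, Stay), None)])"
| "delta Choose t p w =
     (case p of
        Blank \<Rightarrow> []
      | Sep f \<Rightarrow> [(Choose, (t, Stay), (p, Go_Right), (w, Stay), None),
                  (Copy f, (p, Go_Right), (p, Go_Right), (w, Stay), None)]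
      | _ \<Rightarrow> [(Choose, (t, Stay), (p, Go_Right), (w, Stay), None)])"
| "delta (Copy f) t p w =
     (case p of
        Fresh x \<Rightarrow> [(Copy f, (p, Go_Right), (p, Go_Right), (w, Stay), None)]
      | _ \<Rightarrow> [if f then (RewT, (t, Go_Left), (p, Stay), (w, Stay), None)
              else (RewP, (t, Stay), (p, Go_Left), (w, Stay), None)])"
| "delta RewT t p w =
     (if t = Blank then [(Forward, (t, Go_Right), (p, Stay), (w, Stay), None)]
      else [(RewT, (t, Go_Left), (p, Stay), (w, Stay), None)])"
| "delta Forward t p w =
     (case t of
        Blank \<Rightarrow> [(Backward, (t, Go_Left), (p, Stay), (w, Stay), None)]
      | Sep f \<Rightarrow> [(Seek, (t, Go_Right), (p, Stay), (w, Stay), None)]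
      | _ \<Rightarrow> [(Forward, (t, Go_Right), (p, Stay), (w, Stay), None)])"
| "delta Seek t p w =
     (case t of
        Done \<Rightarrow> [(Seek, (t, Go_Right), (p, Stay), (w, Stay), None)]
      | Fresh x \<Rightarrow>
          (case x of
             Nop \<Rightarrow> [(Forward, (Cur x, Go_Right), (p, Stay), (w, Stay), None)]
           | RW r r' d \<Rightarrow>
               (if w = r then [(Forward, (Cur x, Go_Right), (p, Stay), (r', d), None)] else [])
           | Out a \<Rightarrow> [(Forward, (Cur x, Go_Right), (p, Stay), (w, Stay), Some a)]
           | Ask b \<Rightarrow> [(Asking b, (Cur x, Go_Right), (p, Stay), (w, Stay), None)])
      | Cur x \<Rightarrow> []
      | _ \<Rightarrow> [(Accept, (t, Stay), (p, Stay), (w, Stay), None)])"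
| "delta Backward t p w =
     (case t of
        Blank \<Rightarrow> [(Forward, (t, Go_Right), (p, Stay), (w, Stay), None)]
      | Cur x \<Rightarrow>
          (case x of
             RW r r' d \<Rightarrow> [(Restore r, (Done, Go_Left), (p, Stay), (w, opposite d), None)]
           | _ \<Rightarrow> [(Backward, (Done, Go_Left), (p, Stay), (w, Stay), None)])
      | _ \<Rightarrow> [(Backward, (t, Go_Left), (p, Stay), (w, Stay), None)])"
| "delta (Restore r) t p w = [(Backward, (t, Stay), (p, Stay), (r, Stay), None)]"
| "delta (Asking b) t p w = []"
| "delta Accept t p w = []"
| "delta Reject t p w = []"

type_synonym checker = "control \<times> symbol ptape \<times> symbol ptape \<times> bool ptape \<times> bool list"

fun apply_action :: "action \<Rightarrow> checker \<Rightarrow> checker" where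
  "apply_action (v', t, p, w, out) (v, T, P, W, q) =
     (v', act t T, act p P, act w W, (case out of None \<Rightarrow> q | Some a \<Rightarrow> q @ [a]))"

text \<open>A wrong guess ends in the dead state \<open>Reject\<close>.\<close>

fun answer :: "bool list set \<Rightarrow> checker \<Rightarrow> checker" where
  "answer A (v, T, P, W, q) = ((if v = Asking (q \<in> A) then Forward else Reject), T, P, W, [])"

fun actions :: "checker \<Rightarrow> action list" where
  "actions (v, T, P, W, q) = delta v (scan T) (scan P) (scan W)"

definition check_step :: "bool list set \<Rightarrow> checker \<Rightarrow> checker \<Rightarrow> bool" where
  "check_step A s s' \<longleftrightarrow>
     (\<exists>x\<in>set (actions s). s' = apply_action x s) \<or> (\<exists>b. fst s = Asking b) \<and> s' = answer A s"

text \<open>Acceptance within a budget of steps. Outside the choice of the trace the checker has at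
  most one successor, so a stretch of known cost becomes an equivalence that only shifts the budget;
  soundness and running time are read off the same statement.\<close>

fun accepts_in :: "bool list set \<Rightarrow> nat \<Rightarrow> checker \<Rightarrow> bool" where
  "accepts_in A 0 s \<longleftrightarrow> fst s = Accept"
| "accepts_in A (Suc n) s \<longleftrightarrow> fst s = Accept \<or> (\<exists>s'. check_step A s s' \<and> accepts_in A n s')"

lemma accepts_in_mono: "accepts_in A n s \<Longrightarrow> n \<le> m \<Longrightarrow> accepts_in A m s"
proof (induction n arbitrary: s m)
  case 0
  then show ?case by (cases m) auto
next
  case (Suc n)
  then obtain m' where "m = Suc m'" "n \<le> m'" by (cases m) auto
  with Suc show ?case by (auto simp del: split_paired_Ex)
qed

lemma accepts_in_Suc:
  "accepts_in A (Suc n) (v, T, P, W, q) \<longleftrightarrow> v = Accept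
     \<or> (\<exists>x\<in>set (delta v (scan T) (scan P) (scan W)). accepts_in A n (apply_action x (v, T, P, W, q)))
     \<or> (\<exists>b. v = Asking b) \<and> accepts_in A n (answer A (v, T, P, W, q))"
  by (simp add: check_step_def del: split_paired_Ex answer.simps apply_action.simps) blast

declare accepts_in.simps(2) [simp del]

lemma accepts_in_Reject [simp]: "\<not> accepts_in A n (Reject, T, P, W, q)"
  by (cases n) (auto simp: accepts_in_Suc)

lemma act_scan [simp]: "act (scan T, Stay) T = T"
  by (cases T) auto

section \<open>Tapes as pairs of lists\<close>

definition cells :: "symbol list \<Rightarrow> int \<Rightarrow> symbol" where
  "cells xs j = (if 0 \<le> j \<and> nat j < length xs then xs ! nat j else Blank)"

text \<open>\<open>l\<close> lists the cells left of the head, nearest first; the head is on the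
  first symbol of \<open>r\<close>, or on the blank behind the last cell if \<open>r\<close> is
  empty.\<close>

definition zip_tape :: "symbol list \<Rightarrow> symbol list \<Rightarrow> symbol ptape" where
  "zip_tape l r = (int (length l), cells (rev l @ r))"

text \<open>The head is on the last symbol of \<open>rev l\<close>, or just before the first cell if there is none.\<close>

definition zip_left :: "symbol list \<Rightarrow> symbol list \<Rightarrow> symbol ptape" where
  "zip_left l r = (int (length l) - 1, cells (rev l @ r))"

lemma cells_update: "(cells (xs @ s # ys))(int (length xs) := s') = cells (xs @ s' # ys)"
proof
  fix j show "((cells (xs @ s # ys))(int (length xs) := s')) j = cells (xs @ s' # ys) j"
  proof (cases "j = int (length xs)")
    case True
    then show ?thesis by (simp add: cells_def)
  next
    case False
    then have "0 \<le> j \<Longrightarrow> nat j \<noteq> length xs" by auto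
    with False show ?thesis by (auto simp: cells_def nth_append nth_Cons')
  qed
qed

lemma cells_append: "(cells xs)(int (length xs) := s) = cells (xs @ [s])"
proof
  fix j show "((cells xs)(int (length xs) := s)) j = cells (xs @ [s]) j"
  proof (cases "j = int (length xs)")
    case True
    then show ?thesis by (simp add: cells_def)
  next
    case False
    then have "0 \<le> j \<Longrightarrow> nat j \<noteq> length xs" by auto
    with False show ?thesis by (auto simp: cells_def nth_append)
  qed
qed

lemma cells_blank: "(cells xs)(int (length xs) := Blank) = cells xs" "(cells xs)(-1 := Blank) = cells xs"
  by (auto simp: cells_def)

lemma zip_tape_simps [simp]:
  "scan (zip_tape l (s # r)) = s"
  "scan (zip_tape l []) = Blank"
  "act (s', Go_Right) (zip_tape l (s # r)) = zip_tape (s' # l) r"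
  "act (s', Go_Right) (zip_tape l []) = zip_tape (s' # l) []"
  "act (s', Go_Left) (zip_tape l (s # r)) = zip_left l (s' # r)"
  "act (Blank, Go_Left) (zip_tape l []) = zip_left l []"
  using cells_update[of "rev l" s r s'] cells_append[of "rev l" s'] cells_blank(1)[of "rev l"]
  by (auto simp: zip_tape_def zip_left_def cells_def nth_append)

lemma zip_tape_Stay [simp]:
  "act (Blank, Stay) (zip_tape l []) = zip_tape l []" "act (s, Stay) (zip_tape l (s # r)) = zip_tape l (s # r)"
  using act_scan[of "zip_tape l []"] act_scan[of "zip_tape l (s # r)"] by simp_all

lemma zip_left_Cons: "zip_left (s # l) r = zip_tape l (s # r)"
  by (simp add: zip_tape_def zip_left_def)

lemma zip_left_simps [simp]:
  "scan (zip_left [] r) = Blank"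
  "scan (zip_left (s # l) r) = s"
  "act (Blank, Go_Right) (zip_left [] r) = zip_tape [] r"
  "act (s', Go_Left) (zip_left (s # l) r) = zip_left l (s' # r)"
proof -
  show "scan (zip_left [] r) = Blank" by (simp add: zip_left_def cells_def)
  show "act (Blank, Go_Right) (zip_left [] r) = zip_tape [] r"
    using cells_blank(2)[of r] by (simp add: zip_left_def zip_tape_def)
qed (simp_all add: zip_left_Cons)

section \<open>Forward and backward sweeps\<close>

definition blank_tape :: "bool ptape" where
  "blank_tape = (0, \<lambda>_. False)"

text \<open>The number \<open>k\<close> counts completed sweeps, each of which turns one operation
  into \<open>Done\<close>.\<close>

definition block :: "nat \<Rightarrow> bool \<times> op list \<Rightarrow> symbol list" where
  "block k b = Sep (fst b) # replicate k Done @ map Fresh (snd b)"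

text \<open>The shape of a block between the forward and the backward sweep.\<close>

definition marked :: "nat \<Rightarrow> bool \<times> op list \<Rightarrow> symbol list" where
  "marked k b = Sep (fst b) # replicate k Done @ Cur (hd (snd b)) # map Fresh (tl (snd b))"

text \<open>The second step of a query, in which the oracle answers.\<close>

definition extra :: "op \<Rightarrow> nat" where
  "extra x = (case x of Ask b \<Rightarrow> 1 | _ \<Rightarrow> 0)"

text \<open>A write is undone in two steps: the head must be back in the cell before the old bit can
  be written there.\<close>

definition extra_undo :: "op \<Rightarrow> nat" where
  "extra_undo x = (case x of RW r r' d \<Rightarrow> 1 | _ \<Rightarrow> 0)"

lemma seek_Done:
  "accepts_in A (n + k) (Seek, zip_tape l (replicate k Done @ r), P, W, q)
   \<longleftrightarrow> accepts_in A n (Seek, zip_tape (replicate k Done @ l) r, P, W, q)"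
  by (induction k arbitrary: l) (auto simp: replicate_app_Cons_same accepts_in_Suc)

text \<open>A mismatching read leaves the checker without an action, and a wrong guess sends it to
  \<open>Reject\<close>; in both cases no budget suffices.\<close>

lemma seek_Fresh:
  "accepts_in A (n + Suc (extra x)) (Seek, zip_tape l (Fresh x # r), P, W, q) \<longleftrightarrow>
   (case exec_op A x (W, q) of None \<Rightarrow> False
    | Some (W', q') \<Rightarrow> accepts_in A n (Forward, zip_tape (Cur x # l) r, P, W', q'))"
  by (cases x) (auto simp: extra_def accepts_in_Suc)

lemma turning_steps:
  "accepts_in A (Suc n) (Forward, zip_tape l (Sep f # r), P, W, q)
   \<longleftrightarrow> accepts_in A n (Seek, zip_tape (Sep f # l) r, P, W, q)"
  "accepts_in A (Suc n) (Forward, zip_tape l [], P, W, q) \<longleftrightarrow> accepts_in A n (Backward, zip_left l [], P, W, q)"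
  "accepts_in A (Suc n) (Backward, zip_left (Sep f # l) r, P, W, q)
   \<longleftrightarrow> accepts_in A n (Backward, zip_left l (Sep f # r), P, W, q)"
  "accepts_in A (Suc n) (Backward, zip_left [] r, P, W, q) \<longleftrightarrow> accepts_in A n (Forward, zip_tape [] r, P, W, q)"
  by (simp_all add: accepts_in_Suc)

lemma forward_Fresh:
  "accepts_in A (n + length xs) (Forward, zip_tape l (map Fresh xs @ r), P, W, q)
   \<longleftrightarrow> accepts_in A n (Forward, zip_tape (rev (map Fresh xs) @ l) r, P, W, q)"
  by (induction xs arbitrary: l) (auto simp: accepts_in_Suc)

lemma forward_block:
  assumes "snd b \<noteq> []"
  shows "accepts_in A (n + (Suc k + extra (hd (snd b)) + length (snd b))) (Forward, zip_tape l (block k b @ r), P, W, q) \<longleftrightarrow>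
   (case exec_op A (hd (snd b)) (W, q) of None \<Rightarrow> False
    | Some (W', q') \<Rightarrow> accepts_in A n (Forward, zip_tape (rev (marked k b) @ l) r, P, W', q'))"
proof -
  obtain f x xs where b: "b = (f, x # xs)" using assms by (cases b; cases "snd b") auto
  have "accepts_in A (n + (Suc k + extra x + Suc (length xs))) (Forward, zip_tape l (block k b @ r), P, W, q)
    \<longleftrightarrow> accepts_in A (n + length xs + Suc (extra x) + k)
          (Seek, zip_tape (Sep f # l) (replicate k Done @ Fresh x # map Fresh xs @ r), P, W, q)"
    by (simp add: b block_def algebra_simps turning_steps)
  also have "\<dots> \<longleftrightarrow> (case exec_op A x (W, q) of None \<Rightarrow> False
    | Some (W', q') \<Rightarrow> accepts_in A n (Forward, zip_tape (rev (marked k b) @ l) r, P, W', q'))"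
    unfolding seek_Done seek_Fresh forward_Fresh by (auto simp: b marked_def split: option.splits)
  finally show ?thesis by (simp add: b)
qed

definition forward_cost :: "nat \<Rightarrow> (bool \<times> op list) list \<Rightarrow> nat" where
  "forward_cost k bs = (\<Sum>b\<leftarrow>bs. Suc k + extra (hd (snd b)) + length (snd b))"

lemma forward_pass:
  assumes "\<forall>b\<in>set bs. snd b \<noteq> []"
  shows "accepts_in A (n + forward_cost k bs) (Forward, zip_tape l (concat (map (block k) bs)), P, W, q) \<longleftrightarrow>
   (case run A (map (hd \<circ> snd) bs) (W, q) of None \<Rightarrow> False
    | Some (W', q') \<Rightarrow>
        accepts_in A n (Forward, zip_tape (rev (concat (map (marked k) bs)) @ l) [], P, W', q'))"
  using assms
proof (induction bs arbitrary: l W q)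
  case Nil
  then show ?case by (simp add: forward_cost_def)
next
  case (Cons b bs)
  have e: "n + forward_cost k (b # bs)
    = (n + forward_cost k bs) + (Suc k + extra (hd (snd b)) + length (snd b))"
    by (simp add: forward_cost_def)
  have "accepts_in A (n + forward_cost k (b # bs)) (Forward, zip_tape l (concat (map (block k) (b # bs))), P, W, q)
    \<longleftrightarrow> (case exec_op A (hd (snd b)) (W, q) of None \<Rightarrow> False
        | Some (W', q') \<Rightarrow> accepts_in A (n + forward_cost k bs)
            (Forward, zip_tape (rev (marked k b) @ l) (concat (map (block k) bs)), P, W', q'))"
    unfolding e using forward_block[of b] Cons.prems by simp
  also have "\<dots> \<longleftrightarrow> (case run A (map (hd \<circ> snd) (b # bs)) (W, q) of None \<Rightarrow> False
    | Some (W', q') \<Rightarrow>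
        accepts_in A n (Forward, zip_tape (rev (concat (map (marked k) (b # bs))) @ l) [], P, W', q'))"
    using Cons.IH Cons.prems
    by (cases "exec_op A (hd (snd b)) (W, q)") (auto simp: comp_def split: option.splits)
  finally show ?case .
qed

lemma backward_Fresh:
  "accepts_in A (n + length xs) (Backward, zip_left (rev (map Fresh xs) @ l) r, P, W, q)
   \<longleftrightarrow> accepts_in A n (Backward, zip_left l (map Fresh xs @ r), P, W, q)"
  by (induction xs arbitrary: r rule: rev_induct) (auto simp: accepts_in_Suc)

lemma backward_Done:
  "accepts_in A (n + k) (Backward, zip_left (replicate k Done @ l) r, P, W, q)
   \<longleftrightarrow> accepts_in A n (Backward, zip_left l (replicate k Done @ r), P, W, q)"
  by (induction k arbitrary: r) (auto simp: replicate_app_Cons_same accepts_in_Suc)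

lemma move_head_opposite [simp]: "move_head (opposite d) (move_head d h) = h"
  by (cases d) auto

lemma act_undo: "scan W = r \<Longrightarrow> act (r, Stay) (act (scan (act (r', d) W), opposite d) (act (r', d) W)) = W"
  by (cases W) auto

text \<open>\<open>q''\<close> is arbitrary because undoing concerns the bit tape alone; the oracle
  tape is left as it is.\<close>

lemma backward_Cur:
  assumes "exec_op A x (W, q) = Some (W', q')"
  shows "accepts_in A (n + Suc (extra_undo x)) (Backward, zip_left (Cur x # l) r, P, W', q'')
   \<longleftrightarrow> accepts_in A n (Backward, zip_left l (Done # r), P, W, q'')"
proof (cases x)
  case (RW u v d)
  then have W: "scan W = u" "W' = act (v, d) W" using assms by (auto split: if_splits)
  have "act (scan (zip_left l (Done # r)), Stay) (zip_left l (Done # r)) = zip_left l (Done # r)" by simp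
  then show ?thesis using act_undo[OF W(1), of v d] W by (simp add: RW extra_undo_def accepts_in_Suc)
qed (use assms in \<open>auto simp: extra_undo_def accepts_in_Suc split: if_splits\<close>)

lemma backward_block:
  assumes "snd b \<noteq> []" "exec_op A (hd (snd b)) (W, q) = Some (W', q')"
  shows "accepts_in A (n + (Suc k + extra_undo (hd (snd b)) + length (snd b)))
      (Backward, zip_left (rev (marked k b) @ l) r, P, W', q'')
   \<longleftrightarrow> accepts_in A n (Backward, zip_left l (block (Suc k) (map_prod id tl b) @ r), P, W, q'')"
proof -
  obtain f x xs where b: "b = (f, x # xs)" using assms by (cases b; cases "snd b") auto
  have x: "exec_op A x (W, q) = Some (W', q')" using assms b by simp
  have e: "n + (Suc k + extra_undo x + Suc (length xs)) = Suc n + k + Suc (extra_undo x) + length xs" by simp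
  have "accepts_in A (n + (Suc k + extra_undo x + Suc (length xs)))
      (Backward, zip_left (rev (marked k b) @ l) r, P, W', q'')
    \<longleftrightarrow> accepts_in A (Suc n + k + Suc (extra_undo x) + length xs)
      (Backward, zip_left (rev (map Fresh xs) @ Cur x # replicate k Done @ Sep f # l) r, P, W', q'')"
    unfolding e by (simp add: b marked_def)
  also have "\<dots> \<longleftrightarrow> accepts_in A (Suc n) (Backward, zip_left (Sep f # l) (replicate k Done @ Done # map Fresh xs @ r), P, W, q'')"
    unfolding backward_Fresh backward_Cur[OF x] backward_Done ..
  also have "\<dots> \<longleftrightarrow> accepts_in A n (Backward, zip_left l (block (Suc k) (map_prod id tl b) @ r), P, W, q'')"
    by (simp add: b block_def replicate_app_Cons_same turning_steps)
  finally show ?thesis by (simp add: b)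
qed

definition backward_cost :: "nat \<Rightarrow> (bool \<times> op list) list \<Rightarrow> nat" where
  "backward_cost k bs = (\<Sum>b\<leftarrow>bs. Suc k + extra_undo (hd (snd b)) + length (snd b))"

text \<open>Success of the forward run provides the intermediate bit tapes to which the blocks are
  rolled back. The last block is undone first, so in the induction the budget of the first block is
  spent at the end.\<close>

lemma backward_pass:
  assumes "\<forall>b\<in>set bs. snd b \<noteq> []" "run A (map (hd \<circ> snd) bs) (W, q) = Some (W', q')"
  shows "accepts_in A (n + backward_cost k bs)
      (Backward, zip_left (rev (concat (map (marked k) bs)) @ l) r, P, W', q'') \<longleftrightarrow>
    accepts_in A n (Backward, zip_left l (concat (map (block (Suc k)) (map (map_prod id tl) bs)) @ r), P, W, q'')"
  using assms
proof (induction bs arbitrary: l W q n)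
  case Nil
  then show ?case by (simp add: backward_cost_def)
next
  case (Cons b bs)
  let ?c = "Suc k + extra_undo (hd (snd b)) + length (snd b)"
  obtain W1 q1 where 1: "exec_op A (hd (snd b)) (W, q) = Some (W1, q1)"
    "run A (map (hd \<circ> snd) bs) (W1, q1) = Some (W', q')"
    using Cons.prems(2)
    by (cases "exec_op A (hd (snd b)) (W, q)") (auto simp: comp_def)
  have e: "n + backward_cost k (b # bs) = (n + ?c) + backward_cost k bs"
    by (simp add: backward_cost_def)
  show ?case
    using Cons.IH[OF _ 1(2), of "n + ?c" "rev (marked k b) @ l"] Cons.prems(1)
      backward_block[OF _ 1(1), of n k l
        "concat (map (block (Suc k)) (map (map_prod id tl) bs)) @ r" P q'']
    unfolding e by (simp add: id_def)
qed

definition pass_cost :: "nat \<Rightarrow> (bool \<times> op list) list \<Rightarrow> nat" where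
  "pass_cost k bs = forward_cost k bs + backward_cost k bs + 2"

text \<open>The bit tape returns to \<open>W\<close>, whereas the oracle tape keeps
  \<open>q'\<close>. The two additional steps in \<open>pass_cost\<close> are the turns at the
  blanks on either side of the trace.\<close>

lemma sweep:
  assumes "\<forall>b\<in>set bs. snd b \<noteq> []"
  shows "accepts_in A (n + pass_cost k bs) (Forward, zip_tape [] (concat (map (block k) bs)), P, W, q) \<longleftrightarrow>
   (case run A (map (hd \<circ> snd) bs) (W, q) of None \<Rightarrow> False
    | Some (W', q') \<Rightarrow> accepts_in A n
        (Forward, zip_tape [] (concat (map (block (Suc k)) (map (map_prod id tl) bs))), P, W, q'))"
proof -
  have e: "n + pass_cost k bs = Suc (Suc n + backward_cost k bs) + forward_cost k bs"
    by (simp add: pass_cost_def)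
  show ?thesis
  proof (cases "run A (map (hd \<circ> snd) bs) (W, q)")
    case None
    then show ?thesis unfolding e forward_pass[OF assms] by simp
  next
    case (Some s)
    obtain W' q' where s: "s = (W', q')" by fastforce
    have "accepts_in A (Suc n + backward_cost k bs) (Backward, zip_left (rev (concat (map (marked k) bs)) @ []) [], P, W', q')
      \<longleftrightarrow> accepts_in A (Suc n) (Backward, zip_left [] (concat (map (block (Suc k)) (map (map_prod id tl) bs)) @ []), P, W, q')"
      using backward_pass[OF assms Some[unfolded s]] .
    then show ?thesis using Some s unfolding e forward_pass[OF assms] by (simp add: turning_steps)
  qed
qed

fun passes :: "bool list set \<Rightarrow> nat \<Rightarrow> (bool \<times> op list) list \<Rightarrow> bool list \<Rightarrow> bool" where
  "passes A 0 bs q \<longleftrightarrow> True"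
| "passes A (Suc m) bs q \<longleftrightarrow>
     (case run A (map (hd \<circ> snd) bs) (blank_tape, q) of None \<Rightarrow> False
      | Some (W, q') \<Rightarrow> passes A m (map (map_prod id tl) bs) q')"

text \<open>The base case is one step past the first \<open>Sep\<close>, \<open>k\<close> steps over
  finished operations and one step into \<open>Accept\<close>.\<close>

fun passes_cost :: "nat \<Rightarrow> nat \<Rightarrow> (bool \<times> op list) list \<Rightarrow> nat" where
  "passes_cost 0 k bs = k + 2"
| "passes_cost (Suc m) k bs = pass_cost k bs + passes_cost m (Suc k) (map (map_prod id tl) bs)"

text \<open>As all blocks have the same number of operations, an exhausted first block shows that
  every track has been checked; for this there has to be a first block.\<close>

lemma all_sweeps:
  assumes "\<forall>b\<in>set bs. length (snd b) = m" "bs \<noteq> []"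
  shows "accepts_in A (n + passes_cost m k bs) (Forward, zip_tape [] (concat (map (block k) bs)), P, blank_tape, q)
    \<longleftrightarrow> passes A m bs q"
  using assms
proof (induction m arbitrary: k bs q)
  case 0
  obtain f bs' where bs: "bs = (f, []) # bs'" using 0 by (cases bs) auto
  have "accepts_in A (Suc (Suc n + k)) (Forward, zip_tape [] (concat (map (block k) bs)), P, blank_tape, q)
    \<longleftrightarrow> accepts_in A (Suc n) (Seek, zip_tape (replicate k Done @ [Sep f]) (concat (map (block k) bs')), P, blank_tape, q)"
    using seek_Done[of A "Suc n" k "[Sep f]"] by (simp add: bs block_def turning_steps)
  \<comment> \<open>Behind the exhausted block comes another \<open>Sep\<close> or the blank end of
    the trace, and both lead to \<open>Accept\<close>.\<close>
  also have "\<dots>"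
    by (cases bs'; cases n) (auto simp: block_def accepts_in_Suc)
  finally show ?case by simp
next
  case (Suc m)
  have ne: "\<forall>b\<in>set bs. snd b \<noteq> []" using Suc.prems by auto
  have e: "n + passes_cost (Suc m) k bs
    = (n + passes_cost m (Suc k) (map (map_prod id tl) bs)) + pass_cost k bs" by simp
  show ?case
    unfolding e sweep[OF ne] using Suc.IH[of "map (map_prod id tl) bs" "Suc k"] Suc.prems
    by (auto split: option.splits)
qed

lemma rewind_trace:
  assumes "Blank \<notin> set l"
  shows "accepts_in A (n + length l + 1) (RewT, zip_left l r, P, W, q)
   \<longleftrightarrow> accepts_in A n (Forward, zip_tape [] (rev l @ r), P, W, q)"
  using assms
proof (induction l arbitrary: r)
  case Nil
  show ?case by (simp add: accepts_in_Suc)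
next
  case (Cons a l)
  have "accepts_in A (Suc (n + length l + 1)) (RewT, zip_left (a # l) r, P, W, q)
    \<longleftrightarrow> accepts_in A (n + length l + 1) (RewT, zip_left l (a # r), P, W, q)"
    using Cons.prems by (subst accepts_in_Suc) auto
  with Cons show ?case by simp
qed

lemma rewind_table:
  assumes "Blank \<notin> set l"
  shows "accepts_in A (n + length l + 1) (RewP, T, zip_left l r, W, q)
   \<longleftrightarrow> accepts_in A n (Choose, T, zip_tape [] (rev l @ r), W, q)"
  using assms
proof (induction l arbitrary: r)
  case Nil
  show ?case by (simp add: accepts_in_Suc)
next
  case (Cons a l)
  have "accepts_in A (Suc (n + length l + 1)) (RewP, T, zip_left (a # l) r, W, q)
    \<longleftrightarrow> accepts_in A (n + length l + 1) (RewP, T, zip_left l (a # r), W, q)"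
    using Cons.prems by (subst accepts_in_Suc) auto
  with Cons show ?case by simp
qed

subsection \<open>Choosing the trace\<close>

definition blocks :: "(bool \<times> op list) list \<Rightarrow> symbol list" where
  "blocks bs = concat (map (block 0) bs)"

lemma blocks_simps [simp]:
  "blocks [] = []" "blocks (b # bs) = block 0 b @ blocks bs" "blocks (bs @ cs) = blocks bs @ blocks cs"
  by (simp_all add: blocks_def)

lemma Blank_blocks: "Blank \<notin> set (blocks bs)"
  by (auto simp: block_def blocks_def)

lemma blocks_Nil_or_Sep: "blocks bs = [] \<or> (\<exists>f r. blocks bs = Sep f # r)"
  by (cases bs) (auto simp: block_def)

lemma copy_end:
  "r = [] \<or> (\<exists>f' r'. r = Sep f' # r') \<Longrightarrow>
   accepts_in A (Suc n) (Copy f, zip_tape t [], zip_tape l r, W, q) \<longleftrightarrow>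
   (if f then accepts_in A n (RewT, zip_left t [], zip_tape l r, W, q)
    else accepts_in A n (RewP, zip_tape t [], zip_left l r, W, q))"
  by (auto simp: accepts_in_Suc)

text \<open>Apart from its first symbol an entry consists of \<open>Fresh\<close> symbols, so a
  \<open>Sep\<close> met anywhere in the table opens an entry, and a guess made there copies exactly
  one.\<close>

lemma blocks_split:
  "blocks es = a @ Sep f # r \<Longrightarrow>
   \<exists>xs rest. (f, xs) \<in> set es \<and> r = map Fresh xs @ rest \<and> (rest = [] \<or> (\<exists>f' r'. rest = Sep f' # r'))"
proof (induction es arbitrary: a)
  case (Cons b es)
  obtain g ys where b: "b = (g, ys)" by fastforce
  show ?case
  proof (cases a)
    case Nil
    then have "(g, ys) = (f, ys)" "r = map Fresh ys @ blocks es"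
      using Cons.prems by (simp_all add: b block_def)
    then show ?thesis using b blocks_Nil_or_Sep[of es] by (metis list.set_intros(1))
  next
    case (Cons s a')
    then have "map Fresh ys @ blocks es = a' @ Sep f # r" using Cons.prems by (auto simp: b block_def)
    then obtain us where "map Fresh ys = a' @ us \<and> us @ blocks es = Sep f # r
        \<or> map Fresh ys @ us = a' \<and> blocks es = us @ Sep f # r"
      by (auto simp: append_eq_append_conv2)
    then have "\<exists>us. blocks es = us @ Sep f # r"
    proof
      assume *: "map Fresh ys = a' @ us \<and> us @ blocks es = Sep f # r"
      have "us = []"
      proof (rule ccontr)
        assume "us \<noteq> []"
        with * have "Sep f \<in> set us" by (cases us) auto
        with * have "Sep f \<in> set (map Fresh ys)" by (metis UnI2 set_append)
        then show False by auto
      qed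
      with * show ?thesis by (intro exI[of _ "[]"]) simp
    qed blast
    with Cons.IH show ?thesis by (metis list.set_intros(2))
  qed
qed simp

text \<open>The invariant of the guessing phase. The table tape \<open>P\<close> is left open, since
  the sweeps do not depend on it.\<close>

definition completes :: "bool list set \<Rightarrow> (bool \<times> op list) list \<Rightarrow> symbol list \<Rightarrow> bool ptape \<Rightarrow> bool list \<Rightarrow> bool" where
  "completes A es tr W q \<longleftrightarrow> (\<exists>n P bs e. set bs \<subseteq> {b \<in> set es. \<not> fst b} \<and> e \<in> set es \<and> fst e \<and>
     accepts_in A n (Forward, zip_tape [] (tr @ blocks (bs @ [e])), P, W, q))"

lemma completes_final:
  "(True, xs) \<in> set es \<Longrightarrow> accepts_in A n (Forward, zip_tape [] (tr @ Sep True # map Fresh xs), P, W, q)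
   \<Longrightarrow> completes A es tr W q"
  unfolding completes_def
  by (rule exI[of _ n], rule exI[of _ P], rule exI[of _ "[]"], rule exI[of _ "(True, xs)"])
    (simp add: block_def)

lemma completes_Cons:
  assumes "(False, xs) \<in> set es" "completes A es (tr @ Sep False # map Fresh xs) W q"
  shows "completes A es tr W q"
proof -
  obtain n P bs e where *: "set bs \<subseteq> {b \<in> set es. \<not> fst b}" "e \<in> set es" "fst e"
     "accepts_in A n (Forward, zip_tape [] ((tr @ Sep False # map Fresh xs) @ blocks (bs @ [e])), P, W, q)"
    using assms(2) unfolding completes_def by blast
  show ?thesis unfolding completes_def
    by (rule exI[of _ n], rule exI[of _ P], rule exI[of _ "(False, xs) # bs"], rule exI[of _ e])
      (use * assms(1) in \<open>simp add: block_def\<close>)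
qed

text \<open>One induction on the budget for the three control states of the guess, which lead to
  each other: rewinding the table, searching an entry, copying it. \<open>Blank\<close> must not
  occur in \<open>tr\<close>, as the last rewinding finds the start of the trace by the first
  blank.\<close>

lemma choose_sound:
  fixes A es W q
  shows "accepts_in A n (RewP, zip_tape (rev tr) [], zip_left l r, W, q) \<Longrightarrow>
     Blank \<notin> set tr \<Longrightarrow> rev l @ r = blocks es \<Longrightarrow> completes A es tr W q"
   and "accepts_in A n (Choose, zip_tape (rev tr) [], zip_tape l r, W, q) \<Longrightarrow>
     Blank \<notin> set tr \<Longrightarrow> rev l @ r = blocks es \<Longrightarrow> completes A es tr W q"
   and "accepts_in A n (Copy f, zip_tape (rev tr) [], zip_tape l (map Fresh xs @ rest), W, q) \<Longrightarrow>
     Blank \<notin> set tr \<Longrightarrow> rev l @ map Fresh xs @ rest = blocks es \<Longrightarrow>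
     rest = [] \<or> (\<exists>f' r'. rest = Sep f' # r') \<Longrightarrow>
     if f then \<exists>n P. accepts_in A n (Forward, zip_tape [] (tr @ map Fresh xs), P, W, q)
     else completes A es (tr @ map Fresh xs) W q"
proof (induction n arbitrary: tr l r f xs rest)
  case 0
  { case 1 then show ?case by simp }
  { case 2 then show ?case by simp }
  { case 3 then show ?case by simp }
next
  case (Suc n)
  { case 1
    show ?case
    proof (cases l)
      case Nil
      then have "accepts_in A n (Choose, zip_tape (rev tr) [], zip_tape [] r, W, q)"
        using 1 by (simp add: accepts_in_Suc)
      then show ?thesis using Suc.IH(2) 1 Nil by auto
    next
      case (Cons s l')
      then have "s \<in> set (blocks es)" using 1(3) by (metis in_set_conv_decomp rev.simps(2) append_assoc append_Cons append_Nil)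
      then have "s \<noteq> Blank" using Blank_blocks by metis
      then have "accepts_in A n (RewP, zip_tape (rev tr) [], zip_left l' (s # r), W, q)"
        using 1 Cons by (simp add: accepts_in_Suc)
      then show ?thesis using Suc.IH(1) 1 Cons by auto
    qed }
  { case 2
    note outer = 2
    show ?case
    proof (cases r)
      case Nil
      then show ?thesis using 2 by (simp add: accepts_in_Suc)
    next
      case (Cons s r')
      then have "s \<in> set (blocks es)" using 2(3) by (metis in_set_conv_decomp)
      then have "s \<noteq> Blank" using Blank_blocks by metis
      then consider "accepts_in A n (Choose, zip_tape (rev tr) [], zip_tape (s # l) r', W, q)"
        | f where "s = Sep f" "accepts_in A n (Copy f, zip_tape (Sep f # rev tr) [], zip_tape (s # l) r', W, q)"
        using 2 Cons by (auto simp: accepts_in_Suc split: symbol.splits)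
      then show ?thesis
      proof cases
        case 1
        then show ?thesis using Suc.IH(2) 2 Cons by auto
      next
        case (2 f)
        have "blocks es = rev l @ Sep f # r'" using outer Cons 2 by simp
        from blocks_split[OF this] obtain xs rest where
          xs: "(f, xs) \<in> set es" "r' = map Fresh xs @ rest" "rest = [] \<or> (\<exists>f' r'. rest = Sep f' # r')" by blast
        have "if f then \<exists>n P. accepts_in A n (Forward, zip_tape [] ((tr @ [Sep f]) @ map Fresh xs), P, W, q)
          else completes A es ((tr @ [Sep f]) @ map Fresh xs) W q"
          by (rule Suc.IH(3)[of f "tr @ [Sep f]" "s # l" xs rest]) (use outer 2 Cons xs in auto)
        then show ?thesis using completes_final[of xs es A _ tr] completes_Cons[of xs es A tr] xs(1)
          by (cases f) (simp_all del: split_paired_Ex, blast)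
      qed
    qed }
  { case 3
    show ?case
    proof (cases xs)
      case (Cons x xs')
      then have "accepts_in A n (Copy f, zip_tape (rev (tr @ [Fresh x])) [], zip_tape (Fresh x # l) (map Fresh xs' @ rest), W, q)"
        using 3 by (simp add: accepts_in_Suc)
      from Suc.IH(3)[OF this] 3 Cons show ?thesis by auto
    next
      case Nil
      show ?thesis
      proof (cases f)
        case True
        then obtain P where "accepts_in A n (RewT, zip_left (rev tr) [], P, W, q)"
          using 3 Nil by (auto simp: copy_end)
        \<comment> \<open>The budget is raised by the cost of rewinding so that the equivalence
          \<open>rewind_trace\<close> applies.\<close>
        then have "accepts_in A (n + length (rev tr) + 1) (RewT, zip_left (rev tr) [], P, W, q)"
          by (rule accepts_in_mono) simp
        then have "accepts_in A n (Forward, zip_tape [] tr, P, W, q)"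
          using rewind_trace[of "rev tr" A n "[]" P W q] 3(2) by simp
        then have "\<exists>n P. accepts_in A n (Forward, zip_tape [] tr, P, W, q)" by blast
        with True Nil show ?thesis by simp
      next
        case False
        then have "accepts_in A n (RewP, zip_tape (rev tr) [], zip_left l rest, W, q)"
          using 3 Nil by (auto simp: copy_end)
        then show ?thesis using Suc.IH(1) 3 False Nil by auto
      qed
    qed }
qed

lemma copy_block:
  "accepts_in A (n + length xs) (Copy f, zip_tape t [], zip_tape l (map Fresh xs @ r), W, q)
   \<longleftrightarrow> accepts_in A n (Copy f, zip_tape (rev (map Fresh xs) @ t) [], zip_tape (rev (map Fresh xs) @ l) r, W, q)"
  by (induction xs arbitrary: t l) (auto simp: accepts_in_Suc)

lemma skip_table:
  "accepts_in A n (Choose, T, zip_tape (rev a @ l) r, W, q) \<Longrightarrow> Blank \<notin> set a \<Longrightarrow>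
   accepts_in A (n + length a) (Choose, T, zip_tape l (a @ r), W, q)"
proof (induction a arbitrary: l)
  case (Cons s a)
  then show ?case by (cases s) (auto simp: accepts_in_Suc)
qed simp

text \<open>The factor 2 stands for two passes over the table: back to its beginning, then forward
  over the entries before the chosen one and through that one.\<close>

lemma choose_block:
  assumes e: "(f, xs) \<in> set es" and lr: "rev l @ r = blocks es"
    and acc: "\<And>l' r'. rev l' @ r' = blocks es \<Longrightarrow> r' = [] \<or> (\<exists>f r''. r' = Sep f # r'') \<Longrightarrow>
      accepts_in A n (Copy f, zip_tape (rev (block 0 (f, xs)) @ t) [], zip_tape l' r', W, q)"
  shows "accepts_in A (n + 2 * length (blocks es) + 1) (RewP, zip_tape t [], zip_left l r, W, q)"
proof -
  obtain es1 es2 where es: "es = es1 @ (f, xs) # es2" using e by (auto simp: in_set_conv_decomp)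
  have B: "blocks es = blocks es1 @ Sep f # map Fresh xs @ blocks es2" by (simp add: es block_def)
  have "accepts_in A n (Copy f, zip_tape (rev (block 0 (f, xs)) @ t) [],
     zip_tape (rev (map Fresh xs) @ Sep f # rev (blocks es1)) (blocks es2), W, q)"
    by (rule acc) (simp_all add: B blocks_Nil_or_Sep[of es2])
  then have "accepts_in A (n + length xs) (Copy f, zip_tape (Sep f # t) [],
     zip_tape (Sep f # rev (blocks es1)) (map Fresh xs @ blocks es2), W, q)"
    unfolding copy_block by (simp add: block_def)
  then have "accepts_in A (Suc (n + length xs)) (Choose, zip_tape t [],
     zip_tape (rev (blocks es1) @ []) (Sep f # map Fresh xs @ blocks es2), W, q)"
    by (simp add: accepts_in_Suc)
  then have "accepts_in A (Suc (n + length xs) + length (blocks es1)) (Choose, zip_tape t [],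
     zip_tape [] (blocks es1 @ Sep f # map Fresh xs @ blocks es2), W, q)"
    by (rule skip_table) (rule Blank_blocks)
  then have "accepts_in A (Suc (n + length xs) + length (blocks es1) + length l + 1) (RewP, zip_tape t [],
     zip_left l r, W, q)"
    using rewind_table[of l A "Suc (n + length xs) + length (blocks es1)" "zip_tape t []" r W q]
      lr Blank_blocks[of es] unfolding B[symmetric] lr[symmetric] by simp
  moreover have "length l \<le> length (blocks es)" unfolding lr[symmetric] by simp
  ultimately show ?thesis by (rule_tac accepts_in_mono) (auto simp: B)
qed

text \<open>The cost of each guess is bounded in terms of the table alone, so guessing is linear in
  the number of blocks. The length of the whole trace is added for its final rewinding.\<close>

lemma choose_complete:
  assumes "set bs \<subseteq> {b \<in> set es. \<not> fst b}" "e \<in> set es" "fst e" "rev l @ r = blocks es" "Blank \<notin> set tr"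
    and "\<And>P. accepts_in A n (Forward, zip_tape [] (tr @ blocks (bs @ [e])), P, W, q)"
  shows "accepts_in A (n + length (tr @ blocks (bs @ [e])) + (2 * length (blocks es) + 2) * (length bs + 1) + 1)
    (RewP, zip_tape (rev tr) [], zip_left l r, W, q)"
  using assms
proof (induction bs arbitrary: tr l r)
  case Nil
  obtain xs where e: "e = (True, xs)" using Nil by (cases e) auto
  let ?T = "tr @ blocks [e]"
  have B: "Blank \<notin> set (rev ?T)" using Nil Blank_blocks[of "[e]"] by auto
  have "accepts_in A (Suc (n + length (rev ?T) + 1)) (Copy True, zip_tape (rev (block 0 (True, xs)) @ rev tr) [], zip_tape l' r', W, q)"
    if "r' = [] \<or> (\<exists>f r''. r' = Sep f # r'')" for l' r'
  proof -
    have "accepts_in A (n + length (rev ?T) + 1) (RewT, zip_left (rev ?T) [], zip_tape l' r', W, q)"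
      unfolding rewind_trace[OF B] using Nil(6) by simp
    then show ?thesis using that by (auto simp: copy_end e)
  qed
  from choose_block[OF Nil(2)[unfolded e] Nil(4) this]
  have "accepts_in A (Suc (n + length (rev ?T) + 1) + 2 * length (blocks es) + 1) (RewP, zip_tape (rev tr) [], zip_left l r, W, q)" .
  then show ?case by (rule accepts_in_mono) simp
next
  case (Cons b bs)
  obtain xs where b: "b = (False, xs)" using Cons by (cases b) auto
  let ?n = "n + length (tr @ blocks ((b # bs) @ [e])) + (2 * length (blocks es) + 2) * (length bs + 1) + 1"
  have "accepts_in A (Suc ?n) (Copy False, zip_tape (rev (block 0 (False, xs)) @ rev tr) [], zip_tape l' r', W, q)"
    if lr: "rev l' @ r' = blocks es" and r': "r' = [] \<or> (\<exists>f r''. r' = Sep f # r'')" for l' r'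
  proof -
    have "accepts_in A (n + length ((tr @ block 0 b) @ blocks (bs @ [e])) + (2 * length (blocks es) + 2) * (length bs + 1) + 1)
      (RewP, zip_tape (rev (tr @ block 0 b)) [], zip_left l' r', W, q)"
    proof (rule Cons.IH)
      show "Blank \<notin> set (tr @ block 0 b)" using Cons.prems by (auto simp: block_def)
      show "accepts_in A n (Forward, zip_tape [] ((tr @ block 0 b) @ blocks (bs @ [e])), P, W, q)" for P
        using Cons.prems(6) by simp
    qed (use Cons.prems lr in auto)
    then show ?thesis using r' by (simp add: copy_end b)
  qed
  moreover have "(False, xs) \<in> set es" using Cons.prems b by auto
  ultimately have "accepts_in A (Suc ?n + 2 * length (blocks es) + 1) (RewP, zip_tape (rev tr) [], zip_left l r, W, q)"
    using choose_block[of False xs es l r A "Suc ?n" "rev tr" W q] Cons.prems(4) by blast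
  then show ?case by (rule accepts_in_mono) simp
qed

section \<open>Cost and correctness of the checker\<close>

lemma passes_cost_le:
  assumes "\<forall>b\<in>set bs. length (snd b) = m"
  shows "passes_cost m k bs \<le> m * (length bs * (2 * (k + m + 2)) + 2) + k + m + 2"
  using assms
proof (induction m arbitrary: k bs)
  case (Suc m)
  have ex: "extra x \<le> 1" "extra_undo x \<le> 1" for x by (auto simp: extra_def extra_undo_def split: op.splits)
  have "forward_cost k bs \<le> length bs * (k + Suc m + 2)" "backward_cost k bs \<le> length bs * (k + Suc m + 2)"
    using Suc.prems
  proof (induction bs)
    case (Cons b bs)
    { case 1 then show ?case using Cons ex(1)[of "hd (snd b)"] by (auto simp: forward_cost_def) }
    { case 2 then show ?case using Cons ex(2)[of "hd (snd b)"] by (auto simp: backward_cost_def) }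
  qed (auto simp: forward_cost_def backward_cost_def)
  then have "pass_cost k bs \<le> length bs * (2 * (k + Suc m + 2)) + 2"
    by (simp add: pass_cost_def algebra_simps)
  moreover have "passes_cost m (Suc k) (map (map_prod id tl) bs)
     \<le> m * (length bs * (2 * (Suc k + m + 2)) + 2) + Suc k + m + 2"
    using Suc.IH[of "map (map_prod id tl) bs" "Suc k"] Suc.prems by auto
  ultimately show ?case by (simp add: algebra_simps)
qed simp

text \<open>Loading leaves both heads behind the last symbol. There \<open>Copy False\<close> sees
  the end of a nonfinal entry and proceeds to \<open>RewP\<close>, so it can serve as the start
  state.\<close>

definition check_start :: "(bool \<times> op list) list \<Rightarrow> (bool \<times> op list) list \<Rightarrow> checker" where
  "check_start bs es = (Copy False, zip_tape (rev (blocks bs)) [], zip_tape (rev (blocks es)) [], blank_tape, [])"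

lemma check_start_Suc:
  "accepts_in A (Suc n) (check_start bs es) \<longleftrightarrow>
   accepts_in A n (RewP, zip_tape (rev (blocks bs)) [], zip_left (rev (blocks es)) [], blank_tape, [])"
  by (simp add: check_start_def accepts_in_Suc)

lemma check_sound:
  assumes "\<forall>b\<in>set bs \<union> set es. length (snd b) = m" "accepts_in A n (check_start bs es)"
  shows "\<exists>cs e. set cs \<subseteq> {b \<in> set es. \<not> fst b} \<and> e \<in> set es \<and> fst e \<and> passes A m (bs @ cs @ [e]) []"
proof -
  \<comment> \<open>One more step than granted, so that the first step can be split off even for
    \<open>n = 0\<close>.\<close>
  have "accepts_in A (Suc n) (check_start bs es)" using assms(2) by (rule accepts_in_mono) simp
  then have "accepts_in A n (RewP, zip_tape (rev (blocks bs)) [], zip_left (rev (blocks es)) [], blank_tape, [])"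
    unfolding check_start_Suc .
  then have "completes A es (blocks bs) blank_tape []"
    by (rule choose_sound(1)) (simp_all add: Blank_blocks)
  then obtain n' P cs e where *: "set cs \<subseteq> {b \<in> set es. \<not> fst b}" "e \<in> set es" "fst e"
     "accepts_in A n' (Forward, zip_tape [] (blocks bs @ blocks (cs @ [e])), P, blank_tape, [])"
    unfolding completes_def by blast
  have "accepts_in A (n' + passes_cost m 0 (bs @ cs @ [e])) (Forward, zip_tape [] (blocks (bs @ cs @ [e])), P, blank_tape, [])"
    by (rule accepts_in_mono[OF _ le_add1]) (use *(4) in simp)
  then have "passes A m (bs @ cs @ [e]) []"
    unfolding blocks_def by (subst (asm) all_sweeps) (use assms(1) * in auto)
  with * show ?thesis by blast
qed

text \<open>The constant depends on the table and on the number \<open>m\<close> of operations per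
  block, but not on the trace: the simulated machine fixes both the number of sweeps and the cost of
  each block.\<close>

lemma check_complete:
  "\<exists>C. \<forall>bs cs e. (\<forall>b\<in>set bs \<union> set es. length (snd b) = m) \<and> set cs \<subseteq> {b \<in> set es. \<not> fst b} \<and> e \<in> set es \<and> fst e
     \<and> passes A m (bs @ cs @ [e]) [] \<longrightarrow> accepts_in A (C * length (bs @ cs @ [e])) (check_start bs es)"
proof (intro exI allI impI, elim conjE)
  fix bs cs e
  assume m: "\<forall>b\<in>set bs \<union> set es. length (snd b) = m" and cs: "set cs \<subseteq> {b \<in> set es. \<not> fst b}"
    and e: "e \<in> set es" "fst e" and ps: "passes A m (bs @ cs @ [e]) []"
  let ?bs = "bs @ cs @ [e]" and ?p = "2 * length (blocks es) + 2"
  have len: "\<forall>b\<in>set ?bs. length (snd b) = m" using m cs e by auto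
  let ?n = "passes_cost m 0 ?bs"
  have "accepts_in A (0 + passes_cost m 0 ?bs) (Forward, zip_tape [] (blocks ?bs), P, blank_tape, [])" for P
    unfolding blocks_def by (subst all_sweeps) (use len ps in auto)
  then have "accepts_in A (?n + length (blocks bs @ blocks (cs @ [e])) + ?p * (length cs + 1) + 1)
    (RewP, zip_tape (rev (blocks bs)) [], zip_left (rev (blocks es)) [], blank_tape, [])"
    by (intro choose_complete cs e Blank_blocks) simp_all
  then have acc: "accepts_in A (Suc (?n + length (blocks ?bs) + ?p * (length cs + 1) + 1)) (check_start bs es)"
    unfolding check_start_Suc by simp
  have "length (blocks xs) = length xs * (m + 1)" if "\<forall>b\<in>set xs. length (snd b) = m" for xs
    using that by (induction xs) (auto simp: block_def)
  from this[OF len] have L: "length (blocks ?bs) = length ?bs * (m + 1)" .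
  have N: "?n \<le> m * (length ?bs * (2 * (m + 2)) + 2) + m + 2"
    using passes_cost_le[OF len, of 0] by simp
  have "?p * (length cs + 1) \<le> ?p * length ?bs" by (rule mult_le_mono2) simp
  moreover have "m * 2 \<le> (m * 2) * length ?bs" "m + 4 \<le> (m + 4) * length ?bs" by simp_all
  ultimately have "Suc (?n + length (blocks ?bs) + ?p * (length cs + 1) + 1)
    \<le> (m * (2 * (m + 2)) + m * 2 + (m + 4) + (m + 1) + ?p) * length ?bs"
    using N L by (simp add: algebra_simps)
  then show "accepts_in A ((m * (2 * (m + 2)) + m * 2 + (m + 4) + (m + 1) + ?p) * length ?bs) (check_start bs es)"
    by (rule accepts_in_mono[OF acc])
qed

section \<open>The universal machine\<close>

instance direction :: countable by countable_datatype
instance op :: countable by countable_datatype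
instance symbol :: countable by countable_datatype
instance control :: countable by countable_datatype

instance direction :: finite
proof
  have "(UNIV :: direction set) \<subseteq> {Go_Left, Stay, Go_Right}" using direction.exhaust by auto
  then show "finite (UNIV :: direction set)" by (rule finite_subset) simp
qed

instance op :: finite
proof
  have "(UNIV :: op set) \<subseteq> insert Nop (range (\<lambda>(r, r', d). RW r r' d) \<union> range Out \<union> range Ask)"
  proof
    fix x show "x \<in> insert Nop (range (\<lambda>(r, r', d). RW r r' d) \<union> range Out \<union> range Ask)"
      by (cases x) (auto simp: image_iff)
  qed
  then show "finite (UNIV :: op set)" by (rule finite_subset) simp
qed

instance symbol :: finite
proof
  have "(UNIV :: symbol set) \<subseteq> {Blank, Done} \<union> range Sep \<union> range Fresh \<union> range Cur"
  proof
    fix x show "x \<in> {Blank, Done} \<union> range Sep \<union> range Fresh \<union> range Cur" by (cases x) auto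
  qed
  then show "finite (UNIV :: symbol set)" by (rule finite_subset) simp
qed

instance control :: finite
proof
  have "(UNIV :: control set) \<subseteq> {RewP, Choose, RewT, Forward, Seek, Backward, Accept, Reject}
    \<union> range Copy \<union> range Asking \<union> range Restore"
  proof
    fix x show "x \<in> {RewP, Choose, RewT, Forward, Seek, Backward, Accept, Reject}
      \<union> range Copy \<union> range Asking \<union> range Restore" by (cases x) auto
  qed
  then show "finite (UNIV :: control set)" by (rule finite_subset) simp
qed

text \<open>\<open>Blank\<close> has to become 0, the blank of a machine, so that empty tapes
  correspond.\<close>

definition symbol_code :: "symbol \<Rightarrow> nat" where
  "symbol_code s = (if s = Blank then 0 else Suc (to_nat s))"

definition bit_code :: "bool \<Rightarrow> nat" where
  "bit_code b = (if b then 1 else 0)"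

lemma symbol_code_eq [simp]: "symbol_code s = symbol_code s' \<longleftrightarrow> s = s'"
  by (auto simp: symbol_code_def)

lemma bit_code_eq [simp]: "bit_code b = bit_code b' \<longleftrightarrow> b = b'"
  by (auto simp: bit_code_def)

lemma symbol_code_Blank [simp]: "symbol_code Blank = 0"
  by (simp add: symbol_code_def)

lemma bit_code_False [simp]: "bit_code False = 0"
  by (simp add: bit_code_def)

fun encode_tape :: "('a \<Rightarrow> nat) \<Rightarrow> 'a ptape \<Rightarrow> tape" where
  "encode_tape f (h, T) = (h, f \<circ> T)"

lemma scan_encode_tape [simp]: "scan_tape (encode_tape f T) = f (scan T)"
  by (cases T) auto

lemma act_encode_tape [simp]: "act_tape (f s, d) (encode_tape f T) = encode_tape f (act (s, d) T)"
  by (cases T) auto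

text \<open>
  The input is a sequence of numbers in unary notation: zero is padding, and any other number
  tells the machine to append a symbol to the trace tape (\<open>True\<close>) or to the table tape
  (\<open>False\<close>).
\<close>

definition token_code :: "bool \<times> symbol \<Rightarrow> nat" where
  "token_code t = Suc (to_nat t)"

definition max_code :: nat where
  "max_code = Max (range token_code)"

lemma token_code_le: "token_code t \<le> max_code"
  unfolding max_code_def by (rule Max_ge) auto

definition emitted :: "bool \<Rightarrow> nat \<Rightarrow> symbol list" where
  "emitted b i =
     (case i of 0 \<Rightarrow> [] | Suc m \<Rightarrow> (case from_nat m of (b', s) \<Rightarrow> if b' = b then [s] else []))"

definition write_act :: "bool \<Rightarrow> nat \<Rightarrow> nat \<times> direction" where
  "write_act b i = (case emitted b i of [] \<Rightarrow> (0, Stay) | s # _ \<Rightarrow> (symbol_code s, Go_Right))"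

lemma emitted_token_code: "emitted b (token_code (b', s)) = (if b' = b then [s] else [])"
  by (simp add: emitted_def token_code_def)

lemma emitted_0: "emitted b 0 = []"
  by (simp add: emitted_def)

lemma write_act: "act_tape (write_act b i) (encode_tape symbol_code (zip_tape l []))
  = encode_tape symbol_code (zip_tape (rev (emitted b i) @ l) [])"
proof -
  have "emitted b i = [] \<or> (\<exists>s. emitted b i = [s])"
    by (auto simp: emitted_def split: nat.splits prod.splits)
  then consider "emitted b i = []" | s where "emitted b i = [s]" by blast
  then show ?thesis
  proof cases
    case 1
    have "act_tape (symbol_code Blank, Stay) (encode_tape symbol_code (zip_tape l []))
      = encode_tape symbol_code (zip_tape l [])"
      using act_scan[of "zip_tape l []"] unfolding act_encode_tape by simp
    with 1 show ?thesis by (simp add: write_act_def)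
  next
    case 2
    then show ?thesis by (simp add: write_act_def)
  qed
qed

lemma stay_zip_tape: "act_tape (0, Stay) (encode_tape symbol_code (zip_tape l []))
  = encode_tape symbol_code (zip_tape l [])"
  using write_act[of True 0 l] by (simp add: write_act_def emitted_0)

lemma stay_blank_tape: "act_tape (0, Stay) (encode_tape bit_code blank_tape) = encode_tape bit_code blank_tape"
  by (auto simp: blank_tape_def)

text \<open>\<open>Load i\<close>: \<open>i\<close> bits \<open>True\<close> of the current number
  have been read. \<open>Rewind\<close>: the input head returns, as the clock expects it on the
  first cell. \<open>Main g v\<close>: clock state \<open>g\<close> and control state
  \<open>v\<close> side by side.\<close>

datatype phase = Load nat | Rewind | Main nat control | Halt

instance phase :: countable by countable_datatype

definition phase_code :: "phase \<Rightarrow> nat" where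
  "phase_code = to_nat"

lemma phase_code_eq [simp]: "phase_code s = phase_code s' \<longleftrightarrow> s = s'"
  by (simp add: phase_code_def)

text \<open>A machine has a single accept state, so the clock state is forgotten on
  acceptance.\<close>

definition main_phase :: "nat \<Rightarrow> control \<Rightarrow> phase" where
  "main_phase g v = (if v = Accept then Halt else Main g v)"

lemma main_phase_eq: "main_phase g v = Main g' v' \<longleftrightarrow> v \<noteq> Accept \<and> g = g' \<and> v' = v"
  by (auto simp: main_phase_def)

text \<open>The product of a clock step and a checker action: the input head belongs to the clock,
  the oracle tape to the checker. The equation for \<open>Query\<close> is a default value, as the
  clock is oracle-free.\<close>

fun main_instruction :: "instruction \<Rightarrow> control \<Rightarrow> symbol \<Rightarrow> symbol \<Rightarrow> bool \<Rightarrow> action \<Rightarrow> instruction" where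
  "main_instruction (Step g x ys g' d acts u) v t p w (v', (t', dt), (p', dp), (w', dw), out) =
     Step (phase_code (Main g v)) x (symbol_code t # symbol_code p # bit_code w # ys)
       (phase_code (main_phase g' v')) d
       ((symbol_code t', dt) # (symbol_code p', dp) # (bit_code w', dw) # acts) out"
| "main_instruction (Query q y n) v t p w a = Query q y n"

text \<open>A query cannot act on the work tapes, so the clock pauses meanwhile; hence the factor 2
  before the clock time in the running time of \<open>U\<close>.\<close>

definition query_instruction :: "nat \<Rightarrow> bool \<Rightarrow> instruction" where
  "query_instruction g b = Query (phase_code (Main g (Asking b)))
     (phase_code (Main g (if b then Forward else Reject))) (phase_code (Main g (if b then Reject else Forward)))"

locale universal =
  fixes G :: machine
  assumes tm: "turing_machine G" and oracle_free: "oracle_free G"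
begin

abbreviation "b \<equiv> work_tapes G"

definition idle :: "(nat \<times> direction) list" where
  "idle = replicate b (0, Stay)"

text \<open>All work heads stand on blanks throughout: trace and table grow at their right ends, and
  the clock tapes are untouched. For numbers above \<open>max_code\<close> there is no instruction,
  so the machine stops.\<close>

definition load_program :: "instruction set" where
  "load_program =
     (\<lambda>i. Step (phase_code (Load i)) (Bit True) (0 # 0 # 0 # replicate b 0)
        (phase_code (Load (Suc i))) Go_Right ((0, Stay) # (0, Stay) # (0, Stay) # idle) None) ` {..<max_code}
   \<union> (\<lambda>i. Step (phase_code (Load i)) (Bit False) (0 # 0 # 0 # replicate b 0)
        (phase_code (Load 0)) Go_Right (write_act True i # write_act False i # (0, Stay) # idle) None) ` {..max_code}
   \<union> {Step (phase_code (Load 0)) Right_End (0 # 0 # 0 # replicate b 0)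
        (phase_code Rewind) Go_Left ((0, Stay) # (0, Stay) # (0, Stay) # idle) None}
   \<union> range (\<lambda>a. Step (phase_code Rewind) (Bit a) (0 # 0 # 0 # replicate b 0)
        (phase_code Rewind) Go_Left ((0, Stay) # (0, Stay) # (0, Stay) # idle) None)
   \<union> {Step (phase_code Rewind) Left_End (0 # 0 # 0 # replicate b 0)
        (phase_code (Main (start_state G) (Copy False))) Go_Right ((0, Stay) # (0, Stay) # (0, Stay) # idle) None}"

definition main_program :: "instruction set" where
  "main_program = (\<Union>i\<in>program G. \<Union>v t p w. main_instruction i v t p w ` set (delta v t p w))"

text \<open>A finite set that the clock state never leaves, so finitely many query instructions
  suffice.\<close>

definition states :: "nat set" where
  "states = insert (start_state G) (\<Union>i\<in>program G. targets i)"

definition query_program :: "instruction set" where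
  "query_program = (\<Union>g\<in>states. range (query_instruction g))"

definition U :: machine where
  "U = \<lparr>work_tapes = 3 + b, start_state = phase_code (Load 0), accept_state = phase_code Halt,
     program = load_program \<union> main_program \<union> query_program\<rparr>"

lemma turing_machine_U: "turing_machine U"
proof -
  have fin: "finite (program G)" using tm by (simp add: turing_machine_def)
  moreover have "finite (targets i)" for i by (cases i) auto
  ultimately have "finite states" by (auto simp: states_def)
  then have "finite (program U)"
    using fin by (auto simp: U_def load_program_def main_program_def query_program_def)
  moreover have "instruction_wf (3 + b) i" if "i \<in> load_program" for i
    using that by (auto simp: load_program_def idle_def)
  moreover have "instruction_wf (3 + b) i" if "i \<in> query_program" for i
    using that by (auto simp: query_program_def query_instruction_def)
  moreover have "instruction_wf (3 + b) (main_instruction i v t p w a)" if "i \<in> program G" for i v t p w a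
  proof -
    have "instruction_wf b i" using tm that by (auto simp: turing_machine_def)
    then show ?thesis by (cases "(i, v, t, p, w, a)" rule: main_instruction.cases) auto
  qed
  then have "instruction_wf (3 + b) i" if "i \<in> main_program" for i
    using that by (auto simp: main_program_def)
  ultimately show ?thesis by (auto simp: turing_machine_def U_def)
qed

section \<open>Configurations and steps of the universal machine\<close>

definition load_config :: "nat \<Rightarrow> nat \<Rightarrow> symbol list \<Rightarrow> symbol list \<Rightarrow> config" where
  "load_config i p tr pl = \<lparr>state = phase_code (Load i), input_head = p,
     tapes = encode_tape symbol_code (zip_tape (rev tr) []) # encode_tape symbol_code (zip_tape (rev pl) [])
       # encode_tape bit_code blank_tape # replicate b (0, \<lambda>_. 0), oracle_tape = []\<rparr>"

definition rewind_config :: "nat \<Rightarrow> symbol list \<Rightarrow> symbol list \<Rightarrow> config" where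
  "rewind_config p tr pl = (load_config 0 p tr pl)\<lparr>state := phase_code Rewind\<rparr>"

fun main_config :: "config \<Rightarrow> checker \<Rightarrow> config" where
  "main_config c (v, T, P, W, q) = \<lparr>state = phase_code (main_phase (state c) v), input_head = input_head c,
     tapes = encode_tape symbol_code T # encode_tape symbol_code P # encode_tape bit_code W # tapes c,
     oracle_tape = q\<rparr>"

definition start_check :: "symbol list \<Rightarrow> symbol list \<Rightarrow> checker" where
  "start_check tr pl = (Copy False, zip_tape (rev tr) [], zip_tape (rev pl) [], blank_tape, [])"

lemma scan_blank_tape [simp]: "scan blank_tape = False"
  by (simp add: blank_tape_def)

lemma idle_tapes: "map2 act_tape idle (replicate b (0, \<lambda>_. 0)) = replicate b (0, \<lambda>_. 0)"
proof -
  have "map2 act_tape (replicate n (0, Stay)) (replicate n (0, \<lambda>_. 0)) = replicate n (0, \<lambda>_. 0)" for n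
    by (induction n) auto
  then show ?thesis by (simp add: idle_def)
qed

lemma initial_U: "initial U = load_config 0 1 [] []"
proof -
  have "cells [] = (\<lambda>_. Blank)" by (auto simp: cells_def)
  then have "encode_tape symbol_code (zip_tape [] []) = (0, \<lambda>_. 0)"
    by (auto simp: zip_tape_def)
  moreover have "encode_tape bit_code blank_tape = (0, \<lambda>_. 0)" by (auto simp: blank_tape_def)
  ultimately show ?thesis by (simp add: initial_def U_def load_config_def numeral_3_eq_3)
qed

lemma main_program_phase: "i \<in> main_program \<Longrightarrow> \<exists>g v. source i = phase_code (Main g v)"
proof -
  have "\<exists>g v'. source (main_instruction i v t p w a) = phase_code (Main g v')" if "i \<in> program G" for i v t p w a
  proof -
    have "instruction_oracle_free i" using that oracle_free by (auto simp: oracle_free_def)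
    then show ?thesis by (cases "(i, v, t, p, w, a)" rule: main_instruction.cases) auto
  qed
  then show "i \<in> main_program \<Longrightarrow> \<exists>g v. source i = phase_code (Main g v)"
    unfolding main_program_def by blast
qed

lemma query_program_phase: "i \<in> query_program \<Longrightarrow> \<exists>g v. source i = phase_code (Main g v)"
  by (auto simp: query_program_def query_instruction_def)

lemma step_load_phase:
  assumes "state c = phase_code s" "\<And>g v. s \<noteq> Main g v"
  shows "step A U x c c' \<longleftrightarrow> (\<exists>i\<in>load_program.
     applicable i (state c) (scan_input x (input_head c)) (map scan_tape (tapes c)) \<and> c' = execute A x i c)"
proof -
  have "i \<in> load_program" if "i \<in> program U" "applicable i (state c) y ys" for i y ys
  proof -
    have "source i = phase_code s" using that(2) assms(1) by (simp add: applicable_source)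
    then have "i \<notin> main_program" "i \<notin> query_program"
      using assms(2) main_program_phase[of i] query_program_phase[of i] by auto
    with that(1) show ?thesis by (simp add: U_def)
  qed
  then show ?thesis unfolding step_def by (auto simp: U_def)
qed

lemma step_load_config:
  assumes "1 \<le> p" "p \<le> length x + 1"
  shows "step A U x (load_config i p tr pl) c' \<longleftrightarrow>
    (case scan_input x p of
       Left_End \<Rightarrow> False
     | Bit True \<Rightarrow> i < max_code \<and> c' = load_config (Suc i) (p + 1) tr pl
     | Bit False \<Rightarrow> i \<le> max_code \<and> c' = load_config 0 (p + 1) (tr @ emitted True i) (pl @ emitted False i)
     | Right_End \<Rightarrow> i = 0 \<and> c' = rewind_config (p - 1) tr pl)"
proof -
  have sc: "map scan_tape (replicate b (0, \<lambda>_. 0)) = replicate b 0" by simp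
  have mv: "move_input x Go_Right p = p + 1" if "scan_input x p = Bit a" for a
    using that assms by (auto simp: scan_input_def split: if_splits)
  show ?thesis
    by (subst step_load_phase[of _ "Load i"])
      (use mv assms in \<open>auto simp: load_config_def rewind_config_def load_program_def sc idle_tapes write_act
        stay_zip_tape stay_blank_tape bex_Un split: input_symbol.splits bool.splits\<close>)
qed

lemma step_rewind_config:
  assumes "p \<le> length x"
  shows "step A U x (rewind_config p tr pl) c' \<longleftrightarrow>
    (if p = 0 then c' = main_config (initial G) (start_check tr pl) else c' = rewind_config (p - 1) tr pl)"
proof -
  have sc: "map scan_tape (replicate b (0, \<lambda>_. 0)) = replicate b 0" by simp
  show ?thesis
    by (subst step_load_phase[of _ Rewind])
      (use assms in \<open>auto simp: load_config_def rewind_config_def load_program_def sc idle_tapes bex_Un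
        stay_zip_tape stay_blank_tape scan_input_def start_check_def initial_def main_phase_def\<close>)
qed

text \<open>Since the clock is oracle-free, its own steps can be described with the empty oracle;
  what remains besides joint moves is a query with the clock at rest.\<close>

lemma step_main_config:
  "step A U x (main_config c s) c' \<longleftrightarrow>
     (\<exists>d. step {} G x c d \<and> (\<exists>a\<in>set (actions s). c' = main_config d (apply_action a s)))
   \<or> (\<exists>r. fst s = Asking r) \<and> state c \<in> states \<and> c' = main_config c (answer A s)"
  (is "?L \<longleftrightarrow> ?R1 \<or> ?R2")
proof -
  obtain v T P W q where s: "s = (v, T, P, W, q)" by (cases s) auto
  have exec: "execute A x (main_instruction i v t p w a) (main_config c s)
      = main_config (execute {} x i c) (apply_action a s)"
    if "instruction_oracle_free i" for i t p w a
    using that by (cases "(i, v, t, p, w, a)" rule: main_instruction.cases) (auto simp: s split: option.splits)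
  have appl: "applicable (main_instruction i v' t p w a) (state (main_config c s)) (scan_input x (input_head c))
      (map scan_tape (tapes (main_config c s)))
     \<longleftrightarrow> v \<noteq> Accept \<and> v' = v \<and> t = scan T \<and> p = scan P \<and> w = scan W \<and>
       applicable i (state c) (scan_input x (input_head c)) (map scan_tape (tapes c))"
    if "instruction_oracle_free i" for i v' t p w a
    using that by (cases "(i, v', t, p, w, a)" rule: main_instruction.cases) (auto simp: s main_phase_eq)
  have of: "instruction_oracle_free i" if "i \<in> program G" for i
    using that oracle_free by (auto simp: oracle_free_def)
  have head: "input_head (main_config c s) = input_head c" by (simp add: s)
  show ?thesis
  proof
    assume ?L
    then obtain i where i: "i \<in> program U" "c' = execute A x i (main_config c s)"
      "applicable i (state (main_config c s)) (scan_input x (input_head c)) (map scan_tape (tapes (main_config c s)))"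
      unfolding step_def head by blast
    consider "i \<in> load_program" | "i \<in> main_program" | "i \<in> query_program"
      using i(1) by (auto simp: U_def)
    then show "?R1 \<or> ?R2"
    proof cases
      case 1
      then show ?thesis using i(3) by (auto simp: load_program_def s main_phase_def split: if_splits)
    next
      case 2
      then obtain j v' t p w a where j: "j \<in> program G" "a \<in> set (delta v' t p w)"
        "i = main_instruction j v' t p w a" by (auto simp: main_program_def)
      from appl[OF of[OF j(1)], of v' t p w a] i(3) j(3) have
        eq: "v' = v" "t = scan T" "p = scan P" "w = scan W" and
        ap: "applicable j (state c) (scan_input x (input_head c)) (map scan_tape (tapes c))" by auto
      have "step {} G x c (execute {} x j c)" using j(1) ap by (auto simp: step_def)
      moreover have "c' = main_config (execute {} x j c) (apply_action a s)"
        using exec[OF of[OF j(1)]] i(2) j(3) eq by simp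
      moreover have "a \<in> set (actions s)" using j(2) eq by (simp add: s)
      ultimately show ?thesis by blast
    next
      case 3
      then obtain g r where g: "g \<in> states" "i = query_instruction g r" by (auto simp: query_program_def)
      then have "g = state c" "v = Asking r" using i(3) by (auto simp: query_instruction_def s main_phase_eq)
      then have "?R2" using g i(2) by (auto simp: s query_instruction_def main_phase_def)
      then show ?thesis ..
    qed
  next
    assume "?R1 \<or> ?R2"
    then show ?L
    proof
      assume ?R1
      then obtain j a where j: "j \<in> program G" "a \<in> set (actions s)"
        "applicable j (state c) (scan_input x (input_head c)) (map scan_tape (tapes c))"
        "c' = main_config (execute {} x j c) (apply_action a s)"
        unfolding step_def by blast
      let ?i = "main_instruction j v (scan T) (scan P) (scan W) a"
      have a: "a \<in> set (delta v (scan T) (scan P) (scan W))" using j(2) by (simp add: s)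
      then have "v \<noteq> Accept" by auto
      then have "applicable ?i (state (main_config c s)) (scan_input x (input_head c)) (map scan_tape (tapes (main_config c s)))"
        using appl[OF of[OF j(1)]] j(3) by simp
      moreover have "?i \<in> main_program" unfolding main_program_def using j(1) a by blast
      then have "?i \<in> program U" by (simp add: U_def)
      moreover have "c' = execute A x ?i (main_config c s)" using exec[OF of[OF j(1)]] j(4) by simp
      ultimately show ?L unfolding step_def head by blast
    next
      assume ?R2
      then obtain r where r: "v = Asking r" "state c \<in> states" "c' = main_config c (answer A s)" by (auto simp: s)
      then have "query_instruction (state c) r \<in> program U" by (auto simp: U_def query_program_def)
      then show ?L unfolding step_def
        by (rule bexI[rotated]) (use r in \<open>auto simp: s query_instruction_def main_phase_def\<close>)
    qed
  qed
qed

lemma main_config_Halt: "state (main_config c s) = accept_state U \<longleftrightarrow> fst s = Accept"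
  by (cases s) (auto simp: main_phase_def U_def)

lemma accept_sink_U: "accept_sink U"
proof -
  have "source i \<noteq> phase_code Halt" if "i \<in> load_program" for i
    using that by (auto simp: load_program_def)
  moreover have "source i \<noteq> phase_code Halt" if "i \<in> main_program" for i
    using main_program_phase[OF that] by auto
  moreover have "source i \<noteq> phase_code Halt" if "i \<in> query_program" for i
    using query_program_phase[OF that] by auto
  ultimately show ?thesis by (auto simp: accept_sink_def U_def)
qed

text \<open>A potential: a pending query is a step for which the preceding joint move pays in
  advance.\<close>

definition asking :: "checker \<Rightarrow> nat" where
  "asking s = (case fst s of Asking r \<Rightarrow> 1 | _ \<Rightarrow> 0)"

lemma asking_le: "asking s \<le> 1"
  by (auto simp: asking_def split: control.splits)

lemma asking_answer: "asking (answer A s) = 0"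
  by (cases s) (auto simp: asking_def)

text \<open>Loading and returning take at most \<open>length x + 1\<close> steps each. Thereafter
  each clock step allows two steps of \<open>U\<close>: a joint move and possibly a query, which is
  never followed by another query immediately.\<close>

lemma path_U:
  assumes "(step A U x ^^ k) (initial U) c"
  shows "(\<exists>i tr pl. k \<le> length x \<and> c = load_config i (k + 1) tr pl)
    \<or> (\<exists>p tr pl. p \<le> length x \<and> k + p = 2 * length x + 1 \<and> c = rewind_config p tr pl)
    \<or> (\<exists>j d s. (step {} G x ^^ j) (initial G) d \<and> c = main_config d s
        \<and> k + asking s \<le> 2 * length x + 2 + 2 * j)"
  using assms
proof (induction k arbitrary: c)
  case 0
  then show ?case by (auto simp: initial_U)
next
  case (Suc k)
  then obtain c0 where c0: "(step A U x ^^ k) (initial U) c0" "step A U x c0 c" by auto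
  from Suc.IH[OF c0(1)] consider
    i tr pl where "k \<le> length x" "c0 = load_config i (k + 1) tr pl"
    | p tr pl where "p \<le> length x" "k + p = 2 * length x + 1" "c0 = rewind_config p tr pl"
    | j d s where "(step {} G x ^^ j) (initial G) d" "c0 = main_config d s" "k + asking s \<le> 2 * length x + 2 + 2 * j"
    by blast
  then show ?case
  proof cases
    case 1
    then have st: "case scan_input x (k + 1) of
       Left_End \<Rightarrow> False
     | Bit True \<Rightarrow> i < max_code \<and> c = load_config (Suc i) (k + 1 + 1) tr pl
     | Bit False \<Rightarrow> i \<le> max_code \<and> c = load_config 0 (k + 1 + 1) (tr @ emitted True i) (pl @ emitted False i)
     | Right_End \<Rightarrow> i = 0 \<and> c = rewind_config (k + 1 - 1) tr pl"
      using c0(2) step_load_config[of "k + 1" x A i tr pl c] by simp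
    show ?thesis
    proof (cases "k = length x")
      case True
      then have "c = rewind_config (length x) tr pl" using st by (simp add: scan_input_def)
      then have "\<exists>p tr pl. p \<le> length x \<and> Suc k + p = 2 * length x + 1 \<and> c = rewind_config p tr pl"
        using True by (intro exI[of _ "length x"]) auto
      then show ?thesis by blast
    next
      case False
      then obtain a where "scan_input x (k + 1) = Bit a" using 1 by (auto simp: scan_input_def)
      then have "\<exists>i tr pl. c = load_config i (Suc k + 1) tr pl" using st by (cases a) auto
      moreover have "Suc k \<le> length x" using False 1 by simp
      ultimately show ?thesis by blast
    qed
  next
    case 2
    then have st: "if p = 0 then c = main_config (initial G) (start_check tr pl) else c = rewind_config (p - 1) tr pl"
      using c0(2) step_rewind_config by blast
    show ?thesis
    proof (cases "p = 0")
      case True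
      have "asking (start_check tr pl) = 0" by (simp add: asking_def start_check_def)
      then have "(step {} G x ^^ 0) (initial G) (initial G) \<and> c = main_config (initial G) (start_check tr pl)
        \<and> Suc k + asking (start_check tr pl) \<le> 2 * length x + 2 + 2 * 0"
        using st True 2 by simp
      then show ?thesis by blast
    next
      case False
      then have "p - 1 \<le> length x \<and> Suc k + (p - 1) = 2 * length x + 1 \<and> c = rewind_config (p - 1) tr pl"
        using st 2 by auto
      then show ?thesis by blast
    qed
  next
    case 3
    from c0(2)[unfolded 3(2) step_main_config] show ?thesis
    proof (elim disjE exE conjE bexE)
      fix d' a assume d': "step {} G x d d'" "a \<in> set (actions s)" "c = main_config d' (apply_action a s)"
      have "(step {} G x ^^ Suc j) (initial G) d'" using 3(1) d'(1) by auto
      moreover have "Suc k + asking (apply_action a s) \<le> 2 * length x + 2 + 2 * Suc j"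
        using 3(3) asking_le[of "apply_action a s"] by simp
      ultimately show ?thesis using d'(3) by blast
    next
      fix r assume r: "fst s = Asking r" "c = main_config d (answer A s)"
      then have "Suc k + asking (answer A s) \<le> 2 * length x + 2 + 2 * j"
        using 3(3) asking_answer by (simp add: asking_def)
      then show ?thesis using 3(1) r by blast
    qed
  qed
qed

text \<open>The bound covers every guess and every input, because only a pending query can still
  happen once the clock has halted.\<close>

lemma runs_within_U:
  assumes "runs_within {} G t"
  shows "runs_within A U (\<lambda>n. 2 * n + 2 + 2 * t n)"
  unfolding runs_within_def
proof (intro allI impI)
  fix x c k assume "(step A U x ^^ k) (initial U) c"
  from path_U[OF this] show "k \<le> 2 * length x + 2 + 2 * t (length x)"
  proof (elim disjE exE conjE)
    fix j d s assume "(step {} G x ^^ j) (initial G) d" "k + asking s \<le> 2 * length x + 2 + 2 * j"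
    moreover from this have "j \<le> t (length x)" using assms by (auto simp: runs_within_def)
    ultimately show ?thesis by linarith
  qed auto
qed

section \<open>Acceptance by the universal machine\<close>

definition reaches_accept :: "bool list set \<Rightarrow> bool list \<Rightarrow> config \<Rightarrow> bool" where
  "reaches_accept A x c \<longleftrightarrow> (\<exists>c'. (step A U x)\<^sup>*\<^sup>* c c' \<and> state c' = accept_state U)"

lemma reaches_accept_unique_step:
  assumes "\<And>c'. step A U x c c' \<longleftrightarrow> c' = d" "state c \<noteq> accept_state U"
  shows "reaches_accept A x c \<longleftrightarrow> reaches_accept A x d"
  unfolding reaches_accept_def
  using assms by (metis converse_rtranclpE converse_rtranclp_into_rtranclp)

lemma language_U: "x \<in> language A U \<longleftrightarrow> reaches_accept A x (load_config 0 1 [] [])"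
  using accept_sink_halted[OF accept_sink_U]
  by (auto simp: language_def accepts_def halts_in_def reaches_accept_def initial_U)

lemma load_not_accept: "state (load_config i p tr pl) \<noteq> accept_state U" "state (rewind_config p tr pl) \<noteq> accept_state U"
  by (auto simp: load_config_def rewind_config_def U_def)

fun token_bits :: "(bool \<times> symbol) option \<Rightarrow> bool list" where
  "token_bits None = [False]"
| "token_bits (Some t) = replicate (token_code t) True @ [False]"

fun token_symbols :: "bool \<Rightarrow> (bool \<times> symbol) option \<Rightarrow> symbol list" where
  "token_symbols a None = []"
| "token_symbols a (Some (a', s)) = (if a' = a then [s] else [])"

lemma load_True:
  assumes "i + k \<le> max_code" "x = y @ replicate k True @ z"
  shows "reaches_accept A x (load_config i (length y + 1) tr pl)
    \<longleftrightarrow> reaches_accept A x (load_config (i + k) (length y + k + 1) tr pl)"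
  using assms
proof (induction k arbitrary: i y)
  case (Suc k)
  have "reaches_accept A x (load_config i (length y + 1) tr pl)
    \<longleftrightarrow> reaches_accept A x (load_config (Suc i) (length y + 1 + 1) tr pl)"
    by (rule reaches_accept_unique_step, subst step_load_config)
      (use Suc.prems load_not_accept in \<open>auto simp: scan_input_def nth_append\<close>)
  also have "\<dots> \<longleftrightarrow> reaches_accept A x (load_config (Suc i + k) (length (y @ [True]) + k + 1) tr pl)"
    using Suc.IH[of "Suc i" "y @ [True]"] Suc.prems by simp
  finally show ?case by simp
qed simp

lemma load_False:
  assumes "i \<le> max_code" "x = y @ False # z"
  shows "reaches_accept A x (load_config i (length y + 1) tr pl)
    \<longleftrightarrow> reaches_accept A x (load_config 0 (length y + 2) (tr @ emitted True i) (pl @ emitted False i))"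
  by (rule reaches_accept_unique_step, subst step_load_config)
    (use assms load_not_accept in \<open>auto simp: scan_input_def nth_append\<close>)

lemma load_token:
  assumes "x = y @ token_bits t @ z"
  shows "reaches_accept A x (load_config 0 (length y + 1) tr pl)
    \<longleftrightarrow> reaches_accept A x (load_config 0 (length (y @ token_bits t) + 1)
          (tr @ token_symbols True t) (pl @ token_symbols False t))"
proof (cases t)
  case None
  then show ?thesis using load_False[of 0 x y z A tr pl] assms by (simp add: emitted_0)
next
  case (Some u)
  obtain a s where u: "u = (a, s)" by fastforce
  let ?k = "token_code u"
  have "reaches_accept A x (load_config 0 (length y + 1) tr pl)
    \<longleftrightarrow> reaches_accept A x (load_config (0 + ?k) (length y + ?k + 1) tr pl)"
    by (rule load_True) (use assms Some token_code_le in auto)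
  also have "\<dots> \<longleftrightarrow> reaches_accept A x (load_config ?k (length (y @ replicate ?k True) + 1) tr pl)"
    by simp
  also have "\<dots> \<longleftrightarrow> reaches_accept A x (load_config 0 (length (y @ replicate ?k True) + 2)
      (tr @ emitted True ?k) (pl @ emitted False ?k))"
    by (rule load_False) (use assms Some token_code_le in auto)
  finally show ?thesis using Some u by (simp add: emitted_token_code)
qed

lemma load_tokens:
  assumes "x = y @ concat (map token_bits ts) @ z"
  shows "reaches_accept A x (load_config 0 (length y + 1) tr pl)
    \<longleftrightarrow> reaches_accept A x (load_config 0 (length (y @ concat (map token_bits ts)) + 1)
          (tr @ concat (map (token_symbols True) ts)) (pl @ concat (map (token_symbols False) ts)))"
  using assms
proof (induction ts arbitrary: y tr pl)
  case (Cons t ts)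
  have "reaches_accept A x (load_config 0 (length y + 1) tr pl)
    \<longleftrightarrow> reaches_accept A x (load_config 0 (length (y @ token_bits t) + 1)
          (tr @ token_symbols True t) (pl @ token_symbols False t))"
    by (rule load_token) (use Cons.prems in simp)
  also have "\<dots> \<longleftrightarrow> reaches_accept A x (load_config 0 (length ((y @ token_bits t) @ concat (map token_bits ts)) + 1)
          ((tr @ token_symbols True t) @ concat (map (token_symbols True) ts))
          ((pl @ token_symbols False t) @ concat (map (token_symbols False) ts)))"
    by (rule Cons.IH) (use Cons.prems in simp)
  finally show ?case by simp
qed simp

lemma rewind_input:
  "p \<le> length x \<Longrightarrow> reaches_accept A x (rewind_config p tr pl)
    \<longleftrightarrow> reaches_accept A x (main_config (initial G) (start_check tr pl))"
proof (induction p)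
  case 0
  then show ?case
    by (intro reaches_accept_unique_step) (auto simp: step_rewind_config load_not_accept)
next
  case (Suc p)
  have "reaches_accept A x (rewind_config (Suc p) tr pl) \<longleftrightarrow> reaches_accept A x (rewind_config p tr pl)"
    using Suc.prems by (intro reaches_accept_unique_step) (auto simp: step_rewind_config load_not_accept)
  with Suc show ?case by simp
qed

text \<open>On such inputs the phases before the check have unique steps, so acceptance carries over
  to the first configuration of the check.\<close>

lemma language_U_tokens:
  assumes x: "x = concat (map token_bits ts)"
  shows "x \<in> language A U \<longleftrightarrow> reaches_accept A x (main_config (initial G)
    (start_check (concat (map (token_symbols True) ts)) (concat (map (token_symbols False) ts))))"
proof -
  let ?tr = "concat (map (token_symbols True) ts)" and ?pl = "concat (map (token_symbols False) ts)"
  have "x \<in> language A U \<longleftrightarrow> reaches_accept A x (load_config 0 (length x + 1) ?tr ?pl)"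
    using load_tokens[of x "[]" ts "[]" A "[]" "[]"] x by (simp add: language_U)
  also have "\<dots> \<longleftrightarrow> reaches_accept A x (rewind_config (length x) ?tr ?pl)"
    by (rule reaches_accept_unique_step, subst step_load_config)
      (auto simp: scan_input_def load_not_accept)
  also have "\<dots> \<longleftrightarrow> reaches_accept A x (main_config (initial G) (start_check ?tr ?pl))"
    by (rule rewind_input) simp
  finally show ?thesis .
qed

text \<open>Forgetting the clock turns an accepting run of \<open>U\<close> into one of the
  checker.\<close>

lemma main_sound:
  assumes "reaches_accept A x (main_config c s)"
  shows "\<exists>n. accepts_in A n s"
proof -
  obtain c' where c': "(step A U x)\<^sup>*\<^sup>* (main_config c s) c'" "state c' = accept_state U"
    using assms by (auto simp: reaches_accept_def)
  have "\<forall>c s. d = main_config c s \<longrightarrow> (\<exists>n. accepts_in A n s)" if "(step A U x)\<^sup>*\<^sup>* d c'" for d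
    using that
  proof (induction rule: converse_rtranclp_induct)
    case base
    then show ?case using c'(2) main_config_Halt by (intro allI impI exI[of _ 0]) auto
  next
    case (step d e)
    show ?case
    proof (intro allI impI)
      fix c s assume d: "d = main_config c s"
      from step.hyps(1)[unfolded d step_main_config]
      obtain c1 s1 where "e = main_config c1 s1" "check_step A s s1"
        unfolding check_step_def by blast
      moreover from this step.IH obtain n where "accepts_in A n s1" by blast
      ultimately have "accepts_in A (Suc n) s" unfolding accepts_in.simps(2) by blast
      then show "\<exists>n. accepts_in A n s" ..
    qed
  qed
  with c'(1) show ?thesis by blast
qed

lemma states_step: "step {} G x c d \<Longrightarrow> state d \<in> states"
proof -
  assume "step {} G x c d"
  then obtain i where i: "i \<in> program G" "d = execute {} x i c" by (auto simp: step_def)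
  have "state d \<in> targets i" using i(2) by (cases i) auto
  with i(1) show ?thesis by (auto simp: states_def)
qed

text \<open>A joint move uses one step of the budget and one of the clock, a query only one of the
  budget; so a clock run of length at least \<open>n\<close> lasts until acceptance.\<close>

lemma main_complete:
  assumes "accepts_in A n s" "(step {} G x ^^ m) c d" "n \<le> m" "state c \<in> states"
  shows "reaches_accept A x (main_config c s)"
  using assms
proof (induction n arbitrary: s c m)
  case 0
  then show ?case using main_config_Halt[of c s] by (auto simp: reaches_accept_def)
next
  case (Suc n)
  show ?case
  proof (cases "fst s = Accept")
    case True
    then show ?thesis using main_config_Halt[of c s] by (auto simp: reaches_accept_def)
  next
    case False
    then obtain s1 where s1: "check_step A s s1" "accepts_in A n s1"
      using Suc.prems(1) unfolding accepts_in.simps(2) by blast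
    obtain m' where m': "m = Suc m'" "n \<le> m'" using Suc.prems(3) by (cases m) auto
    have "\<exists>c1. step A U x (main_config c s) (main_config c1 s1) \<and> reaches_accept A x (main_config c1 s1)"
      using s1(1) unfolding check_step_def
    proof
      assume "\<exists>a\<in>set (actions s). s1 = apply_action a s"
      then obtain a where a: "a \<in> set (actions s)" "s1 = apply_action a s" by blast
      obtain c1 where c1: "step {} G x c c1" "(step {} G x ^^ m') c1 d"
        using Suc.prems(2) unfolding m' by (metis relpowp_Suc_D2)
      have "step A U x (main_config c s) (main_config c1 s1)"
        unfolding step_main_config using c1(1) a by blast
      moreover have "reaches_accept A x (main_config c1 s1)"
        using Suc.IH[OF s1(2) c1(2) m'(2)] states_step[OF c1(1)] .
      ultimately show ?thesis by blast
    next
      assume *: "(\<exists>b. fst s = Asking b) \<and> s1 = answer A s"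
      have "step A U x (main_config c s) (main_config c s1)"
        unfolding step_main_config using * Suc.prems(4) by blast
      moreover have "reaches_accept A x (main_config c s1)"
        using Suc.IH[OF s1(2) Suc.prems(2) _ Suc.prems(4)] Suc.prems(3) by simp
      ultimately show ?thesis by blast
    qed
    then show ?thesis unfolding reaches_accept_def by (meson converse_rtranclp_into_rtranclp)
  qed
qed

end

text \<open>Hence the run of the machine that constructs \<open>f\<close> is long enough for a clock.\<close>

lemma ones_le_steps:
  assumes tm: "turing_machine M" and run: "(step A M x ^^ k) (initial M) c"
    and j: "j < work_tapes M" and ones: "tape_has_ones m (tapes c ! j)"
  shows "m \<le> k"
proof -
  \<comment> \<open>A step writes at most one cell of each tape, so the number of nonblank cells
    grows by at most one.\<close>
  have *: "finite {p. snd (tapes c ! j) p \<noteq> 0} \<and> card {p. snd (tapes c ! j) p \<noteq> 0} \<le> k \<and> length (tapes c) = work_tapes M"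
    using run
  proof (induction k arbitrary: c)
    case 0
    then show ?case using j by (auto simp: initial_def)
  next
    case (Suc k)
    then obtain d where d: "(step A M x ^^ k) (initial M) d" "step A M x d c" by auto
    let ?N = "\<lambda>c. {p. snd (tapes c ! j) p \<noteq> 0}"
    have IH: "finite (?N d)" "card (?N d) \<le> k" "length (tapes d) = work_tapes M" using Suc.IH[OF d(1)] by auto
    have len: "length (tapes c) = work_tapes M" using length_tapes_step[OF tm d(2) IH(3)] .
    obtain i where i: "i \<in> program M" "c = execute A x i d" using d(2) by (auto simp: step_def)
    have wf: "instruction_wf (work_tapes M) i" using i tm by (auto simp: turing_machine_def)
    have sub: "?N c \<subseteq> insert (fst (tapes d ! j)) (?N d)"
    proof (cases i)
      case (Step q y ys q' dir acts out)
      then have "tapes c ! j = act_tape (acts ! j) (tapes d ! j)" using i wf IH(3) j by simp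
      then show ?thesis by (cases "acts ! j"; cases "tapes d ! j") (auto split: if_splits)
    qed (use i in auto)
    have "card (?N c) \<le> card (insert (fst (tapes d ! j)) (?N d))" by (rule card_mono) (use sub IH in auto)
    also have "\<dots> \<le> Suc k" using IH by (simp add: card_insert_if)
    finally show ?case using finite_subset[OF sub] IH len by auto
  qed
  obtain p where "\<And>i. snd (tapes c ! j) i = (if p \<le> i \<and> i < p + int m then 1 else 0)"
    using ones by (auto simp: tape_has_ones_def)
  then have "{p..<p + int m} \<subseteq> {p. snd (tapes c ! j) p \<noteq> 0}" by auto
  then have "card {p..<p + int m} \<le> k" using * card_mono le_trans by blast
  then show ?thesis by simp
qed

section \<open>Traces as tracks of bits\<close>

text \<open>The triple is the symbol read, the symbol written and the move; \<open>None\<close>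
  leaves the tape alone. A letter combines an operation on the oracle tape with one such operation
  per tape.\<close>

type_synonym cell_op = "(nat \<times> nat \<times> direction) option"
type_synonym letter = "op \<times> cell_op list"

fun cell_ok :: "cell_op \<Rightarrow> tape \<Rightarrow> bool" where
  "cell_ok None tp \<longleftrightarrow> True"
| "cell_ok (Some (r, r', d)) tp \<longleftrightarrow> scan_tape tp = r"

fun cell_act :: "cell_op \<Rightarrow> tape \<Rightarrow> tape" where
  "cell_act None tp = tp"
| "cell_act (Some (r, r', d)) tp = act_tape (r', d) tp"

fun oracle_ok :: "bool list set \<Rightarrow> op \<Rightarrow> bool list \<Rightarrow> bool" where
  "oracle_ok A (Ask b) q \<longleftrightarrow> (q \<in> A) = b"
| "oracle_ok A _ q \<longleftrightarrow> True"

fun oracle_act :: "op \<Rightarrow> bool list \<Rightarrow> bool list" where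
  "oracle_act (Out a) q = q @ [a]"
| "oracle_act (Ask b) q = []"
| "oracle_act _ q = q"

fun trace_ok :: "bool list set \<Rightarrow> letter list \<Rightarrow> tape list \<Rightarrow> bool list \<Rightarrow> bool" where
  "trace_ok A [] tps q \<longleftrightarrow> True"
| "trace_ok A ((x, gs) # ls) tps q \<longleftrightarrow> oracle_ok A x q \<and> list_all2 cell_ok gs tps \<and>
     trace_ok A ls (map2 cell_act gs tps) (oracle_act x q)"

fun cells_ok :: "cell_op list \<Rightarrow> tape \<Rightarrow> bool" where
  "cells_ok [] tp \<longleftrightarrow> True"
| "cells_ok (g # gs) tp \<longleftrightarrow> cell_ok g tp \<and> cells_ok gs (cell_act g tp)"

fun oracle_track :: "bool list set \<Rightarrow> op list \<Rightarrow> bool list \<Rightarrow> bool" where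
  "oracle_track A [] q \<longleftrightarrow> True"
| "oracle_track A (x # xs) q \<longleftrightarrow> oracle_ok A x q \<and> oracle_track A xs (oracle_act x q)"

text \<open>With all reads and writes fixed by the letters, no tape influences another one; the
  condition on the rows of the trace splits into one for each column.\<close>

lemma trace_ok_columns:
  assumes "\<forall>l\<in>set ls. length (snd l) = length tps"
  shows "trace_ok A ls tps q \<longleftrightarrow> oracle_track A (map fst ls) q
     \<and> (\<forall>j<length tps. cells_ok (map (\<lambda>l. snd l ! j) ls) (tps ! j))"
  using assms
proof (induction ls arbitrary: tps q)
  case (Cons l ls)
  obtain x gs where l: "l = (x, gs)" by fastforce
  have len: "length gs = length tps" using Cons.prems l by simp
  have "trace_ok A ls (map2 cell_act gs tps) (oracle_act x q) \<longleftrightarrow>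
     oracle_track A (map fst ls) (oracle_act x q) \<and>
     (\<forall>j<length tps. cells_ok (map (\<lambda>l. snd l ! j) ls) (cell_act (gs ! j) (tps ! j)))"
    by (subst Cons.IH) (use Cons.prems len in auto)
  then show ?case using len by (auto simp: l list_all2_conv_all_nth)
qed simp

text \<open>Track \<open>s\<close> of a tape tells which cells contain the symbol
  \<open>s\<close>.\<close>

fun bit_op :: "nat \<Rightarrow> cell_op \<Rightarrow> op" where
  "bit_op s None = Nop"
| "bit_op s (Some (r, r', d)) = RW (r = s) (r' = s) d"

fun bit_track :: "op list \<Rightarrow> bool ptape \<Rightarrow> bool" where
  "bit_track [] W \<longleftrightarrow> True"
| "bit_track (RW r r' d # xs) W \<longleftrightarrow> scan W = r \<and> bit_track xs (act (r', d) W)"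
| "bit_track (_ # xs) W \<longleftrightarrow> bit_track xs W"

definition bounded_cell :: "nat \<Rightarrow> cell_op \<Rightarrow> bool" where
  "bounded_cell K g \<longleftrightarrow> (\<forall>r r' d. g = Some (r, r', d) \<longrightarrow> r < K \<and> r' < K)"

text \<open>Symbol 0 needs no track, being the symbol of the cells where all tracks are false. So a
  blank tape has blank tracks, which is how each sweep finds the bit tape.\<close>

lemma cells_ok_bits:
  assumes "\<forall>g\<in>set gs. bounded_cell K g" "\<forall>p. snd tp p < K"
  shows "cells_ok gs tp \<longleftrightarrow> (\<forall>s\<in>{1..<K}. bit_track (map (bit_op s) gs) (fst tp, \<lambda>p. snd tp p = s))"
  using assms
proof (induction gs arbitrary: tp)
  case (Cons g gs)
  obtain h T where tp: "tp = (h, T)" by fastforce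
  show ?case
  proof (cases g)
    case None
    then show ?thesis using Cons by simp
  next
    case (Some a)
    obtain r r' d where g: "g = Some (r, r', d)" using Some by (cases a) auto
    have lt: "r < K" "r' < K" using Cons.prems(1) g by (auto simp: bounded_cell_def)
    \<comment> \<open>A symbol below \<open>K\<close> that matches no track is 0, which settles the
      case \<open>r = 0\<close>.\<close>
    have scan: "T h = r \<longleftrightarrow> (\<forall>s\<in>{1..<K}. (T h = s) = (r = s))"
    proof
      assume *: "\<forall>s\<in>{1..<K}. (T h = s) = (r = s)"
      show "T h = r"
      proof (cases "r = 0")
        case True
        then have "T h \<notin> {1..<K}" using * by auto
        moreover have "T h < K" using Cons.prems(2) tp by auto
        ultimately show ?thesis using True by auto
      next
        case False
        then show ?thesis using * lt by auto
      qed
    qed auto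
    have upd: "(\<lambda>p. (T(h := r')) p = s) = (\<lambda>p. T p = s)(h := (r' = s))" for s by auto
    have "cells_ok gs (move_head d h, T(h := r')) \<longleftrightarrow>
      (\<forall>s\<in>{1..<K}. bit_track (map (bit_op s) gs) (move_head d h, \<lambda>p. (T(h := r')) p = s))"
      using Cons.IH[of "(move_head d h, T(h := r'))"] Cons.prems lt tp by simp
    then have "cells_ok gs (move_head d h, T(h := r')) \<longleftrightarrow>
      (\<forall>s\<in>{1..<K}. bit_track (map (bit_op s) gs) (move_head d h, (\<lambda>p. T p = s)(h := (r' = s))))"
      unfolding upd .
    then show ?thesis using scan by (auto simp: g tp)
  qed
qed simp

lemma run_bit_track:
  assumes "\<forall>x\<in>set xs. \<exists>s g. x = bit_op s g"
  shows "\<exists>W'. run A xs (W, q) = (if bit_track xs W then Some (W', q) else None)"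
  using assms
proof (induction xs arbitrary: W)
  case (Cons x xs)
  then obtain s g where x: "x = bit_op s g" by auto
  have IH: "\<exists>W'. run A xs (V, q) = (if bit_track xs V then Some (W', q) else None)" for V
    using Cons by auto
  show ?case
  proof (cases g)
    case None
    then show ?thesis using IH[of W] x by simp
  next
    case (Some a)
    obtain r r' d where "a = (r, r', d)" by (cases a)
    then show ?thesis using IH[of "act (r' = s, d) W"] x Some by auto
  qed
qed simp

lemma run_oracle_track:
  assumes "\<forall>x\<in>set xs. \<forall>r r' d. x \<noteq> RW r r' d"
  shows "run A xs (W, q) = None \<longleftrightarrow> \<not> oracle_track A xs q"
  using assms
proof (induction xs arbitrary: q)
  case (Cons x xs)
  then show ?case by (cases x) auto
qed simp

text \<open>Bit tracks neither read nor change the oracle tape, so any \<open>q\<close> can be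
  carried through and the sweeps are independent of each other.\<close>

lemma passes_bits:
  assumes "\<And>l i. l \<in> set ls \<Longrightarrow> i \<in> set idx \<Longrightarrow> \<exists>s g. \<phi> l i = bit_op s g"
  shows "passes A (length idx) (map (\<lambda>l. (f l, map (\<phi> l) idx)) ls) q
    \<longleftrightarrow> (\<forall>i\<in>set idx. bit_track (map (\<lambda>l. \<phi> l i) ls) blank_tape)"
  using assms
proof (induction idx arbitrary: q)
  case (Cons i idx)
  have *: "map (hd \<circ> snd) (map (\<lambda>l. (f l, map (\<phi> l) (i # idx))) ls) = map (\<lambda>l. \<phi> l i) ls"
    "map (map_prod id tl) (map (\<lambda>l. (f l, map (\<phi> l) (i # idx))) ls) = map (\<lambda>l. (f l, map (\<phi> l) idx)) ls"
    by auto
  have "\<forall>x\<in>set (map (\<lambda>l. \<phi> l i) ls). \<exists>s g. x = bit_op s g" using Cons.prems by auto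
  from run_bit_track[OF this, where A = A and W = blank_tape and q = q]
  obtain W' where "run A (map (\<lambda>l. \<phi> l i) ls) (blank_tape, q)
    = (if bit_track (map (\<lambda>l. \<phi> l i) ls) blank_tape then Some (W', q) else None)" by blast
  then show ?case using Cons.IH Cons.prems unfolding length_Cons passes.simps * by simp
qed simp

definition tracks :: "nat \<Rightarrow> nat \<Rightarrow> (nat \<times> nat) list" where
  "tracks B K = List.product [0..<B] [1..<K]"

text \<open>The oracle track is swept first; each further track belongs to a tape and a nonblank
  symbol.\<close>

definition letter_ops :: "nat \<Rightarrow> nat \<Rightarrow> letter \<Rightarrow> op list" where
  "letter_ops B K l = fst l # map (\<lambda>(j, s). bit_op s (snd l ! j)) (tracks B K)"

definition well_formed :: "nat \<Rightarrow> nat \<Rightarrow> letter \<Rightarrow> bool" where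
  "well_formed B K l \<longleftrightarrow> (\<forall>r r' d. fst l \<noteq> RW r r' d) \<and> length (snd l) = B \<and> (\<forall>g\<in>set (snd l). bounded_cell K g)"

lemma passes_letters:
  assumes wf: "\<forall>l\<in>set ls. well_formed B K l" and K: "K > 0"
  shows "passes A (Suc (length (tracks B K))) (map (\<lambda>l. (f l, letter_ops B K l)) ls) []
    \<longleftrightarrow> trace_ok A ls (replicate B (0, \<lambda>_. 0)) []"
proof -
  let ?\<phi> = "\<lambda>l (j, s). bit_op s (snd l ! j)"
  have *: "map (hd \<circ> snd) (map (\<lambda>l. (f l, letter_ops B K l)) ls) = map fst ls"
    "map (map_prod id tl) (map (\<lambda>l. (f l, letter_ops B K l)) ls) = map (\<lambda>l. (f l, map (?\<phi> l) (tracks B K))) ls"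
    by (auto simp: letter_ops_def)
  have or: "run A (map fst ls) (blank_tape, []) = None \<longleftrightarrow> \<not> oracle_track A (map fst ls) []"
    by (rule run_oracle_track) (use wf in \<open>auto simp: well_formed_def\<close>)
  have bits: "passes A (length (tracks B K)) (map (\<lambda>l. (f l, map (?\<phi> l) (tracks B K))) ls) q
      \<longleftrightarrow> (\<forall>i\<in>set (tracks B K). bit_track (map (\<lambda>l. ?\<phi> l i) ls) blank_tape)" for q
    by (rule passes_bits) auto
  have "(\<forall>i\<in>set (tracks B K). bit_track (map (\<lambda>l. ?\<phi> l i) ls) blank_tape)
    \<longleftrightarrow> (\<forall>j<B. \<forall>s\<in>{1..<K}. bit_track (map (bit_op s) (map (\<lambda>l. snd l ! j) ls)) (0, \<lambda>_. 0 = s))"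
    by (auto simp: tracks_def blank_tape_def comp_def)
  also have "\<dots> \<longleftrightarrow> (\<forall>j<B. cells_ok (map (\<lambda>l. snd l ! j) ls) (0, \<lambda>_. 0))"
  proof (intro all_cong1 imp_cong refl)
    fix j assume j: "j < B"
    have "\<forall>g\<in>set (map (\<lambda>l. snd l ! j) ls). bounded_cell K g"
      using wf j by (auto simp: well_formed_def)
    from cells_ok_bits[OF this, of "(0, \<lambda>_. 0)"] K
    show "(\<forall>s\<in>{1..<K}. bit_track (map (bit_op s) (map (\<lambda>l. snd l ! j) ls)) (0, \<lambda>_. 0 = s))
      \<longleftrightarrow> cells_ok (map (\<lambda>l. snd l ! j) ls) (0, \<lambda>_. 0)" by simp
  qed
  finally have "(\<forall>i\<in>set (tracks B K). bit_track (map (\<lambda>l. ?\<phi> l i) ls) blank_tape)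
    \<longleftrightarrow> (\<forall>j<B. cells_ok (map (\<lambda>l. snd l ! j) ls) (0, \<lambda>_. 0))" .
  moreover have "trace_ok A ls (replicate B (0, \<lambda>_. 0)) [] \<longleftrightarrow> oracle_track A (map fst ls) []
     \<and> (\<forall>j<B. cells_ok (map (\<lambda>l. snd l ! j) ls) (0, \<lambda>_. 0))"
    by (subst trace_ok_columns) (use wf in \<open>auto simp: well_formed_def\<close>)
  ultimately show ?thesis
    unfolding passes.simps * bits using or by (auto split: option.splits)
qed

section \<open>The letters of a machine\<close>

text \<open>
  The state and the input tape of a machine become two further tapes, initially blank. A state
  \<open>q\<close> is stored as \<open>q + 2\<close>, and 1 is the state in which the input head returns to the left end
  after the input has been written.
\<close>

fun input_code :: "input_symbol \<Rightarrow> nat" where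
  "input_code Left_End = 0"
| "input_code (Bit a) = (if a then 2 else 1)"
| "input_code Right_End = 3"

lemma input_code_eq [simp]: "input_code x = input_code y \<longleftrightarrow> x = y"
  by (cases x; cases y) auto

lemma input_code_0 [simp]: "input_code x = 0 \<longleftrightarrow> x = Left_End" "0 = input_code x \<longleftrightarrow> x = Left_End"
  by (cases x; auto)+

text \<open>The input becomes an ordinary tape without barriers, so a move blocked by an end marker
  is recorded as \<open>Stay\<close>.\<close>

definition clamp :: "input_symbol \<Rightarrow> direction \<Rightarrow> direction" where
  "clamp x d = (if x = Left_End \<and> d = Go_Left \<or> x = Right_End \<and> d = Go_Right then Stay else d)"

definition load_letter :: "nat \<Rightarrow> bool \<Rightarrow> letter" where
  "load_letter b a = (Nop, None # Some (0, input_code (Bit a), Go_Right) # replicate b None)"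

definition end_letter :: "nat \<Rightarrow> letter" where
  "end_letter b = (Nop, Some (0, 1, Stay) # Some (0, input_code Right_End, Stay) # replicate b None)"

definition back_letter :: "nat \<Rightarrow> input_symbol \<Rightarrow> letter" where
  "back_letter b x = (Nop, Some (1, 1, Stay) # Some (input_code x, input_code x, Go_Left) # replicate b None)"

definition start_letter :: "machine \<Rightarrow> letter" where
  "start_letter M = (Nop, Some (1, start_state M + 2, Stay) # Some (0, 0, Go_Right) # replicate (work_tapes M) None)"

definition final_letter :: "machine \<Rightarrow> letter" where
  "final_letter M = (Nop, Some (accept_state M + 2, accept_state M + 2, Stay) # None # replicate (work_tapes M) None)"

text \<open>A query has one letter for either answer; the sweep over the oracle track discards the
  wrong one.\<close>

fun instruction_letters :: "nat \<Rightarrow> instruction \<Rightarrow> letter set" where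
  "instruction_letters b (Step q x ys q' d acts out) =
     {(case out of None \<Rightarrow> Nop | Some a \<Rightarrow> Out a,
       Some (q + 2, q' + 2, Stay) # Some (input_code x, input_code x, clamp x d)
         # map2 (\<lambda>y (s, d). Some (y, s, d)) ys acts)}"
| "instruction_letters b (Query q y n) =
     (\<lambda>r. (Ask r, Some (q + 2, (if r then y else n) + 2, Stay) # None # replicate b None)) ` UNIV"

text \<open>The letters that may be guessed repeatedly. The loading letters and
  \<open>end_letter\<close> come with the input, and \<open>final_letter\<close> will be the only
  final entry of the table.\<close>

definition letters :: "machine \<Rightarrow> letter set" where
  "letters M = insert (start_letter M) (back_letter (work_tapes M) ` {x. x \<noteq> Left_End}
     \<union> (\<Union>i\<in>program M. instruction_letters (work_tapes M) i))"

section \<open>Loading the input and returning to its left end\<close>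

definition state_tape :: "nat \<Rightarrow> tape" where
  "state_tape s = (0, (\<lambda>_. 0)(0 := s))"

text \<open>The bits occupy the cells from 0 on, followed by the right marker. The left marker is
  coded as 0, so cell -1 carries it without having been written.\<close>

definition input_cells :: "bool list \<Rightarrow> int \<Rightarrow> nat" where
  "input_cells w p = (if 0 \<le> p \<and> p \<le> int (length w) then input_code (scan_input w (nat p + 1)) else 0)"

definition config_tapes :: "bool list \<Rightarrow> config \<Rightarrow> tape list" where
  "config_tapes w c = state_tape (state c + 2) # (int (input_head c) - 1, input_cells w) # tapes c"

definition return_tapes :: "nat \<Rightarrow> bool list \<Rightarrow> int \<Rightarrow> tape list" where
  "return_tapes b w p = state_tape 1 # (p, input_cells w) # replicate b (0, \<lambda>_. 0)"

lemma state_tape_simps [simp]: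
  "scan_tape (state_tape s) = s" "act_tape (s', Stay) (state_tape s) = state_tape s'"
  by (simp_all add: state_tape_def)

lemma idle_cells [simp]: "list_all2 cell_ok (replicate b None) tps \<longleftrightarrow> length tps = b"
  by (auto simp: list_all2_conv_all_nth)

lemma idle_acts [simp]: "length tps = b \<Longrightarrow> map2 cell_act (replicate b None) tps = tps"
  by (induction tps arbitrary: b) auto

lemma input_cells_head: "p \<le> length w + 1 \<Longrightarrow> input_cells w (int p - 1) = input_code (scan_input w p)"
  by (cases p) (auto simp: input_cells_def scan_input_def)

lemma input_cells_0: "- 1 \<le> p \<Longrightarrow> p \<le> int (length w) \<Longrightarrow> input_cells w p = 0 \<longleftrightarrow> p = - 1"
  by (auto simp: input_cells_def scan_input_def)

definition loaded :: "bool list \<Rightarrow> int \<Rightarrow> nat" where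
  "loaded u p = (if 0 \<le> p \<and> nat p < length u then input_code (Bit (u ! nat p)) else 0)"

lemma trace_load:
  "trace_ok A (map (load_letter b) w @ ls) ((0, \<lambda>_. 0) # (int (length u), loaded u) # replicate b (0, \<lambda>_. 0)) q
   \<longleftrightarrow> trace_ok A ls ((0, \<lambda>_. 0) # (int (length (u @ w)), loaded (u @ w)) # replicate b (0, \<lambda>_. 0)) q"
proof (induction w arbitrary: u)
  case (Cons a w)
  have "(loaded u)(int (length u) := input_code (Bit a)) = loaded (u @ [a])"
    by (rule ext) (auto simp: loaded_def nth_append)
  moreover have "loaded u (int (length u)) = 0" by (simp add: loaded_def)
  ultimately show ?case using Cons.IH[of "u @ [a]"] by (simp add: load_letter_def algebra_simps)
qed simp

lemma trace_prefix:
  "trace_ok A (map (load_letter b) w @ end_letter b # ls) (replicate (b + 2) (0, \<lambda>_. 0)) []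
   \<longleftrightarrow> trace_ok A ls (return_tapes b w (int (length w))) []"
proof -
  have T0: "loaded [] = (\<lambda>_. 0)" by (auto simp: loaded_def)
  have "trace_ok A (map (load_letter b) w @ end_letter b # ls) (replicate (b + 2) (0, \<lambda>_. 0)) []
    \<longleftrightarrow> trace_ok A (end_letter b # ls) ((0, \<lambda>_. 0) # (int (length w), loaded w) # replicate b (0, \<lambda>_. 0)) []"
    using trace_load[of A b w "end_letter b # ls" "[]" "[]"] T0 by simp
  moreover have "(loaded w)(int (length w) := 3) = input_cells w"
    by (rule ext) (auto simp: input_cells_def scan_input_def loaded_def)
  moreover have "loaded w (int (length w)) = 0" by (simp add: loaded_def)
  moreover have "act_tape (1, Stay) (0, \<lambda>_. 0) = state_tape 1" by (simp add: state_tape_def)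
  ultimately show ?thesis by (simp add: end_letter_def return_tapes_def)
qed

lemma initial_tapes: "config_tapes w (initial M) = state_tape (start_state M + 2) # (0, input_cells w)
   # replicate (work_tapes M) (0, \<lambda>_. 0)"
  by (simp add: config_tapes_def initial_def)

text \<open>State code 1 excludes the instruction letters and the final letter, whose state codes
  are at least 2. A return letter needs a nonblank cell and \<open>start_letter\<close> a blank one,
  so the machine is started exactly at the left end.\<close>

lemma return_sound:
  assumes "trace_ok A (ls @ [final_letter M]) (return_tapes (work_tapes M) w p) []"
    "- 1 \<le> p" "p \<le> int (length w)" "set ls \<subseteq> letters M"
  shows "\<exists>ls'. set ls' \<subseteq> letters M \<and> trace_ok A (ls' @ [final_letter M]) (config_tapes w (initial M)) []"
  using assms
proof (induction ls arbitrary: p)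
  case Nil
  then show ?case by (simp add: final_letter_def return_tapes_def)
next
  case (Cons l ls)
  from Cons.prems(4) consider "l = start_letter M" | x where "l = back_letter (work_tapes M) x" "x \<noteq> Left_End"
    | i where "i \<in> program M" "l \<in> instruction_letters (work_tapes M) i" by (auto simp: letters_def)
  then show ?case
  proof cases
    case 1
    then have "input_cells w p = 0" using Cons.prems by (simp add: start_letter_def return_tapes_def)
    then have p: "p = - 1" using input_cells_0 Cons.prems by blast
    then have "(input_cells w)(p := 0) = input_cells w" by (auto simp: input_cells_def)
    then have "trace_ok A (ls @ [final_letter M]) (config_tapes w (initial M)) []"
      using 1 Cons.prems p by (simp add: start_letter_def return_tapes_def initial_tapes)
    then show ?thesis using Cons.prems by auto
  next
    case 2
    then have *: "input_cells w p = input_code x" using Cons.prems by (simp add: back_letter_def return_tapes_def)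
    then have p: "p \<noteq> - 1" using 2 by (auto simp: input_cells_def)
    have "(input_cells w)(p := input_code x) = input_cells w" using * by auto
    then have "trace_ok A (ls @ [final_letter M]) (return_tapes (work_tapes M) w (p - 1)) []"
      using 2 Cons.prems by (simp add: back_letter_def return_tapes_def)
    then show ?thesis using Cons.IH[of "p - 1"] Cons.prems p by auto
  next
    case 3
    then show ?thesis using Cons.prems by (cases i) (auto simp: return_tapes_def)
  qed
qed

lemma return_complete:
  assumes "trace_ok A ls (config_tapes w (initial M)) []" "k \<le> length w + 1"
  shows "\<exists>bs. set bs \<subseteq> letters M \<and> length bs = k + 1 \<and> trace_ok A (bs @ ls) (return_tapes (work_tapes M) w (int k - 1)) []"
  using assms(2)
proof (induction k)
  case 0
  have "(input_cells w)(- 1 := 0) = input_cells w" "input_cells w (- 1) = 0" by (auto simp: input_cells_def)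
  then have "trace_ok A ([start_letter M] @ ls) (return_tapes (work_tapes M) w (int 0 - 1)) []"
    using assms(1) by (simp add: start_letter_def return_tapes_def initial_tapes)
  then show ?case by (intro exI[of _ "[start_letter M]"]) (auto simp: letters_def)
next
  case (Suc k)
  then obtain bs where bs: "set bs \<subseteq> letters M" "length bs = k + 1"
    "trace_ok A (bs @ ls) (return_tapes (work_tapes M) w (int k - 1)) []" by auto
  let ?x = "scan_input w (Suc k)"
  have x: "?x \<noteq> Left_End" by (auto simp: scan_input_def)
  have *: "input_cells w (int k) = input_code ?x" using input_cells_head[of "Suc k" w] Suc.prems by simp
  then have "(input_cells w)(int k := input_code ?x) = input_cells w" by auto
  with * bs(3) have "trace_ok A ((back_letter (work_tapes M) ?x # bs) @ ls) (return_tapes (work_tapes M) w (int (Suc k) - 1)) []"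
    by (simp add: back_letter_def return_tapes_def)
  then show ?case using bs x
    by (intro exI[of _ "back_letter (work_tapes M) ?x # bs"]) (auto simp: letters_def)
qed

section \<open>Letters and steps of the machine\<close>

lemma instruction_cells:
  assumes "length ys = b" "length acts = b" "length tps = b"
  shows "list_all2 cell_ok (map2 (\<lambda>y (s, d). Some (y, s, d)) ys acts) tps \<longleftrightarrow> map scan_tape tps = ys"
    "map2 cell_act (map2 (\<lambda>y (s, d). Some (y, s, d)) ys acts) tps = map2 act_tape acts tps"
proof -
  have "length ys = length acts" "length acts = length tps" using assms by auto
  then have "(list_all2 cell_ok (map2 (\<lambda>y (s, d). Some (y, s, d)) ys acts) tps \<longleftrightarrow> map scan_tape tps = ys) \<and>
    map2 cell_act (map2 (\<lambda>y (s, d). Some (y, s, d)) ys acts) tps = map2 act_tape acts tps"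
    by (induction ys acts tps rule: list_induct3) auto
  then show "list_all2 cell_ok (map2 (\<lambda>y (s, d). Some (y, s, d)) ys acts) tps \<longleftrightarrow> map scan_tape tps = ys"
    "map2 cell_act (map2 (\<lambda>y (s, d). Some (y, s, d)) ys acts) tps = map2 act_tape acts tps" by auto
qed

lemma clamp_move:
  "p \<le> length w + 1 \<Longrightarrow> move_head (clamp (scan_input w p) d) (int p - 1) = int (move_input w d p) - 1"
  "p \<le> length w + 1 \<Longrightarrow> move_input w d p \<le> length w + 1"
  by (cases d; cases p; auto simp: clamp_def scan_input_def)+

text \<open>The letter of a \<open>Step\<close> records exactly the reading that the instruction
  expects. For a \<open>Query\<close> exactly one of the two guessed answers is right, and its
  letter leads to the state that \<open>execute\<close> chooses.\<close>

lemma trace_instruction: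
  assumes wf: "instruction_wf b i" and len: "length (tapes c) = b" and p: "input_head c \<le> length w + 1"
  shows "(\<exists>l\<in>instruction_letters b i. trace_ok A (l # ls) (config_tapes w c) (oracle_tape c)) \<longleftrightarrow>
    applicable i (state c) (scan_input w (input_head c)) (map scan_tape (tapes c)) \<and>
    trace_ok A ls (config_tapes w (execute A w i c)) (oracle_tape (execute A w i c))"
proof (cases i)
  case (Step q x ys q' d acts out)
  have l: "length ys = b" "length acts = b" using wf Step by auto
  have upd: "(input_cells w)(int (input_head c) - 1 := input_code (scan_input w (input_head c))) = input_cells w"
    using input_cells_head[OF p] by auto
  have orc: "oracle_ok A (case out of None \<Rightarrow> Nop | Some a \<Rightarrow> Out a) q"
    "oracle_act (case out of None \<Rightarrow> Nop | Some a \<Rightarrow> Out a) q = (case out of None \<Rightarrow> q | Some a \<Rightarrow> q @ [a])" for q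
    by (auto split: option.splits)
  show ?thesis
    using instruction_cells[OF l len] input_cells_head[OF p] clamp_move(1)[OF p, of d] upd
    by (auto simp: Step config_tapes_def orc)
next
  case (Query q y n)
  then show ?thesis using len by (auto simp: config_tapes_def)
qed

lemma config_invariant:
  assumes "turing_machine M" "i \<in> program M" "length (tapes c) = work_tapes M" "input_head c \<le> length w + 1"
  shows "length (tapes (execute A w i c)) = work_tapes M" "input_head (execute A w i c) \<le> length w + 1"
proof -
  have "instruction_wf (work_tapes M) i" using assms by (auto simp: turing_machine_def)
  then show "length (tapes (execute A w i c)) = work_tapes M" "input_head (execute A w i c) \<le> length w + 1"
    using assms clamp_move(2) by (cases i; auto)+
qed

text \<open>All state codes are at least 2 from here on, so the start and return letters no longer
  fit.\<close>

lemma main_trace_sound: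
  assumes tm: "turing_machine M"
    and "trace_ok A (ls @ [final_letter M]) (config_tapes w c) (oracle_tape c)" "set ls \<subseteq> letters M"
    "length (tapes c) = work_tapes M" "input_head c \<le> length w + 1"
  shows "\<exists>c'. (step A M w)\<^sup>*\<^sup>* c c' \<and> state c' = accept_state M"
  using assms(2-)
proof (induction ls arbitrary: c)
  case Nil
  then show ?case by (auto simp: final_letter_def config_tapes_def)
next
  case (Cons l ls)
  from Cons.prems(2) consider "l = start_letter M" | x where "l = back_letter (work_tapes M) x"
    | i where "i \<in> program M" "l \<in> instruction_letters (work_tapes M) i" by (auto simp: letters_def)
  then show ?case
  proof cases
    case 1
    then show ?thesis using Cons.prems by (simp add: start_letter_def config_tapes_def)
  next
    case 2
    then show ?thesis using Cons.prems by (simp add: back_letter_def config_tapes_def)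
  next
    case 3
    have wf: "instruction_wf (work_tapes M) i" using tm 3 by (auto simp: turing_machine_def)
    have "\<exists>l\<in>instruction_letters (work_tapes M) i.
        trace_ok A (l # ls @ [final_letter M]) (config_tapes w c) (oracle_tape c)"
      using 3(2) Cons.prems(1) by auto
    then have *: "applicable i (state c) (scan_input w (input_head c)) (map scan_tape (tapes c))"
      "trace_ok A (ls @ [final_letter M]) (config_tapes w (execute A w i c)) (oracle_tape (execute A w i c))"
      unfolding trace_instruction[OF wf Cons.prems(3,4)] by auto
    have "step A M w c (execute A w i c)" using 3(1) *(1) by (auto simp: step_def)
    moreover have "\<exists>c'. (step A M w)\<^sup>*\<^sup>* (execute A w i c) c' \<and> state c' = accept_state M"
      using Cons.IH[OF *(2)] Cons.prems config_invariant[OF tm 3(1) Cons.prems(3,4)] by auto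
    ultimately show ?thesis by (meson converse_rtranclp_into_rtranclp)
  qed
qed

lemma main_trace_complete:
  assumes tm: "turing_machine M"
    and "(step A M w ^^ k) c c'" "state c' = accept_state M"
    "length (tapes c) = work_tapes M" "input_head c \<le> length w + 1"
  shows "\<exists>ls. set ls \<subseteq> letters M \<and> length ls = k \<and>
    trace_ok A (ls @ [final_letter M]) (config_tapes w c) (oracle_tape c)"
  using assms(2-)
proof (induction k arbitrary: c)
  case 0
  then show ?case by (auto simp: final_letter_def config_tapes_def)
next
  case (Suc k)
  obtain c1 where c1: "step A M w c c1" "(step A M w ^^ k) c1 c'"
    using relpowp_Suc_D2[OF Suc.prems(1)] by blast
  then obtain i where i: "i \<in> program M" "c1 = execute A w i c"
     "applicable i (state c) (scan_input w (input_head c)) (map scan_tape (tapes c))" by (auto simp: step_def)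
  have wf: "instruction_wf (work_tapes M) i" using tm i by (auto simp: turing_machine_def)
  obtain ls where ls: "set ls \<subseteq> letters M" "length ls = k"
     "trace_ok A (ls @ [final_letter M]) (config_tapes w c1) (oracle_tape c1)"
    using Suc.IH[OF c1(2) Suc.prems(2)] config_invariant[OF tm i(1) Suc.prems(3,4)] i(2) by blast
  then obtain l where "l \<in> instruction_letters (work_tapes M) i"
     "trace_ok A (l # ls @ [final_letter M]) (config_tapes w c) (oracle_tape c)"
    using trace_instruction[OF wf Suc.prems(3,4), of A "ls @ [final_letter M]"] i by blast
  then show ?case using ls i(1) by (intro exI[of _ "l # ls"]) (auto simp: letters_def)
qed

definition trace_of :: "machine \<Rightarrow> bool list \<Rightarrow> letter list \<Rightarrow> letter list" where
  "trace_of M w ls = map (load_letter (work_tapes M)) w @ end_letter (work_tapes M) # ls @ [final_letter M]"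

text \<open>\<open>final_letter\<close> only tests the state; that the machine halts there is due to
  \<open>accept_sink\<close>.\<close>

lemma trace_sound:
  assumes tm: "turing_machine M" and sink: "accept_sink M" and ls: "set ls \<subseteq> letters M"
    and ok: "trace_ok A (trace_of M w ls) (replicate (work_tapes M + 2) (0, \<lambda>_. 0)) []"
  shows "w \<in> language A M"
proof -
  have "trace_ok A (ls @ [final_letter M]) (return_tapes (work_tapes M) w (int (length w))) []"
    using ok unfolding trace_of_def trace_prefix .
  from return_sound[OF this _ _ ls] obtain ls' where ls': "set ls' \<subseteq> letters M"
    "trace_ok A (ls' @ [final_letter M]) (config_tapes w (initial M)) []" by auto
  have "\<exists>c'. (step A M w)\<^sup>*\<^sup>* (initial M) c' \<and> state c' = accept_state M"
    by (rule main_trace_sound[OF tm _ ls'(1)]) (use ls'(2) in \<open>auto simp: initial_def\<close>)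
  then show ?thesis using accept_sink_halted[OF sink]
    by (auto simp: language_def accepts_def halts_in_def)
qed

text \<open>There are \<open>length w + 1\<close> return letters, one start letter and one letter
  for each step.\<close>

lemma trace_complete:
  assumes tm: "turing_machine M" and t: "runs_within A M t" and w: "w \<in> language A M"
  shows "\<exists>ls. set ls \<subseteq> letters M \<and> length ls \<le> length w + 2 + t (length w) \<and>
    trace_ok A (trace_of M w ls) (replicate (work_tapes M + 2) (0, \<lambda>_. 0)) []"
proof -
  obtain c k where c: "(step A M w ^^ k) (initial M) c" "state c = accept_state M"
    using w by (auto simp: language_def accepts_def halts_in_def rtranclp_power)
  have k: "k \<le> t (length w)" using c(1) t by (auto simp: runs_within_def)
  have "\<exists>ls. set ls \<subseteq> letters M \<and> length ls = k \<and>
    trace_ok A (ls @ [final_letter M]) (config_tapes w (initial M)) (oracle_tape (initial M))"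
    by (rule main_trace_complete[OF tm c]) (auto simp: initial_def)
  then obtain ls where ls: "set ls \<subseteq> letters M" "length ls = k"
    "trace_ok A (ls @ [final_letter M]) (config_tapes w (initial M)) []" by (auto simp: initial_def)
  from return_complete[OF ls(3), of "length w + 1"] obtain bs where bs: "set bs \<subseteq> letters M"
    "length bs = length w + 2" "trace_ok A (bs @ ls @ [final_letter M]) (return_tapes (work_tapes M) w (int (length w))) []"
    by auto
  have "trace_ok A (trace_of M w (bs @ ls)) (replicate (work_tapes M + 2) (0, \<lambda>_. 0)) []"
    unfolding trace_of_def trace_prefix using bs(3) by simp
  then show ?thesis using bs ls k by (intro exI[of _ "bs @ ls"]) auto
qed

lemma finite_letters: "turing_machine M \<Longrightarrow> finite (letters M)"
proof -
  have "finite (instruction_letters b i)" for b i by (cases i) auto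
  moreover have "finite {x. x \<noteq> Left_End}" by (rule finite_subset[OF _ finite_input_symbol]) auto
  ultimately show "turing_machine M \<Longrightarrow> finite (letters M)"
    by (auto simp: letters_def turing_machine_def)
qed

lemma letters_shape:
  assumes "turing_machine M" "l \<in> letters M"
  shows "length (snd l) = work_tapes M + 2" "fst l \<noteq> RW r r' d"
proof -
  have "length (snd l) = b + 2 \<and> fst l \<noteq> RW r r' d" if "instruction_wf b i" "l \<in> instruction_letters b i" for b i
    using that by (cases i) (auto split: option.splits)
  then show "length (snd l) = work_tapes M + 2" "fst l \<noteq> RW r r' d"
    using assms by (auto simp: letters_def start_letter_def back_letter_def turing_machine_def)
qed

lemma ex_well_formed:
  assumes tm: "turing_machine M"
  shows "\<exists>K>0. \<forall>l \<in> letters M \<union> range (load_letter (work_tapes M)) \<union> {end_letter (work_tapes M), final_letter M}.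
    well_formed (work_tapes M + 2) K l"
proof -
  let ?L = "letters M \<union> range (load_letter (work_tapes M)) \<union> {end_letter (work_tapes M), final_letter M}"
  let ?S = "\<Union>l\<in>?L. \<Union>g\<in>set (snd l). \<Union>(r, r', d)\<in>set_option g. {r, r'}"
  have "finite ?L" using finite_letters[OF tm] by simp
  then have "finite ?S" by (auto simp del: finite_Un)
  then obtain K where K: "\<forall>s\<in>?S. s < K" using finite_nat_set_iff_bounded by blast
  have "bounded_cell (Suc K) g" if "l \<in> ?L" "g \<in> set (snd l)" for l g
    unfolding bounded_cell_def
  proof (intro allI impI)
    fix r r' d assume "g = Some (r, r', d)"
    then have "r \<in> ?S" "r' \<in> ?S" using that by (force simp del: UN_Un)+
    then show "r < Suc K \<and> r' < Suc K" using K by (simp add: less_SucI)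
  qed
  moreover have "length (snd l) = work_tapes M + 2 \<and> (\<forall>r r' d. fst l \<noteq> RW r r' d)" if "l \<in> ?L" for l
    using that letters_shape[OF tm, of l] by (auto simp: load_letter_def end_letter_def final_letter_def)
  ultimately show ?thesis unfolding well_formed_def by (intro exI[of _ "Suc K"]) blast
qed

section \<open>Reduction to the universal machine\<close>

text \<open>The final flag matters for guessing but not for the sweeps.\<close>

lemma passes_cong: "map snd bs = map snd bs' \<Longrightarrow> passes A k bs q \<longleftrightarrow> passes A k bs' q"
proof (induction k arbitrary: bs bs' q)
  case (Suc k)
  have 1: "map (hd \<circ> snd) bs = map (hd \<circ> snd) bs'"
    using arg_cong[OF Suc.prems, of "map hd"] by simp
  have "map snd (map (map_prod id tl) bs) = map snd (map (map_prod id tl) bs')"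
    using arg_cong[OF Suc.prems, of "map tl"] by (simp add: comp_def)
  then show ?case using 1 Suc.IH by (auto split: option.splits)
qed simp

text \<open>\<open>es\<close> is the program of \<open>M\<close> as a table of letters;
  \<open>lb\<close> and \<open>eb\<close> load the input. The bound counts a trace:
  \<open>length w + 1\<close> letters for loading, at most
  \<open>length w + 2 + t (length w)\<close> guessed ones and the final one.\<close>

lemma ex_checker_input:
  assumes tm: "turing_machine M" and sink: "accept_sink M" and t: "runs_within A M t"
  shows "\<exists>lb eb es C. \<forall>w.
     (\<forall>n. accepts_in A n (check_start (map lb w @ [eb]) es) \<longrightarrow> w \<in> language A M) \<and>
     (w \<in> language A M \<longrightarrow>
        accepts_in A (C * (2 * length w + 4 + t (length w))) (check_start (map lb w @ [eb]) es))"
proof -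
  let ?b = "work_tapes M"
  obtain K where K: "K > 0" "\<forall>l \<in> letters M \<union> range (load_letter ?b) \<union> {end_letter ?b, final_letter M}.
    well_formed (?b + 2) K l" using ex_well_formed[OF tm] by blast
  obtain ll where ll: "set ll = letters M" using finite_list[OF finite_letters[OF tm]] by blast
  define entry where "entry = (\<lambda>f l. (f :: bool, letter_ops (?b + 2) K l))"
  define lb where "lb = (\<lambda>a. entry False (load_letter ?b a))"
  define eb where "eb = entry False (end_letter ?b)"
  define es where "es = map (entry False) ll @ [entry True (final_letter M)]"
  define m where "m = Suc (length (tracks (?b + 2) K))"
  have len: "\<forall>b\<in>set (map lb w @ [eb]) \<union> set es. length (snd b) = m" for w
    by (auto simp: lb_def eb_def es_def entry_def m_def letter_ops_def)
  have nonfinal: "{b \<in> set es. \<not> fst b} = entry False ` letters M"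
    by (auto simp: es_def entry_def ll)
  have final: "e \<in> set es \<and> fst e \<longleftrightarrow> e = entry True (final_letter M)" for e
    by (auto simp: es_def entry_def)
  have passes: "passes A m ((map lb w @ [eb]) @ map (entry False) ls @ [entry True (final_letter M)]) []
    \<longleftrightarrow> trace_ok A (trace_of M w ls) (replicate (?b + 2) (0, \<lambda>_. 0)) []"
    if ls: "set ls \<subseteq> letters M" for w ls
  proof -
    have "passes A m ((map lb w @ [eb]) @ map (entry False) ls @ [entry True (final_letter M)]) []
      \<longleftrightarrow> passes A m (map (\<lambda>l. (False, letter_ops (?b + 2) K l)) (trace_of M w ls)) []"
      by (rule passes_cong) (simp add: lb_def eb_def entry_def trace_of_def)
    also have "\<dots> \<longleftrightarrow> trace_ok A (trace_of M w ls) (replicate (?b + 2) (0, \<lambda>_. 0)) []"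
      unfolding m_def by (rule passes_letters) (use K ls in \<open>auto simp: trace_of_def\<close>)
    finally show ?thesis .
  qed
  obtain C where C: "\<And>bs cs e. (\<forall>b\<in>set bs \<union> set es. length (snd b) = m) \<and> set cs \<subseteq> {b \<in> set es. \<not> fst b} \<and> e \<in> set es \<and> fst e
     \<and> passes A m (bs @ cs @ [e]) [] \<Longrightarrow> accepts_in A (C * length (bs @ cs @ [e])) (check_start bs es)"
    using check_complete[of es m A] by blast
  have "w \<in> language A M" if acc: "accepts_in A n (check_start (map lb w @ [eb]) es)" for w n
  proof -
    obtain cs e where cs: "set cs \<subseteq> entry False ` letters M" "e = entry True (final_letter M)"
      "passes A m ((map lb w @ [eb]) @ cs @ [e]) []"
      using check_sound[OF len acc] unfolding nonfinal using final by blast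
    have "cs \<in> lists (entry False ` letters M)" using cs(1) by auto
    then obtain ls where "cs = map (entry False) ls" "set ls \<subseteq> letters M"
      unfolding lists_image by auto
    then show ?thesis using cs passes trace_sound[OF tm sink] by blast
  qed
  moreover have "accepts_in A (C * (2 * length w + 4 + t (length w))) (check_start (map lb w @ [eb]) es)"
    if w: "w \<in> language A M" for w
  proof -
    obtain ls where ls: "set ls \<subseteq> letters M" "length ls \<le> length w + 2 + t (length w)"
      "trace_ok A (trace_of M w ls) (replicate (?b + 2) (0, \<lambda>_. 0)) []"
      using trace_complete[OF tm t w] by blast
    have "accepts_in A (C * length ((map lb w @ [eb]) @ map (entry False) ls @ [entry True (final_letter M)]))
      (check_start (map lb w @ [eb]) es)"
      by (rule C) (use len[of w] nonfinal final passes[OF ls(1)] ls in auto)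
    then show ?thesis by (rule accepts_in_mono[OF _ mult_le_mono2]) (use ls(2) in simp)
  qed
  ultimately show ?thesis by blast
qed

text \<open>A padding token is a single bit \<open>False\<close>, so a sequence of tokens can be
  stretched to any sufficient length without changing what it loads. The table goes into the tail
  \<open>e\<close>, which occurs once per word.\<close>

lemma (in universal) ex_block_code:
  fixes lb :: "bool \<Rightarrow> bool \<times> op list"
  shows "\<exists>c0. \<forall>c\<ge>c0. \<exists>h e. (\<forall>a. length (h a) = c) \<and> length e = c - 1 \<and>
     (\<forall>w. concat (map h w) @ e \<in> language A U \<longleftrightarrow>
        reaches_accept A (concat (map h w) @ e) (main_config (initial G) (check_start (map lb w @ [eb]) es)))"
proof -
  define ht where "ht = (\<lambda>a. map (\<lambda>s. Some (True, s)) (block 0 (lb a)))"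
  define et where "et = map (\<lambda>s. Some (True, s)) (block 0 eb) @ map (\<lambda>s. Some (False, s)) (blocks es)"
  define n where "n = (\<lambda>ts. length (concat (map token_bits ts)))"
  define padded where "padded = (\<lambda>c ts. ts @ replicate (c - n ts) None)"
  have len: "length (concat (map token_bits (padded c ts))) = c" if "n ts \<le> c" for c ts
  proof -
    have "length (concat (map token_bits (replicate k None))) = k" for k by (induction k) auto
    then show ?thesis using that by (simp add: padded_def n_def)
  qed
  have S: "concat (map (token_symbols a) (map (\<lambda>s. Some (a', s)) xs)) = (if a' = a then xs else [])" for a a' xs
    by (induction xs) auto
  have N: "concat (map (token_symbols a) (replicate k None)) = []" for a k by (induction k) auto
  have P: "concat (map (token_symbols a) (padded c ts)) = concat (map (token_symbols a) ts)" for a c ts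
    using N by (simp add: padded_def)
  show ?thesis
  \<comment> \<open>The summand 1 makes up for the tail having length \<open>c - 1\<close>
    only.\<close>
  proof (intro exI[of _ "n (ht True) + n (ht False) + n et + 1"] allI impI)
    fix c assume c: "c \<ge> n (ht True) + n (ht False) + n et + 1"
    define h where "h = (\<lambda>a. concat (map token_bits (padded c (ht a))))"
    define e where "e = concat (map token_bits (padded (c - 1) et))"
    have "length (h a) = c" for a unfolding h_def by (rule len) (use c in \<open>cases a; simp\<close>)
    moreover have "length e = c - 1" unfolding e_def by (rule len) (use c in simp)
    moreover have "concat (map h w) @ e \<in> language A U \<longleftrightarrow>
        reaches_accept A (concat (map h w) @ e) (main_config (initial G) (check_start (map lb w @ [eb]) es))" for w
    proof -
      define ts where "ts = concat (map (\<lambda>a. padded c (ht a)) w) @ padded (c - 1) et"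
      have "concat (map h w) = concat (map token_bits (concat (map (\<lambda>a. padded c (ht a)) w)))"
        by (induction w) (auto simp: h_def)
      then have x: "concat (map h w) @ e = concat (map token_bits ts)" by (simp add: ts_def e_def)
      have "concat (map (token_symbols a) (concat (map (\<lambda>a. padded c (ht a)) w)))
        = (if a then blocks (map lb w) else [])" for a
        by (induction w) (auto simp: P ht_def S simp del: map_map)
      then have "concat (map (token_symbols True) ts) = blocks (map lb w @ [eb])"
        "concat (map (token_symbols False) ts) = blocks es"
        by (simp_all add: ts_def P et_def S del: map_map)
      then show ?thesis
        unfolding x language_U_tokens[OF refl] by (simp add: start_check_def check_start_def)
    qed
    ultimately show "\<exists>h e. (\<forall>a. length (h a) = c) \<and> length e = c - 1 \<and>
     (\<forall>w. concat (map h w) @ e \<in> language A U \<longleftrightarrow>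
        reaches_accept A (concat (map h w) @ e) (main_config (initial G) (check_start (map lb w @ [eb]) es)))"
      by blast
  qed
qed

section \<open>Time bounds\<close>

lemma nat_bigo_iff:
  fixes t f :: "nat \<Rightarrow> nat"
  shows "(\<lambda>n. real (t n)) \<in> O(\<lambda>n. real (f n)) \<longleftrightarrow> (\<exists>C n0. \<forall>n\<ge>n0. t n \<le> C * f n)"
proof
  assume "(\<lambda>n. real (t n)) \<in> O(\<lambda>n. real (f n))"
  then obtain c where "eventually (\<lambda>n. norm (real (t n)) \<le> c * norm (real (f n))) at_top"
    by (elim landau_o.bigE)
  then obtain n0 where n0: "\<And>n. n \<ge> n0 \<Longrightarrow> real (t n) \<le> c * real (f n)"
    by (auto simp: eventually_at_top_linorder)
  have "t n \<le> nat \<lceil>c\<rceil> * f n" if "n \<ge> n0" for n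
  proof -
    have "real (t n) \<le> c * real (f n)" using n0[OF that] .
    also have "\<dots> \<le> real (nat \<lceil>c\<rceil>) * real (f n)" by (intro mult_right_mono) linarith+
    finally show ?thesis by (simp flip: of_nat_mult)
  qed
  then show "\<exists>C n0. \<forall>n\<ge>n0. t n \<le> C * f n" by blast
next
  assume "\<exists>C n0. \<forall>n\<ge>n0. t n \<le> C * f n"
  then obtain C n0 where C: "\<forall>n\<ge>n0. t n \<le> C * f n" by blast
  show "(\<lambda>n. real (t n)) \<in> O(\<lambda>n. real (f n))"
  proof (rule bigoI[of _ "real C"])
    show "eventually (\<lambda>n. norm (real (t n)) \<le> real C * norm (real (f n))) at_top"
      using C by (auto simp: eventually_at_top_linorder simp flip: of_nat_mult)
  qed
qed

lemma runs_in_O_iff: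
  "runs_in_O A M f \<longleftrightarrow> (\<exists>t C n0. runs_within A M t \<and> (\<forall>n\<ge>n0. t n \<le> C * f n))"
  unfolding runs_in_O_def nat_bigo_iff by blast

lemma time_bound_mono: "time_bound f \<Longrightarrow> m \<le> n \<Longrightarrow> f m \<le> f n"
  by (rule lift_Suc_mono_le) (auto simp: time_bound_def)

lemma runs_in_O_accept_sink:
  assumes "time_bound f" "turing_machine M" "runs_in_O A M f"
  obtains N where "turing_machine N" "deterministic M \<Longrightarrow> deterministic N" "work_tapes N = work_tapes M"
    "accept_sink N" "language A N = language A M" "runs_in_O A N f"
proof -
  obtain N where N: "turing_machine N" "deterministic M \<longrightarrow> deterministic N" "work_tapes N = work_tapes M"
    "accept_sink N" "language A N = language A M"
    "\<forall>t. runs_within A M t \<longrightarrow> runs_within A N (\<lambda>n. t n + 1)"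
    using ex_accept_sink[OF assms(2), of A] by blast
  obtain t C n0 where t: "runs_within A M t" "\<forall>n\<ge>n0. t n \<le> C * f n"
    using assms(3) unfolding runs_in_O_iff by blast
  have "t n + 1 \<le> (C + 1) * f n" if "n \<ge> max n0 1" for n
  proof -
    have "n \<le> f n" using assms(1) by (simp add: time_bound_def)
    moreover have "t n \<le> C * f n" "1 \<le> n" using that t(2) by auto
    ultimately show ?thesis by simp
  qed
  then have "runs_in_O A N f" unfolding runs_in_O_iff using N(6) t(1) by blast
  with N show ?thesis using that by blast
qed

text \<open>The finitely many exceptional values go into the constant. The shift to
  \<open>n + 1\<close> guarantees a positive factor, as \<open>f 0\<close> may be 0.\<close>

lemma time_le_shifted:
  assumes f: "time_bound f" and t: "\<forall>n\<ge>n0. t n \<le> C * f n"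
  shows "\<exists>C'. \<forall>n. t n \<le> C' * f (n + 1)"
proof (intro exI allI)
  fix n
  let ?S = "\<Sum>k<n0. t k"
  show "t n \<le> (C + ?S) * f (n + 1)"
  proof (cases "n < n0")
    case True
    have "n + 1 \<le> f (n + 1)" using f by (simp add: time_bound_def)
    then have "1 \<le> f (n + 1)" by simp
    then have "?S * 1 \<le> (C + ?S) * f (n + 1)" by (intro mult_mono) auto
    moreover have "t n \<le> ?S" using True by (intro member_le_sum) auto
    ultimately show ?thesis by simp
  next
    case False
    then have "t n \<le> C * f n" using t by simp
    also have "\<dots> \<le> (C + ?S) * f (n + 1)" using f by (intro mult_mono) (auto simp: time_bound_def)
    finally show ?thesis .
  qed
qed

text \<open>For \<open>n \<ge> 1\<close> the code of a word of length \<open>n\<close> has length at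
  most \<open>2 * c * n\<close>, so subhomogeneity for the factor \<open>2 * c\<close> brings the
  running time back to \<open>f n\<close>, up to a constant.\<close>

lemma runs_in_O_block_machine:
  assumes f: "time_bound f" "subhomogeneous f" and bc: "block_code D h e c" and D: "runs_in_O A D f"
  shows "runs_in_O A (block_code.block_machine D h e c) f"
proof -
  interpret block_code D h e c by fact
  obtain t C n0 where t: "runs_within A D t" "\<forall>n\<ge>n0. t n \<le> C * f n"
    using D unfolding runs_in_O_iff by blast
  have "1 \<le> 2 * c" using pos by simp
  then obtain c' where c': "\<forall>n\<ge>1. f (2 * c * n) \<le> c' * f n"
    using f(2) unfolding subhomogeneous_def by blast
  have "t (c * n + (c - 1)) \<le> (C * c') * f n" if n: "n \<ge> max n0 1" for n
  proof -
    have "1 * n \<le> c * n" using pos by (intro mult_le_mono1) simp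
    then have "n \<le> c * n + (c - 1)" unfolding mult_1 by (rule trans_le_add1)
    then have "n0 \<le> c * n + (c - 1)" using n by (meson le_trans max.boundedE)
    then have "t (c * n + (c - 1)) \<le> C * f (c * n + (c - 1))" using t by simp
    also have "f (c * n + (c - 1)) \<le> f (2 * c * n)"
    proof (rule time_bound_mono[OF f(1)])
      have "c * 1 \<le> c * n" using n by (intro mult_le_mono2) simp
      then have "c - 1 \<le> c * n" by linarith
      then have "c * n + (c - 1) \<le> c * n + c * n" by (rule add_left_mono)
      then show "c * n + (c - 1) \<le> 2 * c * n" by simp
    qed
    also have "\<dots> \<le> c' * f n" using c' n by simp
    finally show ?thesis by simp
  qed
  then show ?thesis unfolding runs_in_O_iff using runs_within_block_machine[OF t(1)] by blast
qed

theorem theorem2: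
  fixes A :: "bool list set" and f :: "nat \<Rightarrow> nat"
  assumes "time_bound f"
    and "time_constructible f"
    and "quasihomogeneous f"
    and "\<forall>b. DTIME_tapes b A f \<noteq> DTIME A f"
  shows "DTIME A f \<noteq> NTIME A f"
proof
  assume eq: "DTIME A f = NTIME A f"
  have ge: "n \<le> f n" for n using assms(1) by (simp add: time_bound_def)
  have sub: "subhomogeneous f" and super: "superhomogeneous f"
    using assms(3) by (auto simp: quasihomogeneous_def)
  obtain G k where G: "turing_machine G" "oracle_free G" "runs_in_O {} G f" "k < work_tapes G"
    and clock: "\<And>w. \<exists>c. halts_in {} G w c \<and> tape_has_ones (f (length w)) (tapes c ! k)"
    using assms(2) unfolding time_constructible_def by blast
  interpret universal G using G by unfold_locales
  obtain tG CG nG where tG: "runs_within {} G tG" "\<forall>n\<ge>nG. tG n \<le> CG * f n"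
    using G(3) unfolding runs_in_O_iff by blast
  have "2 * n + 2 + 2 * tG n \<le> (4 + 2 * CG) * f n" if "n \<ge> max nG 1" for n
  proof -
    have "tG n \<le> CG * f n" "n \<le> f n" "1 \<le> n" using that tG ge[of n] by auto
    then show ?thesis by (simp add: algebra_simps)
  qed
  then have "runs_in_O A U f" unfolding runs_in_O_iff using runs_within_U[OF tG(1)] by blast
  then have "language A U \<in> NTIME A f" using turing_machine_U unfolding NTIME_def by blast
  \<comment> \<open>The assumed equality is applied to a single language, that of
    \<open>U\<close>.\<close>
  then obtain D0 where D0: "turing_machine D0" "deterministic D0" "runs_in_O A D0 f" "language A U = language A D0"
    unfolding eq[symmetric] DTIME_def by blast
  obtain D where D: "turing_machine D" "deterministic D" "work_tapes D = work_tapes D0"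
    "accept_sink D" "language A D = language A U" "runs_in_O A D f"
    using runs_in_O_accept_sink[OF assms(1) D0(1,3)] D0(2,4) by metis
  \<comment> \<open>The machine \<open>D\<close> does not depend on \<open>L\<close>, and the block
    machines built from it keep its number of tapes.\<close>
  have "L \<in> DTIME_tapes (work_tapes D) A f" if "L \<in> DTIME A f" for L
  proof -
    obtain M0 where M0: "turing_machine M0" "runs_in_O A M0 f" "L = language A M0"
      using \<open>L \<in> DTIME A f\<close> unfolding DTIME_def by blast
    obtain M where M: "turing_machine M" "accept_sink M" "language A M = L" "runs_in_O A M f"
      using runs_in_O_accept_sink[OF assms(1) M0(1,2)] M0(3) by metis
    obtain t C0 n0 where t: "runs_within A M t" "\<forall>n\<ge>n0. t n \<le> C0 * f n"
      using M(4) unfolding runs_in_O_iff by blast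
    obtain Ct where Ct: "\<And>n. t n \<le> Ct * f (n + 1)" using time_le_shifted[OF assms(1) t(2)] by blast
    obtain lb eb es C where
      sound: "\<And>w n. accepts_in A n (check_start (map lb w @ [eb]) es) \<Longrightarrow> w \<in> L" and
      complete: "\<And>w. w \<in> L \<Longrightarrow>
        accepts_in A (C * (2 * length w + 4 + t (length w))) (check_start (map lb w @ [eb]) es)"
      using ex_checker_input[OF M(1,2) t(1)] unfolding M(3) by blast
    obtain c0 where c0: "\<And>c. c \<ge> c0 \<Longrightarrow> \<exists>h e. (\<forall>a. length (h a) = c) \<and> length e = c - 1 \<and>
      (\<forall>w. concat (map h w) @ e \<in> language A U \<longleftrightarrow>
        reaches_accept A (concat (map h w) @ e) (main_config (initial G) (check_start (map lb w @ [eb]) es)))"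
      using ex_block_code[of A lb eb es] by blast
    \<comment> \<open>The factor by which the budget of the checker may exceed
      \<open>f (length w + 1)\<close>; the added 1 keeps it positive even for
      \<open>C = 0\<close>.\<close>
    have "1 \<le> C * (4 + Ct) + 1" by simp
    then obtain c1 where c1: "\<forall>n\<ge>1. (C * (4 + Ct) + 1) * f n \<le> f (c1 * n)"
      using super unfolding superhomogeneous_def by blast
    \<comment> \<open>\<open>c0\<close> makes room for the tokens and \<open>c1\<close> lets the
      clock run long enough. The 1 makes \<open>c\<close> positive and gives
      \<open>c - 1 \<ge> c1\<close>, so that the code has length at least
      \<open>c1 * (length w + 1)\<close>.\<close>
    define c where "c = c0 + c1 + 1"
    have "c0 \<le> c" by (simp add: c_def)
    from c0[OF this] obtain h e where h: "\<And>a. length (h a) = c" "length e = c - 1" and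
      hU: "\<And>w. concat (map h w) @ e \<in> language A U \<longleftrightarrow>
        reaches_accept A (concat (map h w) @ e) (main_config (initial G) (check_start (map lb w @ [eb]) es))"
      by blast
    have bc: "block_code D h e c" using D h by unfold_locales (auto simp: c_def)
    interpret block_code D h e c by (rule bc)
    have "w \<in> L \<longleftrightarrow> code w \<in> language A D" for w
    proof
      assume w: "w \<in> L"
      let ?n = "length w"
      have "2 * ?n + 4 \<le> 4 * f (?n + 1)" using ge[of "?n + 1"] by simp
      then have "2 * ?n + 4 + t ?n \<le> (4 + Ct) * f (?n + 1)" using Ct[of ?n] by (simp add: algebra_simps)
      then have "C * (2 * ?n + 4 + t ?n) \<le> C * ((4 + Ct) * f (?n + 1))" by (rule mult_le_mono2)
      also have "\<dots> \<le> (C * (4 + Ct) + 1) * f (?n + 1)" by (simp add: algebra_simps)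
      also have "\<dots> \<le> f (c1 * (?n + 1))" using c1 le_add2 by blast
      also have "\<dots> \<le> f (length (code w))"
        by (rule time_bound_mono[OF assms(1)]) (simp add: length_code c_def algebra_simps)
      finally have le: "C * (2 * ?n + 4 + t ?n) \<le> f (length (code w))" .
      obtain d where d: "halts_in {} G (code w) d" "tape_has_ones (f (length (code w))) (tapes d ! k)"
        using clock by blast
      then obtain m where m: "(step {} G (code w) ^^ m) (initial G) d"
        by (auto simp: halts_in_def rtranclp_power)
      have "f (length (code w)) \<le> m" using ones_le_steps[OF G(1) m G(4) d(2)] .
      moreover have "state (initial G) \<in> states" by (simp add: initial_def states_def)
      ultimately have "reaches_accept A (code w) (main_config (initial G) (check_start (map lb w @ [eb]) es))"
        using main_complete[OF complete[OF w] m] le by simp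
      then show "code w \<in> language A D" using hU D(5) by (simp add: code_def)
    next
      assume "code w \<in> language A D"
      then have "reaches_accept A (code w) (main_config (initial G) (check_start (map lb w @ [eb]) es))"
        using hU D(5) by (simp add: code_def)
      from main_sound[OF this] show "w \<in> L" using sound by blast
    qed
    then have "L = language A block_machine" unfolding language_block_machine by blast
    moreover have "runs_in_O A block_machine f" using runs_in_O_block_machine[OF assms(1) sub bc D(6)] .
    moreover have "work_tapes block_machine = work_tapes D" by (simp add: block_machine_def)
    ultimately show ?thesis
      using turing_machine_block_machine deterministic_block_machine[OF D(2)]
      unfolding DTIME_tapes_def by blast
  qed
  moreover have "DTIME_tapes (work_tapes D) A f \<subseteq> DTIME A f"
    unfolding DTIME_tapes_def DTIME_def by blast
  ultimately have "DTIME_tapes (work_tapes D) A f = DTIME A f" by blast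
  with assms(4) show False by blast
qed

end
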